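(* Let $x,\beta\in(0,\infty)$, $\delta\in[0,\infty)$, $\gamma\in\mathbb{R}$, let $(\Omega,\mathcal{F},\mathbb{P},(\mathcal{F}_t)_{t\in[0,\infty)})$ be a stochastic basis, let $W\colon[0,\infty)\times\Omega\to\mathbb{R}$ be a standard $(\mathcal{F}_t)_{t\in[0,\infty)}$-Wiener process, let $X\colon[0,\infty)\times\Omega\to[0,\infty)$ be an adapted stochastic process with continuous sample paths satisfying $$dX_t=(\delta-\gamma X_t)\,dt+\beta\sqrt{X_t}\,dW_t,\qquad t\in[0,\infty),\qquad X_0=x,$$ and let $Z_t:=\sqrt{X_t}$ for all $t\in[0,\infty)$. Then for all $T,\varepsilon,p\in(0,\infty)$ it holds that $$\sup_{\substack{s,t\in[0,T]\\ s\ne t}}\left\|\frac{Z_t-Z_s}{|t-s|^{1/2}}\right\|_{L^p(\Omega;\mathbb{R})}+\left\|\sup_{\substack{s,t\in[0,T]\\ s\neq t}}\frac{|Z_t-Z_s|}{|t-s|^{1/2-\varepsilon}}\right\|_{L^p(\Omega;\mathbb{R})}<\infty .$$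
   Context: A stochastic basis is a probability space with a normal filtration (right-continuous, $\mathcal{F}_0$ contains all $\mathbb{P}$-null sets). For $p\in(0,\infty)$, $\|V\|_{L^p(\Omega;\mathbb{R})}=(\mathbb{E}[|V|^p])^{1/p}\in[0,\infty]$. *)

theory Defs
  imports "HOL-Probability.Probability"
begin

text \<open>
  Processes indexed by \<open>[0,\<infinity>)\<close> are functions on \<open>real\<close> of which only the values at
  nonnegative times are constrained. For this reason the library locale \<open>filtration\<close>, which
  quantifies over the whole index type, is not used here.
\<close>

locale stochastic_basis = prob_space M for M :: "'a measure" +
  fixes F :: "real \<Rightarrow> 'a measure"
  assumes subalgebra_filtration: "0 \<le> t \<Longrightarrow> subalgebra M (F t)"
    and filtration_mono: "0 \<le> s \<Longrightarrow> s \<le> t \<Longrightarrow> sets (F s) \<subseteq> sets (F t)"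
    and right_continuous: "0 \<le> t \<Longrightarrow> sets (F t) = (\<Inter>u\<in>{t<..}. sets (F u))"
    and null_sets_filtration: "null_sets M \<subseteq> sets (F 0)"

definition adapted_process :: "(real \<Rightarrow> 'a measure) \<Rightarrow> (real \<Rightarrow> 'a \<Rightarrow> real) \<Rightarrow> bool" where
  "adapted_process F X \<longleftrightarrow> (\<forall>t\<ge>0. X t \<in> borel_measurable (F t))"

definition progressively_measurable ::
    "(real \<Rightarrow> 'a measure) \<Rightarrow> (real \<Rightarrow> 'a \<Rightarrow> real) \<Rightarrow> bool" where
  "progressively_measurable F H \<longleftrightarrow>
     (\<forall>u\<ge>0. (\<lambda>(s, \<omega>). H s \<omega>) \<in> borel_measurable (restrict_space borel {0..u} \<Otimes>\<^sub>M F u))"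

locale standard_wiener_process = stochastic_basis M F
  for M :: "'a measure" and F :: "real \<Rightarrow> 'a measure" +
  fixes W :: "real \<Rightarrow> 'a \<Rightarrow> real"
  assumes wiener_adapted: "adapted_process F W"
    and wiener_zero: "AE \<omega> in M. W 0 \<omega> = 0"
    and wiener_continuous: "AE \<omega> in M. continuous_on {0..} (\<lambda>t. W t \<omega>)"
    and wiener_increment_normal:
      "0 \<le> s \<Longrightarrow> s < t \<Longrightarrow>
        distributed M lborel (\<lambda>\<omega>. W t \<omega> - W s \<omega>) (normal_density 0 (sqrt (t - s)))"
    and wiener_increment_indep:
      "0 \<le> s \<Longrightarrow> s < t \<Longrightarrow>
        indep_set (sets (F s))
          {(\<lambda>\<omega>. W t \<omega> - W s \<omega>) -` B \<inter> space M |B. B \<in> sets borel}"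

text \<open>
  The triple \<open>n\<close>, \<open>\<tau>\<close>, \<open>\<xi>\<close> encodes the simple integrand
  \<open>\<Sum>i<n. \<xi> i * indicator {\<tau> i<..\<tau> (Suc i)}\<close>, where \<open>\<xi> i\<close> is bounded and measurable at
  time \<open>\<tau> i\<close>.
\<close>

definition simple_integrand ::
    "'a measure \<Rightarrow> (real \<Rightarrow> 'a measure) \<Rightarrow> nat \<Rightarrow> (nat \<Rightarrow> real) \<Rightarrow> (nat \<Rightarrow> 'a \<Rightarrow> real) \<Rightarrow> bool" where
  "simple_integrand M F n \<tau> \<xi> \<longleftrightarrow>
     0 \<le> \<tau> 0 \<and>
     (\<forall>i<n. \<tau> i < \<tau> (Suc i) \<and> \<xi> i \<in> borel_measurable (F (\<tau> i)) \<and> bounded (\<xi> i ` space M))"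

definition simple_process ::
    "nat \<Rightarrow> (nat \<Rightarrow> real) \<Rightarrow> (nat \<Rightarrow> 'a \<Rightarrow> real) \<Rightarrow> real \<Rightarrow> 'a \<Rightarrow> real" where
  "simple_process n \<tau> \<xi> t \<omega> = (\<Sum>i<n. \<xi> i \<omega> * indicator {\<tau> i<..\<tau> (Suc i)} t)"

definition simple_integral ::
    "(real \<Rightarrow> 'a \<Rightarrow> real) \<Rightarrow> nat \<Rightarrow> (nat \<Rightarrow> real) \<Rightarrow> (nat \<Rightarrow> 'a \<Rightarrow> real) \<Rightarrow> real \<Rightarrow> 'a \<Rightarrow> real" where
  "simple_integral W n \<tau> \<xi> t \<omega> =
     (\<Sum>i<n. \<xi> i \<omega> * (W (min (\<tau> (Suc i)) t) \<omega> - W (min (\<tau> i) t) \<omega>))"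

definition null_in_probability :: "'a measure \<Rightarrow> (nat \<Rightarrow> 'a \<Rightarrow> ennreal) \<Rightarrow> bool" where
  "null_in_probability M D \<longleftrightarrow>
     (\<forall>e>0. (\<lambda>k. measure M {\<omega> \<in> space M. ennreal e < D k \<omega>}) \<longlonglongrightarrow> 0)"

text \<open>
  \<open>has_ito_integral M F W H t Y\<close>: the random variable \<open>Y\<close> is a version of the Ito integral of
  \<open>H\<close> with respect to \<open>W\<close> over \<open>[0,t]\<close>. As usual, for a progressively measurable \<open>H\<close> which is
  almost surely square integrable on \<open>[0,t]\<close>, this is the limit in probability of the integrals of
  simple integrands which converge to \<open>H\<close> in \<open>L\<^sup>2([0,t])\<close> in probability. Such simple integrands
  always exist, and up to null sets the limit does not depend on their choice.
\<close>

definition has_ito_integral ::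
    "'a measure \<Rightarrow> (real \<Rightarrow> 'a measure) \<Rightarrow> (real \<Rightarrow> 'a \<Rightarrow> real) \<Rightarrow> (real \<Rightarrow> 'a \<Rightarrow> real) \<Rightarrow>
      real \<Rightarrow> ('a \<Rightarrow> real) \<Rightarrow> bool" where
  "has_ito_integral M F W H t Y \<longleftrightarrow>
     progressively_measurable F H \<and>
     (AE \<omega> in M. (\<integral>\<^sup>+s\<in>{0..t}. ennreal ((H s \<omega>)\<^sup>2) \<partial>lborel) < \<infinity>) \<and>
     Y \<in> borel_measurable M \<and>
     (\<exists>n \<tau> \<xi>.
        (\<forall>k. simple_integrand M F (n k) (\<tau> k) (\<xi> k)) \<and>
        null_in_probability M
          (\<lambda>k \<omega>. \<integral>\<^sup>+s\<in>{0..t}. ennreal ((simple_process (n k) (\<tau> k) (\<xi> k) s \<omega> - H s \<omega>)\<^sup>2) \<partial>lborel) \<and>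
        null_in_probability M
          (\<lambda>k \<omega>. ennreal \<bar>simple_integral W (n k) (\<tau> k) (\<xi> k) t \<omega> - Y \<omega>\<bar>))"

text \<open>
  \<open>dX\<^sub>t = a(X\<^sub>t) dt + b(X\<^sub>t) dW\<^sub>t\<close> for \<open>t \<in> [0,\<infinity>)\<close>, in the integrated form, which is required
  almost surely for each \<open>t\<close>.
\<close>

definition solves_sde ::
    "'a measure \<Rightarrow> (real \<Rightarrow> 'a measure) \<Rightarrow> (real \<Rightarrow> 'a \<Rightarrow> real) \<Rightarrow> (real \<Rightarrow> real) \<Rightarrow> (real \<Rightarrow> real) \<Rightarrow>
      (real \<Rightarrow> 'a \<Rightarrow> real) \<Rightarrow> bool" where
  "solves_sde M F W a b X \<longleftrightarrow>
     (\<forall>t\<ge>0.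
        (AE \<omega> in M. set_integrable lborel {0..t} (\<lambda>s. a (X s \<omega>))) \<and>
        (\<exists>Y. has_ito_integral M F W (\<lambda>s \<omega>. b (X s \<omega>)) t Y \<and>
             (AE \<omega> in M. X t \<omega> = X 0 \<omega> + (LINT s:{0..t}|lborel. a (X s \<omega>)) + Y \<omega>)))"

text \<open>
  Powers with real exponent \<open>p > 0\<close> on \<open>[0,\<infinity>]\<close>. The \<open>L\<^sup>p\<close> norm is stated for \<open>[0,\<infinity>]\<close>-valued
  functions, to be applied to the absolute value of a real random variable, so that
  suprema which may be infinite are covered as well.
\<close>

definition ennpowr :: "ennreal \<Rightarrow> real \<Rightarrow> ennreal" where
  "ennpowr y p = (if y = \<infinity> then \<infinity> else ennreal (enn2real y powr p))"

definition Lp_norm :: "'a measure \<Rightarrow> real \<Rightarrow> ('a \<Rightarrow> ennreal) \<Rightarrow> ennreal" where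
  "Lp_norm M p V = ennpowr (\<integral>\<^sup>+\<omega>. ennpowr (V \<omega>) p \<partial>M) (1 / p)"

end

(*
  For a simple integrand the exponential E exp(l I - l^2 <I> / 2) of its integral I equals 1, by
  conditioning on one Gaussian increment after the other. Hence two simple integrals with close
  integrands are close in probability, and in the limit the Ito integral satisfies an exponential
  supermartingale inequality; neither Ito's formula nor the Ito isometry is needed. The equation
  expresses the Ito integral and its quadratic variation through X and the integral of X alone, so
  for an affine weight lambda(u) with lambda' <= gamma lambda - beta^2 lambda^2 the inequality turns
  into E[exp(lambda(t) X_t) | F_s] <= C exp(lambda(s) X_s). With lambda(t) of order
  (h (X_s + h))^(-1/2), h = t - s, this bounds the exponential moments of
  |X_t - X_s| / (h (X_s + h))^(1/2) uniformly, and |Z_t - Z_s| <= 2 |X_t - X_s| / (X_s + h)^(1/2) + h^(1/2)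
  then bounds all moments of (Z_t - Z_s) / h^(1/2). The pathwise estimate follows by the dyadic
  argument of Kolmogorov and Chentsov.
*)

theory Submission
  imports Defs
begin

text \<open>The obstacle is the boundary point 0. No Feller-type relation between
  \<open>\<delta>\<close> and \<open>\<beta>\<close> is imposed, so \<open>X\<close> may reach 0,
  where the square root is not differentiable and the formal equation of \<open>Z\<close> has a
  drift of order \<open>1 / Z\<close>. Hence all stochastic estimates are made for \<open>X\<close>,
  and the root enters only through an elementary inequality. The quantity sqrt(h (X_s + h)) is the
  natural size of an increment of \<open>X\<close> over a time h: the stochastic part is of order
  sqrt(h X_s), and near 0 the process moves by order h. It depends on the left end only, so it is
  known at time s. Conditional expectations are encoded by weights: an inequality conditional on
  time s is stated as an inequality of integrals against an arbitrary nonnegative \<open>G\<close>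
  measurable at time s. Since all integrands are nonnegative, Tonelli's theorem and Fatou's lemma do
  the work that localisation by stopping times usually does. Only the finiteness of constants
  matters at the end, so sharp constants are given up whenever that shortens the argument.\<close>

section \<open>Exponentials of Wiener increments\<close>

text \<open>Completing the square: tilting the centred normal density by the exponential shifts its
  mean to \<open>a * \<sigma>\<^sup>2\<close>, and the subtracted term is exactly what keeps the
  total mass 1.\<close>

lemma gaussian_exponential_nn_integral:
  assumes "\<sigma> > 0"
  shows "(\<integral>\<^sup>+y. ennreal (exp (a * y - a\<^sup>2 * \<sigma>\<^sup>2 / 2)) \<partial>density lborel (normal_density 0 \<sigma>)) = 1"
proof -
  have "normal_density 0 \<sigma> y * exp (a * y - a\<^sup>2 * \<sigma>\<^sup>2 / 2) = normal_density (a * \<sigma>\<^sup>2) \<sigma> y" for y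
  proof -
    have "- (y - 0)\<^sup>2 / (2 * \<sigma>\<^sup>2) + (a * y - a\<^sup>2 * \<sigma>\<^sup>2 / 2) = - (y - a * \<sigma>\<^sup>2)\<^sup>2 / (2 * \<sigma>\<^sup>2)"
      using assms by (simp add: field_simps power2_eq_square)
    then show ?thesis
      unfolding normal_density_def mult.assoc by (simp only: exp_add[symmetric])
  qed
  then have "(\<integral>\<^sup>+y. ennreal (exp (a * y - a\<^sup>2 * \<sigma>\<^sup>2 / 2)) \<partial>density lborel (normal_density 0 \<sigma>)) =
      (\<integral>\<^sup>+y. normal_density (a * \<sigma>\<^sup>2) \<sigma> y \<partial>lborel)"
    by (subst nn_integral_density) (auto simp: ennreal_mult'[symmetric])
  also have "\<dots> = 1"
    using assms by (simp add: nn_integral_eq_integral integrable_normal_density integral_normal_density)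
  finally show ?thesis .
qed

context stochastic_basis
begin

lemma filtration_space: "0 \<le> t \<Longrightarrow> space (F t) = space M"
  using subalgebra_filtration[of t] by (simp add: subalgebra_def)

lemma filtration_subset: "0 \<le> t \<Longrightarrow> sets (F t) \<subseteq> sets M"
  using subalgebra_filtration[of t] by (simp add: subalgebra_def)

lemma filtration_measurable_mono:
  "0 \<le> s \<Longrightarrow> s \<le> t \<Longrightarrow> f \<in> measurable (F s) N \<Longrightarrow> f \<in> measurable (F t) N"
  using filtration_mono[of s t] by (auto simp: measurable_def filtration_space)

lemma filtration_measurable: "0 \<le> s \<Longrightarrow> f \<in> measurable (F s) N \<Longrightarrow> f \<in> measurable M N"
  using subalgebra_filtration measurable_from_subalg by blast

end

context standard_wiener_process
begin

lemma wiener_measurable: "0 \<le> s \<Longrightarrow> W s \<in> borel_measurable (F s)"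
  using wiener_adapted by (auto simp: adapted_process_def)

lemma wiener_measurable_M: "0 \<le> s \<Longrightarrow> W s \<in> borel_measurable M"
  using wiener_measurable filtration_measurable by blast

text \<open>Independence of the increment from the past, in the form that iterated integration
  needs: this product law replaces conditioning on \<open>F s\<close>. On rectangles it is the
  independence axiom, and rectangles determine the measure.\<close>

lemma increment_product_distribution:
  assumes "0 \<le> s" "s < t"
  shows "distr M (F s \<Otimes>\<^sub>M borel) (\<lambda>\<omega>. (\<omega>, W t \<omega> - W s \<omega>)) =
    distr M (F s) (\<lambda>\<omega>. \<omega>) \<Otimes>\<^sub>M density lborel (normal_density 0 (sqrt (t - s)))"
proof -
  have W: "(\<lambda>\<omega>. W t \<omega> - W s \<omega>) \<in> borel_measurable M"
    using assms by (intro borel_measurable_diff wiener_measurable_M) auto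
  have id: "(\<lambda>\<omega>. \<omega>) \<in> measurable M (F s)"
    using filtration_subset[OF assms(1)] filtration_space[OF assms(1)] sets.sets_into_space[of _ M]
    by (auto intro!: measurableI simp: Int_absorb2)
  let ?N = "density lborel (normal_density 0 (sqrt (t - s)))"
  have N: "?N = distr M borel (\<lambda>\<omega>. W t \<omega> - W s \<omega>)"
    using wiener_increment_normal[OF assms]
    by (subst distributed_distr_eq_density[symmetric]) (auto intro: distr_cong)
  interpret N: prob_space ?N
    using assms by (intro prob_space_normal_density) simp
  interpret D: prob_space "distr M (F s) (\<lambda>\<omega>. \<omega>)"
    using id by (rule prob_space_distr)
  show ?thesis
  proof (rule sym, rule pair_measure_eqI)
    fix A B
    assume A: "A \<in> sets (distr M (F s) (\<lambda>\<omega>. \<omega>))" and B: "B \<in> sets ?N"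
    then have AB: "A \<in> sets (F s)" "B \<in> sets borel" and AM: "A \<in> sets M"
      using filtration_subset[OF assms(1)] by auto
    let ?C = "(\<lambda>\<omega>. W t \<omega> - W s \<omega>) -` B \<inter> space M"
    have "?C \<in> sets M"
      using W AB(2) by (rule measurable_sets)
    have "emeasure (distr M (F s \<Otimes>\<^sub>M borel) (\<lambda>\<omega>. (\<omega>, W t \<omega> - W s \<omega>))) (A \<times> B) = emeasure M (A \<inter> ?C)"
      using W id AB by (subst emeasure_distr) (auto intro!: arg_cong[where f="emeasure M"])
    also have "\<dots> = emeasure M A * emeasure M ?C"
    proof -
      have "prob (A \<inter> ?C) = prob A * prob ?C"
        using AB by (intro indep_setD[OF wiener_increment_indep[OF assms]]) auto
      then show ?thesis
        by (simp add: emeasure_eq_measure ennreal_mult)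
    qed
    also have "emeasure M A = emeasure (distr M (F s) (\<lambda>\<omega>. \<omega>)) A"
      using id AB sets.sets_into_space[OF AM] by (subst emeasure_distr) (auto simp: Int_absorb2)
    also have "emeasure M ?C = emeasure ?N B"
      unfolding N using W AB by (subst emeasure_distr) auto
    finally show "emeasure (distr M (F s) (\<lambda>\<omega>. \<omega>)) A * emeasure ?N B =
        emeasure (distr M (F s \<Otimes>\<^sub>M borel) (\<lambda>\<omega>. (\<omega>, W t \<omega> - W s \<omega>))) (A \<times> B)" ..
  qed (auto intro: N.sigma_finite_measure_axioms D.sigma_finite_measure_axioms cong: sets_pair_measure_cong)
qed

text \<open>Under the product law \<open>G\<close> and \<open>c\<close> are constants in the inner
  integral over the increment, which is then the Gaussian integral with
  \<open>a = c \<omega>\<close> and variance \<open>t - s\<close>. Nonnegativity lets Tonelli's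
  theorem handle unbounded \<open>G\<close> and \<open>c\<close>.\<close>

lemma exponential_increment:
  assumes "0 \<le> s" "s < t" and G: "G \<in> borel_measurable (F s)" and c: "c \<in> borel_measurable (F s)"
  shows "(\<integral>\<^sup>+\<omega>. G \<omega> * ennreal (exp (c \<omega> * (W t \<omega> - W s \<omega>) - (c \<omega>)\<^sup>2 * (t - s) / 2)) \<partial>M) =
    (\<integral>\<^sup>+\<omega>. G \<omega> \<partial>M)"
proof -
  let ?g = "\<lambda>(\<omega>, y). G \<omega> * ennreal (exp (c \<omega> * y - (c \<omega>)\<^sup>2 * (t - s) / 2))"
  let ?N = "density lborel (normal_density 0 (sqrt (t - s)))"
  have W: "(\<lambda>\<omega>. W t \<omega> - W s \<omega>) \<in> borel_measurable M"
    using assms by (intro borel_measurable_diff wiener_measurable_M) auto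
  have id: "(\<lambda>\<omega>. \<omega>) \<in> measurable M (F s)"
    using filtration_subset[OF assms(1)] filtration_space[OF assms(1)] sets.sets_into_space[of _ M]
    by (auto intro!: measurableI simp: Int_absorb2)
  interpret N: prob_space ?N
    using assms by (intro prob_space_normal_density) simp
  note [measurable] = G c
  have g: "?g \<in> borel_measurable (F s \<Otimes>\<^sub>M borel)"
    by measurable
  have "(\<integral>\<^sup>+\<omega>. G \<omega> * ennreal (exp (c \<omega> * (W t \<omega> - W s \<omega>) - (c \<omega>)\<^sup>2 * (t - s) / 2)) \<partial>M) =
      (\<integral>\<^sup>+z. ?g z \<partial>distr M (F s \<Otimes>\<^sub>M borel) (\<lambda>\<omega>. (\<omega>, W t \<omega> - W s \<omega>)))"
    using g W id by (subst nn_integral_distr) auto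
  also have "\<dots> = (\<integral>\<^sup>+\<omega>. \<integral>\<^sup>+y. ?g (\<omega>, y) \<partial>?N \<partial>distr M (F s) (\<lambda>\<omega>. \<omega>))"
    unfolding increment_product_distribution[OF assms(1,2)]
    using g by (intro N.nn_integral_fst[symmetric]) (auto cong: measurable_cong_sets)
  also have "\<dots> = (\<integral>\<^sup>+\<omega>. G \<omega> \<partial>distr M (F s) (\<lambda>\<omega>. \<omega>))"
  proof (intro nn_integral_cong)
    fix \<omega>
    have "(\<integral>\<^sup>+y. ennreal (exp (c \<omega> * y - (c \<omega>)\<^sup>2 * (t - s) / 2)) \<partial>?N) = 1"
      using gaussian_exponential_nn_integral[of "sqrt (t - s)" "c \<omega>"] assms by simp
    then show "(\<integral>\<^sup>+y. ?g (\<omega>, y) \<partial>?N) = G \<omega>"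
      by (simp add: nn_integral_cmult)
  qed
  also have "\<dots> = (\<integral>\<^sup>+\<omega>. G \<omega> \<partial>M)"
    using id G by (subst nn_integral_distr) auto
  finally show ?thesis .
qed

text \<open>The increments are integrated out from the last one backwards: \<open>G\<close> times
  the exponential of the first \<open>N\<close> terms is measurable at time \<open>q N\<close>, so
  it can serve as the weight in \<open>exponential_increment\<close>.\<close>

lemma exponential_grid:
  assumes "0 \<le> q 0" "\<And>j. j < N \<Longrightarrow> q j < q (Suc j)"
    and G: "G \<in> borel_measurable (F (q 0))"
    and c: "\<And>j. j < N \<Longrightarrow> c j \<in> borel_measurable (F (q j))"
  shows "(\<integral>\<^sup>+\<omega>. G \<omega> * ennreal (exp ((\<Sum>j<N. c j \<omega> * (W (q (Suc j)) \<omega> - W (q j) \<omega>)) -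
      (\<Sum>j<N. (c j \<omega>)\<^sup>2 * (q (Suc j) - q j)) / 2)) \<partial>M) = (\<integral>\<^sup>+\<omega>. G \<omega> \<partial>M)"
  using assms(2) c
proof (induction N)
  case 0
  then show ?case by simp
next
  case (Suc N)
  have mono: "i \<le> j \<Longrightarrow> j \<le> Suc N \<Longrightarrow> q i \<le> q j" for i j
  proof (induction j rule: dec_induct)
    case (step k)
    then show ?case using Suc.prems(1)[of k] by linarith
  qed auto
  have pos: "0 \<le> q j" if "j \<le> Suc N" for j
    using mono[of 0 j] that assms(1) by simp
  define H where "H \<omega> = G \<omega> * ennreal (exp ((\<Sum>j<N. c j \<omega> * (W (q (Suc j)) \<omega> - W (q j) \<omega>)) -
      (\<Sum>j<N. (c j \<omega>)\<^sup>2 * (q (Suc j) - q j)) / 2))" for \<omega>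
  have meas: "c j \<in> borel_measurable (F (q N))" if "j < N" for j
    using Suc.prems(2)[of j] that mono pos by (intro filtration_measurable_mono[of "q j" "q N"]) auto
  have measW: "W (q j) \<in> borel_measurable (F (q N))" if "j \<le> N" for j
    using that mono pos by (intro filtration_measurable_mono[OF _ _ wiener_measurable]) auto
  have [measurable]: "(\<lambda>\<omega>. \<Sum>j<N. c j \<omega> * (W (q (Suc j)) \<omega> - W (q j) \<omega>)) \<in> borel_measurable (F (q N))"
    "(\<lambda>\<omega>. \<Sum>j<N. (c j \<omega>)\<^sup>2 * (q (Suc j) - q j)) \<in> borel_measurable (F (q N))"
    using meas measW
    by (intro borel_measurable_sum borel_measurable_times borel_measurable_diff
        borel_measurable_power; force)+
  have [measurable]: "G \<in> borel_measurable (F (q N))"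
    using mono[of 0 N] assms(1) by (intro filtration_measurable_mono[OF _ _ G]) auto
  have "H \<in> borel_measurable (F (q N))"
    unfolding H_def by measurable
  then have "(\<integral>\<^sup>+\<omega>. H \<omega> * ennreal (exp (c N \<omega> * (W (q (Suc N)) \<omega> - W (q N) \<omega>) -
      (c N \<omega>)\<^sup>2 * (q (Suc N) - q N) / 2)) \<partial>M) = (\<integral>\<^sup>+\<omega>. H \<omega> \<partial>M)"
    using Suc.prems pos by (intro exponential_increment) auto
  also have "\<dots> = (\<integral>\<^sup>+\<omega>. G \<omega> \<partial>M)"
    unfolding H_def using Suc.prems by (intro Suc.IH) auto
  also have "(\<lambda>\<omega>. H \<omega> * ennreal (exp (c N \<omega> * (W (q (Suc N)) \<omega> - W (q N) \<omega>) -
      (c N \<omega>)\<^sup>2 * (q (Suc N) - q N) / 2))) = (\<lambda>\<omega>. G \<omega> * ennreal (exp ((\<Sum>j<Suc N. c j \<omega> * (W (q (Suc j)) \<omega> - W (q j) \<omega>)) -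
      (\<Sum>j<Suc N. (c j \<omega>)\<^sup>2 * (q (Suc j) - q j)) / 2)))"
    unfolding H_def
    by (intro ext) (simp only: mult.assoc ennreal_mult[symmetric] exp_ge_zero exp_add[symmetric]
        sum.lessThan_Suc add_divide_distrib diff_conv_add_uminus minus_add_distrib ac_simps)
  finally show ?case .
qed

end

section \<open>Integrals of simple integrands\<close>

text \<open>Applied to the partition points of two simple integrands at once, this yields cells on
  which both are constant. Since \<open>a\<close> and \<open>b\<close> are grid points too,
  integrals over a part of the time axis start and end on the grid.\<close>

lemma finite_set_grid:
  fixes a b :: real
  assumes "finite P" "a < b"
  obtains q :: "nat \<Rightarrow> real" and N where "q 0 = a" "q N = b" "\<And>j. j < N \<Longrightarrow> q j < q (Suc j)"
    "\<And>p j. p \<in> P \<Longrightarrow> j < N \<Longrightarrow> p \<le> q j \<or> q (Suc j) \<le> p"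
proof -
  define S where "S = insert a (insert b (P \<inter> {a<..<b}))"
  have S: "finite S" "a \<in> S" "b \<in> S" "\<And>p. p \<in> S \<Longrightarrow> a \<le> p \<and> p \<le> b"
    using assms by (auto simp: S_def)
  define l where "l = sorted_list_of_set S"
  have l: "sorted_wrt (<) l" "set l = S"
    using S by (auto simp: l_def)
  have lt: "i < j \<Longrightarrow> j < length l \<Longrightarrow> l ! i < l ! j" for i j
    using l(1) sorted_wrt_nth_less by blast
  have le: "i \<le> j \<Longrightarrow> j < length l \<Longrightarrow> l ! i \<le> l ! j" for i j
    using lt[of i j] by (cases "i = j") auto
  have nz: "l \<noteq> []"
    using l S by auto
  obtain i where i: "i < length l" "l ! i = a"
    using S(2) l(2) by (metis in_set_conv_nth)
  obtain k where k: "k < length l" "l ! k = b"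
    using S(3) l(2) by (metis in_set_conv_nth)
  have 0: "l ! 0 = a"
    using le[of 0 i] i S(4)[of "l ! 0"] l(2) nz by (metis antisym le0 length_greater_0_conv nth_mem)
  have N: "l ! (length l - 1) = b"
    using le[of k "length l - 1"] k S(4)[of "l ! (length l - 1)"] l(2) nz
    by (metis Suc_pred' antisym diff_less le_simps(2) length_greater_0_conv less_one nth_mem)
  show ?thesis
  proof (rule that[of "\<lambda>j. l ! j" "length l - 1"])
    fix p j assume p: "p \<in> P" and j: "j < length l - 1"
    have "a \<le> l ! j" "l ! Suc j \<le> b"
      using S(4) l(2) j by auto
    moreover have "p \<le> l ! j \<or> l ! Suc j \<le> p" if ps: "p \<in> S"
    proof -
      obtain m where "m < length l" "l ! m = p"
        using ps l(2) by (metis in_set_conv_nth)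
      then show ?thesis
        using le[of m j] le[of "Suc j" m] j by (cases "m \<le> j") auto
    qed
    ultimately show "p \<le> l ! j \<or> l ! Suc j \<le> p"
      using p by (fastforce simp: S_def)
  qed (use 0 N lt in auto)
qed

lemma step_function_square_nn_integral:
  fixes g q :: "nat \<Rightarrow> real" and f :: "real \<Rightarrow> real"
  assumes "\<And>j. j < N \<Longrightarrow> q j \<le> q (Suc j)"
    and "\<And>j r. j < N \<Longrightarrow> q j < r \<Longrightarrow> r \<le> q (Suc j) \<Longrightarrow> f r = g j"
  shows "(\<integral>\<^sup>+r\<in>{q 0..q N}. ennreal ((f r)\<^sup>2) \<partial>lborel) = ennreal (\<Sum>j<N. (g j)\<^sup>2 * (q (Suc j) - q j))"
proof -
  have le: "j \<le> N \<Longrightarrow> q 0 \<le> q j" for j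
    by (induction j) (use assms(1) in \<open>auto intro: order_trans\<close>)
  \<comment> \<open>The cells are open on the left while the domain of integration is closed, so the
    identity can fail at \<open>q 0\<close>, which is a null set.\<close>
  have eq: "ennreal ((f r)\<^sup>2) * indicator {q 0..q k} r =
      (\<Sum>j<k. ennreal ((g j)\<^sup>2) * indicator {q j<..q (Suc j)} r)" if "r \<noteq> q 0" "k \<le> N" for r k
    using that(2)
  proof (induction k)
    case 0
    then show ?case using that(1) by (simp add: indicator_def)
  next
    case (Suc k)
    then have "ennreal ((f r)\<^sup>2) * indicator {q 0..q (Suc k)} r =
        ennreal ((f r)\<^sup>2) * indicator {q 0..q k} r + ennreal ((g k)\<^sup>2) * indicator {q k<..q (Suc k)} r"
      using assms(1)[of k] assms(2)[of k r] le[of k] by (auto split: split_indicator)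
    then show ?case using Suc by simp
  qed
  have "(\<integral>\<^sup>+r\<in>{q 0..q N}. ennreal ((f r)\<^sup>2) \<partial>lborel) =
      (\<integral>\<^sup>+r. (\<Sum>j<N. ennreal ((g j)\<^sup>2) * indicator {q j<..q (Suc j)} r) \<partial>lborel)"
    using AE_lborel_singleton[of "q 0"] by (intro nn_integral_cong_AE) (auto simp: eq)
  also have "\<dots> = (\<Sum>j<N. ennreal ((g j)\<^sup>2 * (q (Suc j) - q j)))"
    using assms(1) by (subst nn_integral_sum) (auto intro!: sum.cong simp: nn_integral_cmult_indicator ennreal_mult)
  also have "\<dots> = ennreal (\<Sum>j<N. (g j)\<^sup>2 * (q (Suc j) - q j))"
    using assms(1) by (intro sum_ennreal) auto
  finally show ?thesis .
qed

text \<open>Simple processes are left-continuous, so the right end of a cell is the point to sample.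
  The first assumption says that no partition point lies strictly inside the cell.\<close>

lemma simple_process_const:
  assumes "\<And>i. i \<le> n \<Longrightarrow> \<tau> i \<le> u \<or> v \<le> \<tau> i" "u < r" "r \<le> v"
  shows "simple_process n \<tau> \<xi> r \<omega> = simple_process n \<tau> \<xi> v \<omega>"
  unfolding simple_process_def
proof (intro sum.cong refl)
  fix i assume "i \<in> {..<n}"
  then show "\<xi> i \<omega> * indicator {\<tau> i<..\<tau> (Suc i)} r = \<xi> i \<omega> * indicator {\<tau> i<..\<tau> (Suc i)} v"
    using assms(1)[of i] assms(1)[of "Suc i"] assms(2,3) by (auto split: split_indicator)
qed

lemma simple_integral_increment:
  assumes "simple_integrand M F n \<tau> \<xi>"
    and "\<And>i. i \<le> n \<Longrightarrow> \<tau> i \<le> u \<or> v \<le> \<tau> i" "u < v"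
  shows "simple_integral W n \<tau> \<xi> v \<omega> - simple_integral W n \<tau> \<xi> u \<omega> =
    simple_process n \<tau> \<xi> v \<omega> * (W v \<omega> - W u \<omega>)"
  unfolding simple_process_def simple_integral_def sum_distrib_right sum_subtractf[symmetric]
proof (intro sum.cong refl)
  fix i assume i: "i \<in> {..<n}"
  then have "\<tau> i < \<tau> (Suc i)"
    using assms(1) by (auto simp: simple_integrand_def)
  then show "\<xi> i \<omega> * (W (min (\<tau> (Suc i)) v) \<omega> - W (min (\<tau> i) v) \<omega>) -
      \<xi> i \<omega> * (W (min (\<tau> (Suc i)) u) \<omega> - W (min (\<tau> i) u) \<omega>) =
      \<xi> i \<omega> * indicator {\<tau> i<..\<tau> (Suc i)} v * (W v \<omega> - W u \<omega>)"
    using assms(2)[of i] assms(2)[of "Suc i"] assms(3) i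
    by (auto simp: min_def algebra_simps split: split_indicator)
qed

text \<open>The zero integrand lets statements about pairs of simple integrands be used for a single
  one.\<close>

lemma simple_integrand_zero: "simple_integrand M F 0 (\<lambda>_. 0) \<xi>"
  by (simp add: simple_integrand_def)

lemma simple_integral_zero: "simple_integral W 0 \<tau> \<xi> t \<omega> = 0"
  by (simp add: simple_integral_def)

lemma simple_process_zero: "simple_process 0 \<tau> \<xi> t \<omega> = 0"
  by (simp add: simple_process_def)

lemma simple_integrand_times_nonneg:
  assumes "simple_integrand M F n \<tau> \<xi>" "i \<le> n"
  shows "0 \<le> \<tau> i"
  using assms(2)
  by (induction i) (use assms(1) in \<open>auto simp: simple_integrand_def less_eq_Suc_le intro: less_imp_le order_less_imp_le order_trans\<close>)

lemma simple_integral_at_0: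
  assumes "simple_integrand M F n \<tau> \<xi>"
  shows "simple_integral W n \<tau> \<xi> 0 \<omega> = 0"
proof -
  have "min (\<tau> i) 0 = 0" if "i \<le> n" for i
    using simple_integrand_times_nonneg[OF assms that] by simp
  then show ?thesis by (simp add: simple_integral_def)
qed

text \<open>This is predictability: a summand that is nonzero at \<open>v\<close> has
  \<open>\<tau> i < v\<close>, hence \<open>\<tau> i \<le> u\<close>, so its coefficient is already
  known at time \<open>u\<close>.\<close>

lemma (in stochastic_basis) simple_process_measurable:
  assumes "simple_integrand M F n \<tau> \<xi>"
    and "\<And>i. i \<le> n \<Longrightarrow> \<tau> i \<le> u \<or> v \<le> \<tau> i"
  shows "simple_process n \<tau> \<xi> v \<in> borel_measurable (F u)"
proof -
  have "(\<lambda>\<omega>. \<xi> i \<omega> * indicator {\<tau> i<..\<tau> (Suc i)} v) \<in> borel_measurable (F u)" if "i < n" for i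
  proof (cases "\<tau> i < v")
    case True
    then have "\<tau> i \<le> u" using assms(2)[of i] that by auto
    then have "\<xi> i \<in> borel_measurable (F u)"
      using assms(1) that simple_integrand_times_nonneg[OF assms(1), of i]
      by (intro filtration_measurable_mono[of "\<tau> i" u]) (auto simp: simple_integrand_def)
    then show ?thesis by measurable
  qed simp
  then show ?thesis
    unfolding simple_process_def[abs_def] by (intro borel_measurable_sum) auto
qed

text \<open>Two integrands are treated together because stability in probability concerns
  differences. On a common refinement the difference is a step function with values
  \<open>c j\<close>, and the claim is \<open>exponential_grid\<close> with coefficients
  \<open>l * c j\<close>. Finiteness and measurability come from the same explicit sum; finiteness
  makes \<open>enn2real\<close> in the exponent faithful.\<close>

lemma (in standard_wiener_process) exponential_simple_integrals:
  assumes S: "simple_integrand M F n \<tau> \<xi>" and R: "simple_integrand M F m \<sigma> \<eta>"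
    and "0 \<le> a" "a < b" and G: "G \<in> borel_measurable (F a)"
  shows "(\<integral>\<^sup>+\<omega>. G \<omega> * ennreal (exp (l * ((simple_integral W n \<tau> \<xi> b \<omega> - simple_integral W n \<tau> \<xi> a \<omega>) -
        (simple_integral W m \<sigma> \<eta> b \<omega> - simple_integral W m \<sigma> \<eta> a \<omega>)) -
      l\<^sup>2 * enn2real (\<integral>\<^sup>+r\<in>{a..b}. ennreal ((simple_process n \<tau> \<xi> r \<omega> - simple_process m \<sigma> \<eta> r \<omega>)\<^sup>2) \<partial>lborel) / 2))
      \<partial>M) = (\<integral>\<^sup>+\<omega>. G \<omega> \<partial>M)"
    and "\<And>\<omega>. (\<integral>\<^sup>+r\<in>{a..b}. ennreal ((simple_process n \<tau> \<xi> r \<omega> - simple_process m \<sigma> \<eta> r \<omega>)\<^sup>2) \<partial>lborel) < \<infinity>"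
    and "(\<lambda>\<omega>. \<integral>\<^sup>+r\<in>{a..b}. ennreal ((simple_process n \<tau> \<xi> r \<omega> - simple_process m \<sigma> \<eta> r \<omega>)\<^sup>2) \<partial>lborel)
      \<in> borel_measurable M"
proof -
  obtain q N where q: "q 0 = a" "q N = b" "\<And>j. j < N \<Longrightarrow> q j < q (Suc j)"
    "\<And>p j. p \<in> \<tau> ` {..n} \<union> \<sigma> ` {..m} \<Longrightarrow> j < N \<Longrightarrow> p \<le> q j \<or> q (Suc j) \<le> p"
    using finite_set_grid[of "\<tau> ` {..n} \<union> \<sigma> ` {..m}" a b] assms(4) by auto
  define c where "c j \<omega> = simple_process n \<tau> \<xi> (q (Suc j)) \<omega> - simple_process m \<sigma> \<eta> (q (Suc j)) \<omega>" for j \<omega>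
  have t: "i \<le> n \<Longrightarrow> \<tau> i \<le> q j \<or> q (Suc j) \<le> \<tau> i" and s: "i \<le> m \<Longrightarrow> \<sigma> i \<le> q j \<or> q (Suc j) \<le> \<sigma> i"
    if "j < N" for i j
    using q(4) that by blast+
  have int: "(simple_integral W n \<tau> \<xi> b \<omega> - simple_integral W n \<tau> \<xi> a \<omega>) -
        (simple_integral W m \<sigma> \<eta> b \<omega> - simple_integral W m \<sigma> \<eta> a \<omega>) =
      (\<Sum>j<N. c j \<omega> * (W (q (Suc j)) \<omega> - W (q j) \<omega>))" for \<omega>
  proof -
    have "(\<Sum>j<N. c j \<omega> * (W (q (Suc j)) \<omega> - W (q j) \<omega>)) =
        (\<Sum>j<N. (simple_integral W n \<tau> \<xi> (q (Suc j)) \<omega> - simple_integral W n \<tau> \<xi> (q j) \<omega>) -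
          (simple_integral W m \<sigma> \<eta> (q (Suc j)) \<omega> - simple_integral W m \<sigma> \<eta> (q j) \<omega>))"
    proof (intro sum.cong refl)
      fix j assume "j \<in> {..<N}"
      then have j: "j < N" by simp
      show "c j \<omega> * (W (q (Suc j)) \<omega> - W (q j) \<omega>) =
          simple_integral W n \<tau> \<xi> (q (Suc j)) \<omega> - simple_integral W n \<tau> \<xi> (q j) \<omega> -
          (simple_integral W m \<sigma> \<eta> (q (Suc j)) \<omega> - simple_integral W m \<sigma> \<eta> (q j) \<omega>)"
        using simple_integral_increment[where W=W and \<omega>=\<omega>, OF S _ q(3)[OF j]] t[OF j]
          simple_integral_increment[where W=W and \<omega>=\<omega>, OF R _ q(3)[OF j]] s[OF j]
        by (simp add: c_def left_diff_distrib)
    qed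
    also have "\<dots> = (simple_integral W n \<tau> \<xi> b \<omega> - simple_integral W n \<tau> \<xi> a \<omega>) -
        (simple_integral W m \<sigma> \<eta> b \<omega> - simple_integral W m \<sigma> \<eta> a \<omega>)"
      unfolding sum_subtractf[of _ _ "{..<N}"] sum_lessThan_telescope q(1,2)[symmetric]
      using sum_lessThan_telescope[of "\<lambda>j. simple_integral W n \<tau> \<xi> (q j) \<omega>" N]
        sum_lessThan_telescope[of "\<lambda>j. simple_integral W m \<sigma> \<eta> (q j) \<omega>" N]
      by (simp add: sum_subtractf)
    finally show ?thesis ..
  qed
  have sq: "(\<integral>\<^sup>+r\<in>{a..b}. ennreal ((simple_process n \<tau> \<xi> r \<omega> - simple_process m \<sigma> \<eta> r \<omega>)\<^sup>2) \<partial>lborel) =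
      ennreal (\<Sum>j<N. (c j \<omega>)\<^sup>2 * (q (Suc j) - q j))" for \<omega>
    unfolding q(1,2)[symmetric]
  proof (rule step_function_square_nn_integral)
    fix j r assume j: "j < N" "q j < r" "r \<le> q (Suc j)"
    show "simple_process n \<tau> \<xi> r \<omega> - simple_process m \<sigma> \<eta> r \<omega> = c j \<omega>"
      unfolding c_def using t[OF j(1)] s[OF j(1)]
      by (intro arg_cong2[where f="(-)"] simple_process_const[OF _ j(2,3)])
  qed (use q(3) in \<open>auto intro: less_imp_le\<close>)
  show "(\<integral>\<^sup>+r\<in>{a..b}. ennreal ((simple_process n \<tau> \<xi> r \<omega> - simple_process m \<sigma> \<eta> r \<omega>)\<^sup>2) \<partial>lborel) < \<infinity>" for \<omega>
    unfolding sq by simp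
  have nonneg: "0 \<le> (\<Sum>j<N. (c j \<omega>)\<^sup>2 * (q (Suc j) - q j))" for \<omega>
    using q(3) by (intro sum_nonneg mult_nonneg_nonneg) (auto intro: less_imp_le)
  have c: "c j \<in> borel_measurable (F (q j))" if "j < N" for j
    unfolding c_def[abs_def]
    by (intro borel_measurable_diff simple_process_measurable[OF S] simple_process_measurable[OF R] t s that)
  have "0 \<le> q j" if "j \<le> N" for j
    using that by (induction j) (use q(1,3) assms(3) in \<open>auto intro: order_trans less_imp_le simp: less_eq_Suc_le\<close>)
  then have "c j \<in> borel_measurable M" if "j < N" for j
    using c[OF that] that by (intro filtration_measurable[of "q j"]) auto
  then show "(\<lambda>\<omega>. \<integral>\<^sup>+r\<in>{a..b}. ennreal ((simple_process n \<tau> \<xi> r \<omega> - simple_process m \<sigma> \<eta> r \<omega>)\<^sup>2) \<partial>lborel)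
      \<in> borel_measurable M"
    unfolding sq by (intro measurable_compose[OF _ measurable_ennreal] borel_measurable_sum) auto
  have "(\<integral>\<^sup>+\<omega>. G \<omega> * ennreal (exp ((\<Sum>j<N. (l * c j \<omega>) * (W (q (Suc j)) \<omega> - W (q j) \<omega>)) -
      (\<Sum>j<N. (l * c j \<omega>)\<^sup>2 * (q (Suc j) - q j)) / 2)) \<partial>M) = (\<integral>\<^sup>+\<omega>. G \<omega> \<partial>M)"
  proof (rule exponential_grid)
    fix j assume "j < N"
    then show "(\<lambda>\<omega>. l * c j \<omega>) \<in> borel_measurable (F (q j))"
      using c by measurable
  qed (use q assms in auto)
  then show "(\<integral>\<^sup>+\<omega>. G \<omega> * ennreal (exp (l * ((simple_integral W n \<tau> \<xi> b \<omega> - simple_integral W n \<tau> \<xi> a \<omega>) -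
        (simple_integral W m \<sigma> \<eta> b \<omega> - simple_integral W m \<sigma> \<eta> a \<omega>)) -
      l\<^sup>2 * enn2real (\<integral>\<^sup>+r\<in>{a..b}. ennreal ((simple_process n \<tau> \<xi> r \<omega> - simple_process m \<sigma> \<eta> r \<omega>)\<^sup>2) \<partial>lborel) / 2))
      \<partial>M) = (\<integral>\<^sup>+\<omega>. G \<omega> \<partial>M)"
    unfolding int sq enn2real_ennreal[OF nonneg] by (simp add: sum_distrib_left power_mult_distrib mult.assoc)
qed

section \<open>Convergence to zero in probability\<close>

context prob_space
begin

lemma null_in_probability_mono:
  assumes D: "null_in_probability M D" and [measurable]: "\<And>k. D k \<in> borel_measurable M"
    and le: "\<And>k \<omega>. \<omega> \<in> space M \<Longrightarrow> E k \<omega> \<le> D k \<omega>"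
  shows "null_in_probability M E"
  unfolding null_in_probability_def
proof (intro allI impI)
  fix e :: real assume "e > 0"
  then have "(\<lambda>k. prob {\<omega> \<in> space M. ennreal e < D k \<omega>}) \<longlonglongrightarrow> 0"
    using D by (simp add: null_in_probability_def)
  then show "(\<lambda>k. prob {\<omega> \<in> space M. ennreal e < E k \<omega>}) \<longlonglongrightarrow> 0"
  proof (rule tendsto_sandwich[OF _ _ tendsto_const, rotated -1])
    show "\<forall>\<^sub>F k in sequentially. prob {\<omega> \<in> space M. ennreal e < E k \<omega>} \<le> prob {\<omega> \<in> space M. ennreal e < D k \<omega>}"
      using le by (intro always_eventually allI finite_measure_mono) (auto intro: less_le_trans)
  qed auto
qed

lemma null_in_probability_add:
  assumes D: "null_in_probability M D" and E: "null_in_probability M E"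
    and [measurable]: "\<And>k. D k \<in> borel_measurable M" "\<And>k. E k \<in> borel_measurable M"
  shows "null_in_probability M (\<lambda>k \<omega>. D k \<omega> + E k \<omega>)"
  unfolding null_in_probability_def
proof (intro allI impI)
  fix e :: real assume e: "e > 0"
  have "(\<lambda>k. prob {\<omega> \<in> space M. ennreal (e / 2) < D k \<omega>} + prob {\<omega> \<in> space M. ennreal (e / 2) < E k \<omega>}) \<longlonglongrightarrow> 0 + 0"
    using D E e unfolding null_in_probability_def by (intro tendsto_add) auto
  then have "(\<lambda>k. prob {\<omega> \<in> space M. ennreal (e / 2) < D k \<omega>} + prob {\<omega> \<in> space M. ennreal (e / 2) < E k \<omega>}) \<longlonglongrightarrow> 0"
    by simp
  then show "(\<lambda>k. prob {\<omega> \<in> space M. ennreal e < D k \<omega> + E k \<omega>}) \<longlonglongrightarrow> 0"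
  proof (rule tendsto_sandwich[OF _ _ tendsto_const, rotated -1])
    have "prob {\<omega> \<in> space M. ennreal e < D k \<omega> + E k \<omega>} \<le>
        prob ({\<omega> \<in> space M. ennreal (e / 2) < D k \<omega>} \<union> {\<omega> \<in> space M. ennreal (e / 2) < E k \<omega>})" for k
    proof (rule finite_measure_mono)
      have half: "ennreal (e / 2) + ennreal (e / 2) = ennreal e"
        using e by (subst ennreal_plus[symmetric]) auto
      have "D k \<omega> + E k \<omega> \<le> ennreal e" if "D k \<omega> \<le> ennreal (e / 2)" "E k \<omega> \<le> ennreal (e / 2)" for \<omega>
        using add_mono[OF that] unfolding half .
      then show "{\<omega> \<in> space M. ennreal e < D k \<omega> + E k \<omega>} \<subseteq>
          {\<omega> \<in> space M. ennreal (e / 2) < D k \<omega>} \<union> {\<omega> \<in> space M. ennreal (e / 2) < E k \<omega>}"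
        by (auto simp: not_less[symmetric])
    qed auto
    then show "\<forall>\<^sub>F k in sequentially. prob {\<omega> \<in> space M. ennreal e < D k \<omega> + E k \<omega>} \<le>
        prob {\<omega> \<in> space M. ennreal (e / 2) < D k \<omega>} + prob {\<omega> \<in> space M. ennreal (e / 2) < E k \<omega>}"
      by (intro always_eventually allI order_trans[OF _ measure_Un_le]) auto
  qed auto
qed

text \<open>Borel-Cantelli, with indices chosen so that the exceptional probabilities are summable.
  \<open>r\<close> is not claimed to increase: it will feed Fatou's lemma, which asks only for
  pointwise convergence along \<open>r\<close>.\<close>

lemma null_in_probability_AE_subsequence:
  assumes D: "null_in_probability M D" and [measurable]: "\<And>k. D k \<in> borel_measurable M"
  obtains r where "AE \<omega> in M. (\<lambda>j. D (r j) \<omega>) \<longlonglongrightarrow> 0"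
proof -
  have "\<exists>k. prob {\<omega> \<in> space M. ennreal ((1 / 2) ^ j) < D k \<omega>} < (1 / 2) ^ j" for j
  proof -
    have "(\<lambda>k. prob {\<omega> \<in> space M. ennreal ((1 / 2) ^ j) < D k \<omega>}) \<longlonglongrightarrow> 0"
      using D by (simp add: null_in_probability_def)
    then have "\<forall>\<^sub>F k in sequentially. prob {\<omega> \<in> space M. ennreal ((1 / 2) ^ j) < D k \<omega>} < (1 / 2) ^ j"
      by (rule order_tendstoD) simp
    then show ?thesis
      by (auto simp: eventually_sequentially)
  qed
  then obtain r where r: "prob {\<omega> \<in> space M. ennreal ((1 / 2) ^ j) < D (r j) \<omega>} < (1 / 2) ^ j" for j
    by metis
  have "AE \<omega> in M. \<forall>\<^sub>F j in sequentially. \<omega> \<in> space M - {\<omega> \<in> space M. ennreal ((1 / 2) ^ j) < D (r j) \<omega>}"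
  proof (rule borel_cantelli_AE1)
    show "summable (\<lambda>j. prob {\<omega> \<in> space M. ennreal ((1 / 2) ^ j) < D (r j) \<omega>})"
      using r by (intro summable_comparison_test'[OF summable_geometric[of "1 / 2 :: real"], of 0])
        (auto intro: less_imp_le)
  qed (auto simp: emeasure_eq_measure)
  then have "AE \<omega> in M. (\<lambda>j. D (r j) \<omega>) \<longlonglongrightarrow> 0"
  proof (rule AE_mp, intro AE_I2 impI)
    fix \<omega> assume "\<omega> \<in> space M" and
      ev: "\<forall>\<^sub>F j in sequentially. \<omega> \<in> space M - {\<omega> \<in> space M. ennreal ((1 / 2) ^ j) < D (r j) \<omega>}"
    have "(\<lambda>j. ennreal ((1 / 2) ^ j)) \<longlonglongrightarrow> ennreal 0"
      by (intro tendsto_ennrealI LIMSEQ_power_zero) simp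
    then show "(\<lambda>j. D (r j) \<omega>) \<longlonglongrightarrow> 0"
      by (intro tendsto_sandwich[of "\<lambda>_. 0" "\<lambda>j. D (r j) \<omega>" sequentially "\<lambda>j. ennreal ((1 / 2) ^ j)" 0])
        (use ev in \<open>auto simp: not_less elim: eventually_mono\<close>)
  qed
  then show ?thesis using that by blast
qed

end

text \<open>Three domains appear because the errors may be known on intervals larger than
  \<open>A\<close>. Measurability is stated with indicators because a progressively measurable
  integrand is controlled only on bounded time intervals.\<close>

lemma square_diff_nn_integral_le:
  fixes f g h :: "real \<Rightarrow> real"
  assumes "A \<subseteq> B" "A \<subseteq> C"
    and [measurable]: "A \<in> sets borel"
    and "(\<lambda>r. ennreal ((f r - h r)\<^sup>2) * indicator B r) \<in> borel_measurable borel"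
    and "(\<lambda>r. ennreal ((g r - h r)\<^sup>2) * indicator C r) \<in> borel_measurable borel"
  shows "(\<integral>\<^sup>+r\<in>A. ennreal ((f r - g r)\<^sup>2) \<partial>lborel) \<le>
    2 * (\<integral>\<^sup>+r\<in>B. ennreal ((f r - h r)\<^sup>2) \<partial>lborel) + 2 * (\<integral>\<^sup>+r\<in>C. ennreal ((g r - h r)\<^sup>2) \<partial>lborel)"
proof -
  have "ennreal ((f r - g r)\<^sup>2) * indicator A r \<le>
      2 * (ennreal ((f r - h r)\<^sup>2) * indicator B r) + 2 * (ennreal ((g r - h r)\<^sup>2) * indicator C r)" for r
  proof (cases "r \<in> A")
    case True
    have "(f r - g r)\<^sup>2 \<le> 2 * (f r - h r)\<^sup>2 + 2 * (g r - h r)\<^sup>2"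
      using zero_le_power2[of "(f r - h r) + (g r - h r)"] by (simp add: power2_eq_square algebra_simps)
    then have "ennreal ((f r - g r)\<^sup>2) \<le> ennreal (2 * (f r - h r)\<^sup>2 + 2 * (g r - h r)\<^sup>2)"
      by (rule ennreal_leI)
    then show ?thesis
      using True assms(1,2) by (auto simp: ennreal_plus ennreal_mult subset_eq)
  qed simp
  then have "(\<integral>\<^sup>+r\<in>A. ennreal ((f r - g r)\<^sup>2) \<partial>lborel) \<le>
      (\<integral>\<^sup>+r. 2 * (ennreal ((f r - h r)\<^sup>2) * indicator B r) + 2 * (ennreal ((g r - h r)\<^sup>2) * indicator C r) \<partial>lborel)"
    by (rule nn_integral_mono)
  also have "\<dots> = 2 * (\<integral>\<^sup>+r\<in>B. ennreal ((f r - h r)\<^sup>2) \<partial>lborel) + 2 * (\<integral>\<^sup>+r\<in>C. ennreal ((g r - h r)\<^sup>2) \<partial>lborel)"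
    using assms(4,5) by (subst nn_integral_add) (auto simp: nn_integral_cmult)
  finally show ?thesis .
qed

lemma (in standard_wiener_process) simple_integral_measurable:
  assumes "simple_integrand M F n \<tau> \<xi>" "0 \<le> t"
  shows "simple_integral W n \<tau> \<xi> t \<in> borel_measurable M"
  unfolding simple_integral_def[abs_def]
proof (rule borel_measurable_sum)
  fix i assume "i \<in> {..<n}"
  then have "\<xi> i \<in> borel_measurable M" "0 \<le> \<tau> i" "0 \<le> \<tau> (Suc i)"
    using assms simple_integrand_times_nonneg[OF assms(1)]
    by (auto simp: simple_integrand_def intro!: filtration_measurable[of "\<tau> i"])
  then show "(\<lambda>\<omega>. \<xi> i \<omega> * (W (min (\<tau> (Suc i)) t) \<omega> - W (min (\<tau> i) t) \<omega>)) \<in> borel_measurable M"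
    using assms(2) by (intro borel_measurable_times borel_measurable_diff wiener_measurable_M) auto
qed

text \<open>Markov's inequality for two exponentials of mean 1, one with rate \<open>l\<close> and
  one with rate \<open>- l\<close>: where \<open>Q \<omega> \<le> d\<close> and
  \<open>e < \<bar>D \<omega>\<bar>\<close>, one of the two exponents is at least
  \<open>l * e - l\<^sup>2 * d / 2\<close>.\<close>

lemma (in standard_wiener_process) simple_integral_diff_tail:
  assumes S: "simple_integrand M F n \<tau> \<xi>" and R: "simple_integrand M F m \<sigma> \<eta>" and "0 < s"
    and "l > 0" "d \<ge> 0" "e > 0"
  defines "D \<equiv> \<lambda>\<omega>. simple_integral W n \<tau> \<xi> s \<omega> - simple_integral W m \<sigma> \<eta> s \<omega>"
    and "Q \<equiv> \<lambda>\<omega>. \<integral>\<^sup>+r\<in>{0..s}. ennreal ((simple_process n \<tau> \<xi> r \<omega> - simple_process m \<sigma> \<eta> r \<omega>)\<^sup>2) \<partial>lborel"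
  shows "prob {\<omega> \<in> space M. e < \<bar>D \<omega>\<bar>} \<le> prob {\<omega> \<in> space M. ennreal d < Q \<omega>} + 2 * exp (l\<^sup>2 * d / 2 - l * e)"
proof -
  have D[measurable]: "D \<in> borel_measurable M"
    unfolding D_def using assms by (intro borel_measurable_diff simple_integral_measurable) auto
  have Q[measurable]: "Q \<in> borel_measurable M" and Qfin: "Q \<omega> < \<infinity>" for \<omega>
    unfolding Q_def by (intro exponential_simple_integrals(2,3)[OF S R _ \<open>0 < s\<close>, of "\<lambda>_. 0"]; simp)+
  have E: "(\<integral>\<^sup>+\<omega>. ennreal (exp (k * D \<omega> - k\<^sup>2 * enn2real (Q \<omega>) / 2)) \<partial>M) = 1" for k
    using exponential_simple_integrals(1)[OF S R _ \<open>0 < s\<close>, of "\<lambda>_. 1" k]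
    by (simp add: D_def Q_def simple_integral_at_0[OF S] simple_integral_at_0[OF R] emeasure_space_1)
  have tail: "prob {\<omega> \<in> space M. 1 \<le> exp (l\<^sup>2 * d / 2 - l * e) * exp (k * D \<omega> - k\<^sup>2 * enn2real (Q \<omega>) / 2)}
      \<le> exp (l\<^sup>2 * d / 2 - l * e)" for k
  proof -
    have "emeasure M {\<omega> \<in> space M. 1 \<le> ennreal (exp (l\<^sup>2 * d / 2 - l * e)) * ennreal (exp (k * D \<omega> - k\<^sup>2 * enn2real (Q \<omega>) / 2))}
        \<le> ennreal (exp (l\<^sup>2 * d / 2 - l * e))"
      using nn_integral_Markov_inequality[of "\<lambda>\<omega>. ennreal (exp (k * D \<omega> - k\<^sup>2 * enn2real (Q \<omega>) / 2))" "space M" M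
          "ennreal (exp (l\<^sup>2 * d / 2 - l * e))"] E[of k]
      by (simp add: nn_integral_indicator mult_ac cong: nn_integral_cong)
    then show ?thesis
      by (simp add: emeasure_eq_measure ennreal_mult[symmetric] ennreal_1[symmetric] del: ennreal_1)
  qed
  have "{\<omega> \<in> space M. e < \<bar>D \<omega>\<bar>} \<subseteq> {\<omega> \<in> space M. ennreal d < Q \<omega>} \<union>
      ({\<omega> \<in> space M. 1 \<le> exp (l\<^sup>2 * d / 2 - l * e) * exp (l * D \<omega> - l\<^sup>2 * enn2real (Q \<omega>) / 2)} \<union>
      {\<omega> \<in> space M. 1 \<le> exp (l\<^sup>2 * d / 2 - l * e) * exp (- l * D \<omega> - (- l)\<^sup>2 * enn2real (Q \<omega>) / 2)})"
  proof
    fix \<omega> assume w: "\<omega> \<in> {\<omega> \<in> space M. e < \<bar>D \<omega>\<bar>}"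
    show "\<omega> \<in> {\<omega> \<in> space M. ennreal d < Q \<omega>} \<union>
      ({\<omega> \<in> space M. 1 \<le> exp (l\<^sup>2 * d / 2 - l * e) * exp (l * D \<omega> - l\<^sup>2 * enn2real (Q \<omega>) / 2)} \<union>
      {\<omega> \<in> space M. 1 \<le> exp (l\<^sup>2 * d / 2 - l * e) * exp (- l * D \<omega> - (- l)\<^sup>2 * enn2real (Q \<omega>) / 2)})"
    proof (cases "ennreal d < Q \<omega>")
      case False
      then have "enn2real (Q \<omega>) \<le> d"
        using assms(5) by (intro enn2real_leI) auto
      then have "l\<^sup>2 * enn2real (Q \<omega>) \<le> l\<^sup>2 * d"
        by (intro mult_left_mono) auto
      moreover have "l * e \<le> l * D \<omega> \<or> l * e \<le> l * (- D \<omega>)"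
        using w assms(4) mult_left_mono[of e "\<bar>D \<omega>\<bar>" l] by (cases "0 \<le> D \<omega>") auto
      ultimately show ?thesis
        using w by (auto simp: exp_add[symmetric])
    qed (use w in auto)
  qed
  then have "prob {\<omega> \<in> space M. e < \<bar>D \<omega>\<bar>} \<le> prob ({\<omega> \<in> space M. ennreal d < Q \<omega>} \<union>
      ({\<omega> \<in> space M. 1 \<le> exp (l\<^sup>2 * d / 2 - l * e) * exp (l * D \<omega> - l\<^sup>2 * enn2real (Q \<omega>) / 2)} \<union>
      {\<omega> \<in> space M. 1 \<le> exp (l\<^sup>2 * d / 2 - l * e) * exp (- l * D \<omega> - (- l)\<^sup>2 * enn2real (Q \<omega>) / 2)}))"
    by (intro finite_measure_mono) auto
  also have "\<dots> \<le> prob {\<omega> \<in> space M. ennreal d < Q \<omega>} + (exp (l\<^sup>2 * d / 2 - l * e) + exp (l\<^sup>2 * d / 2 - l * e))"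
    by (intro order_trans[OF measure_Un_le] add_mono tail order_refl) auto
  finally show ?thesis by simp
qed

lemma (in standard_wiener_process) null_in_probability_simple_integral_diff:
  assumes S: "\<And>k. simple_integrand M F (n k) (\<tau> k) (\<xi> k)" and R: "\<And>k. simple_integrand M F (m k) (\<sigma> k) (\<eta> k)"
    and "0 \<le> s"
    and Q: "null_in_probability M (\<lambda>k \<omega>. \<integral>\<^sup>+r\<in>{0..s}.
      ennreal ((simple_process (n k) (\<tau> k) (\<xi> k) r \<omega> - simple_process (m k) (\<sigma> k) (\<eta> k) r \<omega>)\<^sup>2) \<partial>lborel)"
  shows "null_in_probability M (\<lambda>k \<omega>. ennreal
    \<bar>simple_integral W (n k) (\<tau> k) (\<xi> k) s \<omega> - simple_integral W (m k) (\<sigma> k) (\<eta> k) s \<omega>\<bar>)"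
proof (cases "s = 0")
  case True
  then show ?thesis
    by (simp add: null_in_probability_def simple_integral_at_0[OF S] simple_integral_at_0[OF R])
next
  case False
  then have s: "0 < s" using assms(3) by simp
  show ?thesis
    unfolding null_in_probability_def
  proof (intro allI impI)
    fix e :: real assume e: "e > 0"
    let ?D = "\<lambda>k. prob {\<omega> \<in> space M. e < \<bar>simple_integral W (n k) (\<tau> k) (\<xi> k) s \<omega> - simple_integral W (m k) (\<sigma> k) (\<eta> k) s \<omega>\<bar>}"
    let ?Q = "\<lambda>d k. prob {\<omega> \<in> space M. ennreal d < (\<integral>\<^sup>+r\<in>{0..s}.
      ennreal ((simple_process (n k) (\<tau> k) (\<xi> k) r \<omega> - simple_process (m k) (\<sigma> k) (\<eta> k) r \<omega>)\<^sup>2) \<partial>lborel)}"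
    have "?D \<longlonglongrightarrow> 0"
    proof (rule LIMSEQ_I)
      fix \<epsilon> :: real assume eps: "\<epsilon> > 0"
      \<comment> \<open>With \<open>d = 1 / l\<^sup>2\<close> the term
        \<open>l\<^sup>2 * d / 2\<close> equals \<open>1 / 2\<close> whatever \<open>l\<close> is.
        This \<open>l\<close> makes the two exponential terms at most \<open>\<epsilon> / 4\<close>
        together, and the probability that the integrated square exceeds \<open>d\<close> is below
        \<open>\<epsilon> / 2\<close> for large \<open>k\<close>.\<close>
      define l where "l = max 1 ((1 / 2 - ln (\<epsilon> / 8)) / e)"
      have l: "l > 0" by (simp add: l_def)
      have "(1 / 2 - ln (\<epsilon> / 8)) / e \<le> l" by (simp add: l_def)
      then have "1 / 2 - l * e \<le> ln (\<epsilon> / 8)"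
        using e by (simp add: field_simps)
      then have exp: "exp (1 / 2 - l * e) \<le> \<epsilon> / 8"
        using eps by (metis divide_pos_pos exp_le_cancel_iff exp_ln zero_less_numeral)
      have "?Q (1 / l\<^sup>2) \<longlonglongrightarrow> 0"
        using Q l unfolding null_in_probability_def by simp
      then have "\<exists>K. \<forall>k\<ge>K. ?Q (1 / l\<^sup>2) k < \<epsilon> / 2"
        using eps order_tendstoD(2)[of _ 0 sequentially "\<epsilon> / 2"] by (auto simp: eventually_sequentially)
      then obtain K where K: "\<And>k. k \<ge> K \<Longrightarrow> ?Q (1 / l\<^sup>2) k < \<epsilon> / 2" by blast
      have "norm (?D k - 0) < \<epsilon>" if "k \<ge> K" for k
        using simple_integral_diff_tail[OF S R s l _ e, of "1 / l\<^sup>2" k k] K[OF that] exp eps l by simp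
      then show "\<exists>K. \<forall>k\<ge>K. norm (?D k - 0) < \<epsilon>" by blast
    qed
    then show "(\<lambda>k. prob {\<omega> \<in> space M. ennreal e < ennreal \<bar>simple_integral W (n k) (\<tau> k) (\<xi> k) s \<omega> -
        simple_integral W (m k) (\<sigma> k) (\<eta> k) s \<omega>\<bar>}) \<longlonglongrightarrow> 0"
      using e by (simp add: ennreal_less_iff)
  qed
qed

section \<open>Exponential inequality for Ito integrals\<close>

text \<open>Joint measurability is available only over \<open>{0..t}\<close>, so Tonelli's theorem
  is applied with Lebesgue measure restricted to that interval. Since \<open>A\<close> lies inside
  it, the integral over the whole line is the same.\<close>

lemma square_nn_integral_section_measurable:
  assumes "(\<lambda>(r, \<omega>). f r \<omega>) \<in> borel_measurable (restrict_space borel {0..t::real} \<Otimes>\<^sub>M M)"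
    and "A \<in> sets borel" "A \<subseteq> {0..t}"
  shows "\<omega> \<in> space M \<Longrightarrow> (\<lambda>r. ennreal ((f r \<omega>)\<^sup>2) * indicator A r) \<in> borel_measurable borel"
    and "(\<lambda>\<omega>. \<integral>\<^sup>+r\<in>A. ennreal ((f r \<omega>)\<^sup>2) \<partial>lborel) \<in> borel_measurable M"
proof -
  let ?B = "restrict_space lborel {0..t}"
  have sets_B: "sets ?B = sets (restrict_space borel {0..t})"
    by (rule sets_restrict_space_cong) simp
  have restr: "ennreal ((f r \<omega>)\<^sup>2) * indicator A r = ennreal ((f r \<omega>)\<^sup>2) * indicator A r * indicator {0..t} r" for r \<omega>
    using assms(3) by (auto split: split_indicator)
  show "(\<lambda>r. ennreal ((f r \<omega>)\<^sup>2) * indicator A r) \<in> borel_measurable borel" if "\<omega> \<in> space M"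
  proof -
    have "(\<lambda>r. f r \<omega>) \<in> borel_measurable (restrict_space borel {0..t})"
      using measurable_compose[OF measurable_Pair2'[OF that] assms(1)] by simp
    then have "(\<lambda>r. ennreal ((f r \<omega>)\<^sup>2)) \<in> borel_measurable (restrict_space borel {0..t})"
      by measurable
    then have "(\<lambda>r. ennreal ((f r \<omega>)\<^sup>2) * indicator {0..t} r) \<in> borel_measurable borel"
      by (subst borel_measurable_restrict_space_iff_ennreal[symmetric]) auto
    then have "(\<lambda>r. (ennreal ((f r \<omega>)\<^sup>2) * indicator {0..t} r) * indicator A r) \<in> borel_measurable borel"
      using assms(2) by measurable
    also have "(\<lambda>r. (ennreal ((f r \<omega>)\<^sup>2) * indicator {0..t} r) * indicator A r) =
        (\<lambda>r. ennreal ((f r \<omega>)\<^sup>2) * indicator A r)"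
      using assms(3) by (intro ext) (auto split: split_indicator)
    finally show ?thesis .
  qed
  interpret B: sigma_finite_measure ?B
    by (intro sigma_finite_measure_restrict_space) (auto intro: sigma_finite_lborel)
  have [measurable]: "(\<lambda>(r, \<omega>). f r \<omega>) \<in> borel_measurable (?B \<Otimes>\<^sub>M M)"
    using assms(1) sets_B by (subst measurable_cong_sets[OF sets_pair_measure_cong refl]) auto
  have [measurable]: "A \<in> sets borel" by fact
  have [measurable]: "indicator A \<in> borel_measurable ?B"
    by (intro measurable_restrict_space1) simp
  have "(\<lambda>(\<omega>, r). ennreal ((f r \<omega>)\<^sup>2) * indicator A r) \<in> borel_measurable (M \<Otimes>\<^sub>M ?B)"
    by (subst measurable_pair_swap_iff) measurable
  then have "(\<lambda>\<omega>. \<integral>\<^sup>+r. ennreal ((f r \<omega>)\<^sup>2) * indicator A r \<partial>?B) \<in> borel_measurable M"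
    by (rule B.borel_measurable_nn_integral)
  also have "(\<lambda>\<omega>. \<integral>\<^sup>+r. ennreal ((f r \<omega>)\<^sup>2) * indicator A r \<partial>?B) =
      (\<lambda>\<omega>. \<integral>\<^sup>+r\<in>A. ennreal ((f r \<omega>)\<^sup>2) \<partial>lborel)"
    by (subst nn_integral_restrict_space) (auto simp: restr[symmetric])
  finally show "(\<lambda>\<omega>. \<integral>\<^sup>+r\<in>A. ennreal ((f r \<omega>)\<^sup>2) \<partial>lborel) \<in> borel_measurable M" .
qed

lemma (in stochastic_basis) progressively_measurable_joint:
  assumes "progressively_measurable F H" "0 \<le> t"
  shows "(\<lambda>(r, \<omega>). H r \<omega>) \<in> borel_measurable (restrict_space borel {0..t} \<Otimes>\<^sub>M M)"
proof -
  have [measurable]: "(\<lambda>\<omega>. \<omega>) \<in> measurable M (F t)"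
    using filtration_measurable[OF assms(2), of "\<lambda>\<omega>. \<omega>" "F t"] by simp
  have [measurable]: "(\<lambda>(r, \<omega>). H r \<omega>) \<in> borel_measurable (restrict_space borel {0..t} \<Otimes>\<^sub>M F t)"
    using assms by (simp add: progressively_measurable_def)
  have "(\<lambda>z. case (fst z, snd z) of (r, \<omega>) \<Rightarrow> H r \<omega>) \<in> borel_measurable (restrict_space borel {0..t} \<Otimes>\<^sub>M M)"
    by (rule measurable_compose[where g="\<lambda>(r, \<omega>). H r \<omega>" and N="restrict_space borel {0..t} \<Otimes>\<^sub>M F t"])
      measurable
  then show ?thesis by (simp add: case_prod_unfold)
qed

lemma (in stochastic_basis) simple_process_joint_measurable:
  assumes "simple_integrand M F n \<tau> \<xi>"
  shows "(\<lambda>(r, \<omega>). simple_process n \<tau> \<xi> r \<omega>) \<in> borel_measurable (restrict_space borel {0..t} \<Otimes>\<^sub>M M)"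
proof -
  have "(\<lambda>z. \<xi> i (snd z) * indicator {\<tau> i<..\<tau> (Suc i)} (fst z))
      \<in> borel_measurable (restrict_space borel {0..t} \<Otimes>\<^sub>M M)" if "i < n" for i
  proof -
    have [measurable]: "\<xi> i \<in> borel_measurable M"
      using assms that simple_integrand_times_nonneg[OF assms, of i]
      by (auto simp: simple_integrand_def intro!: filtration_measurable[of "\<tau> i"])
    have [measurable]: "(indicator {\<tau> i<..\<tau> (Suc i)} :: real \<Rightarrow> real) \<in> borel_measurable (restrict_space borel {0..t})"
      by (intro measurable_restrict_space1) simp
    show ?thesis by measurable
  qed
  then show ?thesis
    unfolding simple_process_def case_prod_unfold by (intro borel_measurable_sum) auto
qed

text \<open>
  The factor \<open>1 / 2\<close> in front of the quadratic variation is given up, which avoids showing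
  that the quadratic variations of the approximating simple integrals converge.
\<close>

lemma (in standard_wiener_process) exponential_ito_increment:
  fixes G :: "'a \<Rightarrow> real"
  assumes "0 \<le> s" "s < t" "has_ito_integral M F W H s I" "has_ito_integral M F W H t J"
    and G: "G \<in> borel_measurable (F s)" "\<And>\<omega>. \<omega> \<in> space M \<Longrightarrow> 0 \<le> G \<omega>"
  shows "(\<integral>\<^sup>+\<omega>. ennreal (G \<omega> * exp (l * (J \<omega> - I \<omega>) -
      l\<^sup>2 * enn2real (\<integral>\<^sup>+r\<in>{s..t}. ennreal ((H r \<omega>)\<^sup>2) \<partial>lborel))) \<partial>M) \<le> (\<integral>\<^sup>+\<omega>. ennreal (G \<omega>) \<partial>M)"
proof -
  obtain n \<tau> \<xi> where S: "\<And>k. simple_integrand M F (n k) (\<tau> k) (\<xi> k)"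
    and nullS: "null_in_probability M
      (\<lambda>k \<omega>. \<integral>\<^sup>+r\<in>{0..t}. ennreal ((simple_process (n k) (\<tau> k) (\<xi> k) r \<omega> - H r \<omega>)\<^sup>2) \<partial>lborel)"
      "null_in_probability M (\<lambda>k \<omega>. ennreal \<bar>simple_integral W (n k) (\<tau> k) (\<xi> k) t \<omega> - J \<omega>\<bar>)"
    using assms(4) unfolding has_ito_integral_def by blast
  obtain m \<sigma> \<eta> where R: "\<And>k. simple_integrand M F (m k) (\<sigma> k) (\<eta> k)"
    and nullR: "null_in_probability M
      (\<lambda>k \<omega>. \<integral>\<^sup>+r\<in>{0..s}. ennreal ((simple_process (m k) (\<sigma> k) (\<eta> k) r \<omega> - H r \<omega>)\<^sup>2) \<partial>lborel)"
      "null_in_probability M (\<lambda>k \<omega>. ennreal \<bar>simple_integral W (m k) (\<sigma> k) (\<eta> k) s \<omega> - I \<omega>\<bar>)"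
    using assms(3) unfolding has_ito_integral_def by blast
  have H: "progressively_measurable F H" and [measurable]: "I \<in> borel_measurable M" "J \<in> borel_measurable M"
    and Hfin: "AE \<omega> in M. (\<integral>\<^sup>+r\<in>{0..t}. ennreal ((H r \<omega>)\<^sup>2) \<partial>lborel) < \<infinity>"
    using assms(3,4) by (auto simp: has_ito_integral_def)
  have t: "0 \<le> t" using assms by simp
  have [measurable]: "G \<in> borel_measurable M"
    using G assms(1) filtration_measurable by blast
  let ?S = "\<lambda>k r \<omega>. simple_process (n k) (\<tau> k) (\<xi> k) r \<omega>"
  let ?R = "\<lambda>k r \<omega>. simple_process (m k) (\<sigma> k) (\<eta> k) r \<omega>"
  let ?IS = "\<lambda>k r \<omega>. simple_integral W (n k) (\<tau> k) (\<xi> k) r \<omega>"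
  let ?IR = "\<lambda>k r \<omega>. simple_integral W (m k) (\<sigma> k) (\<eta> k) r \<omega>"
  define eS where "eS k \<omega> = (\<integral>\<^sup>+r\<in>{0..t}. ennreal ((?S k r \<omega> - H r \<omega>)\<^sup>2) \<partial>lborel)" for k \<omega>
  define eR where "eR k \<omega> = (\<integral>\<^sup>+r\<in>{0..s}. ennreal ((?R k r \<omega> - H r \<omega>)\<^sup>2) \<partial>lborel)" for k \<omega>
  define h where "h \<omega> = (\<integral>\<^sup>+r\<in>{s..t}. ennreal ((H r \<omega>)\<^sup>2) \<partial>lborel)" for \<omega>
  have jointS: "(\<lambda>(r, \<omega>). ?S k r \<omega> - H r \<omega>) \<in> borel_measurable (restrict_space borel {0..t} \<Otimes>\<^sub>M M)" for k
    using borel_measurable_diff[OF simple_process_joint_measurable[OF S[of k], of t] progressively_measurable_joint[OF H t]]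
    by (simp add: case_prod_unfold)
  have jointR: "(\<lambda>(r, \<omega>). ?R k r \<omega> - H r \<omega>) \<in> borel_measurable (restrict_space borel {0..s} \<Otimes>\<^sub>M M)" for k
    using borel_measurable_diff[OF simple_process_joint_measurable[OF R[of k], of s] progressively_measurable_joint[OF H assms(1)]]
    by (simp add: case_prod_unfold)
  have [measurable]: "eS k \<in> borel_measurable M" "eR k \<in> borel_measurable M" "h \<in> borel_measurable M" for k
    unfolding eS_def[abs_def] eR_def[abs_def] h_def[abs_def] using assms(1)
    by (intro square_nn_integral_section_measurable(2)[OF jointS] square_nn_integral_section_measurable(2)[OF jointR]
        square_nn_integral_section_measurable(2)[OF progressively_measurable_joint[OF H t]]; simp)+
  have [measurable]: "(\<lambda>\<omega>. ?IS k t \<omega>) \<in> borel_measurable M" "(\<lambda>\<omega>. ?IS k s \<omega>) \<in> borel_measurable M"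
    "(\<lambda>\<omega>. ?IR k s \<omega>) \<in> borel_measurable M" for k
    using simple_integral_measurable[OF S] simple_integral_measurable[OF R] assms(1) t by auto
  have null_eS: "null_in_probability M eS" and null_eR: "null_in_probability M eR"
    using nullS(1) nullR(1) unfolding eS_def[abs_def] eR_def[abs_def] .
  \<comment> \<open>\<open>I\<close> and \<open>J\<close> come with unrelated approximating
    sequences. The one for \<open>J\<close> also converges to \<open>H\<close> on
    \<open>{0..s}\<close>, so there both sequences have close integrands and, by stability, close
    integrals: \<open>I\<close> is also the limit of the integrals \<open>?IS k s\<close>.\<close>
  have "null_in_probability M (\<lambda>k \<omega>. (eS k \<omega> + eS k \<omega>) + (eR k \<omega> + eR k \<omega>))"
    by (intro null_in_probability_add null_eS null_eR) measurable
  then have "null_in_probability M (\<lambda>k \<omega>. \<integral>\<^sup>+r\<in>{0..s}. ennreal ((?S k r \<omega> - ?R k r \<omega>)\<^sup>2) \<partial>lborel)"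
  proof (rule null_in_probability_mono)
    fix k \<omega> assume w: "\<omega> \<in> space M"
    show "(\<integral>\<^sup>+r\<in>{0..s}. ennreal ((?S k r \<omega> - ?R k r \<omega>)\<^sup>2) \<partial>lborel) \<le> (eS k \<omega> + eS k \<omega>) + (eR k \<omega> + eR k \<omega>)"
      unfolding mult_2[symmetric] eS_def eR_def using assms(1,2) w
      by (intro square_diff_nn_integral_le square_nn_integral_section_measurable(1)[OF jointS]
          square_nn_integral_section_measurable(1)[OF jointR]) auto
  qed measurable
  then have null_D: "null_in_probability M (\<lambda>k \<omega>. ennreal \<bar>?IS k s \<omega> - ?IR k s \<omega>\<bar>)"
    by (intro null_in_probability_simple_integral_diff S R assms)
  \<comment> \<open>Adding all the errors lets one choice of indices make each of them tend to 0
    almost surely.\<close>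
  define E where "E k \<omega> = (eS k \<omega> + ennreal \<bar>?IS k s \<omega> - ?IR k s \<omega>\<bar>) +
      (ennreal \<bar>?IS k t \<omega> - J \<omega>\<bar> + ennreal \<bar>?IR k s \<omega> - I \<omega>\<bar>)" for k \<omega>
  have "null_in_probability M E"
    unfolding E_def[abs_def] by (intro null_in_probability_add null_eS null_D nullS nullR) measurable
  moreover have "E k \<in> borel_measurable M" for k
    unfolding E_def[abs_def] by measurable
  ultimately obtain r where r: "AE \<omega> in M. (\<lambda>j. E (r j) \<omega>) \<longlonglongrightarrow> 0"
    using null_in_probability_AE_subsequence[of E] by blast
  define Q where "Q k \<omega> = (\<integral>\<^sup>+r\<in>{s..t}. ennreal ((?S k r \<omega>)\<^sup>2) \<partial>lborel)" for k \<omega>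
  define \<phi> where "\<phi> k \<omega> = ennreal (G \<omega>) * ennreal (exp (l * (?IS k t \<omega> - ?IS k s \<omega>) - l\<^sup>2 * enn2real (Q k \<omega>) / 2))" for k \<omega>
  have Q[measurable]: "Q k \<in> borel_measurable M" for k
    using exponential_simple_integrals(3)[OF S simple_integrand_zero assms(1,2), of "\<lambda>_. 0" k]
    by (simp add: Q_def[abs_def] simple_process_zero)
  have [measurable]: "\<phi> k \<in> borel_measurable M" for k
    unfolding \<phi>_def[abs_def] by measurable
  have int: "(\<integral>\<^sup>+\<omega>. \<phi> k \<omega> \<partial>M) = (\<integral>\<^sup>+\<omega>. ennreal (G \<omega>) \<partial>M)" for k
    using exponential_simple_integrals(1)[OF S simple_integrand_zero assms(1,2), where G = "\<lambda>\<omega>. ennreal (G \<omega>)" and l = l] G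
    by (simp add: \<phi>_def Q_def simple_process_zero simple_integral_zero)
  have "(\<integral>\<^sup>+\<omega>. ennreal (G \<omega> * exp (l * (J \<omega> - I \<omega>) - l\<^sup>2 * enn2real (h \<omega>))) \<partial>M) \<le>
      (\<integral>\<^sup>+\<omega>. liminf (\<lambda>j. \<phi> (r j) \<omega>) \<partial>M)"
  proof (rule nn_integral_mono_AE, use r Hfin AE_space in eventually_elim)
    fix \<omega> assume w: "\<omega> \<in> space M" and lim: "(\<lambda>j. E (r j) \<omega>) \<longlonglongrightarrow> 0"
      and fin: "(\<integral>\<^sup>+r\<in>{0..t}. ennreal ((H r \<omega>)\<^sup>2) \<partial>lborel) < \<infinity>"
    have lim0: "f \<longlonglongrightarrow> 0" if "\<And>j. f j \<le> E (r j) \<omega>" for f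
      using that by (intro tendsto_sandwich[OF _ _ tendsto_const lim]) auto
    have lim_eS: "(\<lambda>j. eS (r j) \<omega>) \<longlonglongrightarrow> 0"
      by (rule lim0) (simp add: E_def add.assoc)
    have "(\<lambda>j. ennreal \<bar>?IS (r j) s \<omega> - ?IR (r j) s \<omega>\<bar>) \<longlonglongrightarrow> 0"
      by (rule lim0) (simp add: E_def add.assoc add_increasing)
    then have l1: "(\<lambda>j. ?IS (r j) s \<omega> - ?IR (r j) s \<omega>) \<longlonglongrightarrow> 0"
      by (simp add: ennreal_tendsto_0_iff tendsto_rabs_zero_iff)
    have "(\<lambda>j. ennreal \<bar>?IS (r j) t \<omega> - J \<omega>\<bar>) \<longlonglongrightarrow> 0"
      by (rule lim0) (simp add: E_def add_increasing add_increasing2)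
    then have l2: "(\<lambda>j. ?IS (r j) t \<omega> - J \<omega>) \<longlonglongrightarrow> 0"
      by (simp add: ennreal_tendsto_0_iff tendsto_rabs_zero_iff)
    have "(\<lambda>j. ennreal \<bar>?IR (r j) s \<omega> - I \<omega>\<bar>) \<longlonglongrightarrow> 0"
      by (rule lim0) (simp add: E_def add_increasing)
    then have l3: "(\<lambda>j. ?IR (r j) s \<omega> - I \<omega>) \<longlonglongrightarrow> 0"
      by (simp add: ennreal_tendsto_0_iff tendsto_rabs_zero_iff)
    have "(\<lambda>j. (?IS (r j) t \<omega> - J \<omega>) - (?IS (r j) s \<omega> - ?IR (r j) s \<omega>) - (?IR (r j) s \<omega> - I \<omega>) + (J \<omega> - I \<omega>))
        \<longlonglongrightarrow> 0 - 0 - 0 + (J \<omega> - I \<omega>)"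
      by (intro tendsto_intros l1 l2 l3)
    then have lim_int: "(\<lambda>j. ?IS (r j) t \<omega> - ?IS (r j) s \<omega>) \<longlonglongrightarrow> J \<omega> - I \<omega>"
      by simp
    have h: "h \<omega> < \<infinity>"
      unfolding h_def using assms(1)
      by (intro le_less_trans[OF _ fin] nn_integral_mono) (auto split: split_indicator)
    \<comment> \<open>\<open>\<psi>\<close> replaces half the quadratic variation of the
      approximation by an upper bound whose limit is explicit. It eventually lies below
      \<open>\<phi>\<close>, the direction that Fatou's lemma requires.\<close>
    define \<psi> where "\<psi> j = ennreal (G \<omega> * exp (l * (?IS (r j) t \<omega> - ?IS (r j) s \<omega>) -
        l\<^sup>2 * (enn2real (eS (r j) \<omega>) + enn2real (h \<omega>))))" for j
    have lim_e: "(\<lambda>j. enn2real (eS (r j) \<omega>)) \<longlonglongrightarrow> 0"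
      using lim_eS by (intro tendsto_enn2real) auto
    have "\<psi> \<longlonglongrightarrow> ennreal (G \<omega> * exp (l * (J \<omega> - I \<omega>) - l\<^sup>2 * (0 + enn2real (h \<omega>))))"
      unfolding \<psi>_def by (intro tendsto_ennrealI tendsto_mult_left tendsto_exp
          tendsto_diff[OF tendsto_mult_left[OF lim_int] tendsto_mult_left[OF tendsto_add[OF lim_e tendsto_const]]])
    then have "ennreal (G \<omega> * exp (l * (J \<omega> - I \<omega>) - l\<^sup>2 * enn2real (h \<omega>))) = liminf \<psi>"
      by (simp add: lim_imp_Liminf)
    also have "\<dots> \<le> liminf (\<lambda>j. \<phi> (r j) \<omega>)"
    proof (rule Liminf_mono)
      have "\<forall>\<^sub>F j in sequentially. eS (r j) \<omega> < 1"
        using lim_eS by (rule order_tendstoD) simp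
      then show "\<forall>\<^sub>F j in sequentially. \<psi> j \<le> \<phi> (r j) \<omega>"
      proof eventually_elim
        fix j assume "eS (r j) \<omega> < 1"
        then have eS: "eS (r j) \<omega> < \<infinity>"
          by (rule less_trans) simp
        \<comment> \<open>The constant 2 in front of \<open>h \<omega>\<close> cancels the factor
          1/2 in the exponent of \<open>\<phi>\<close>; this is why the limiting exponent carries
          the full quadratic variation.\<close>
        have "Q (r j) \<omega> \<le> 2 * eS (r j) \<omega> + 2 * h \<omega>"
          using square_diff_nn_integral_le[of "{s..t}" "{0..t}" "{s..t}" "\<lambda>u. ?S (r j) u \<omega>" "\<lambda>u. H u \<omega>" "\<lambda>_. 0"]
            square_nn_integral_section_measurable(1)[OF jointS _ _ w, of "{0..t}"]
            square_nn_integral_section_measurable(1)[OF progressively_measurable_joint[OF H t] _ _ w, of "{s..t}"] assms(1)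
          by (simp add: Q_def eS_def h_def)
        then have "enn2real (Q (r j) \<omega>) \<le> enn2real (2 * eS (r j) \<omega> + 2 * h \<omega>)"
          using eS h by (intro enn2real_mono) (auto simp: ennreal_mult_less_top)
        also have "\<dots> = 2 * (enn2real (eS (r j) \<omega>) + enn2real (h \<omega>))"
          using eS h by (subst enn2real_plus) (auto simp: ennreal_mult_less_top enn2real_mult)
        finally have "enn2real (Q (r j) \<omega>) / 2 \<le> enn2real (eS (r j) \<omega>) + enn2real (h \<omega>)"
          by simp
        then have "l\<^sup>2 * (enn2real (Q (r j) \<omega>) / 2) \<le> l\<^sup>2 * (enn2real (eS (r j) \<omega>) + enn2real (h \<omega>))"
          by (intro mult_left_mono) auto
        then show "\<psi> j \<le> \<phi> (r j) \<omega>"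
          unfolding \<psi>_def \<phi>_def using G(2)[OF w]
          by (subst ennreal_mult[symmetric]) (auto intro!: ennreal_leI mult_left_mono)
      qed
    qed
    finally show "ennreal (G \<omega> * exp (l * (J \<omega> - I \<omega>) - l\<^sup>2 * enn2real (h \<omega>))) \<le> liminf (\<lambda>j. \<phi> (r j) \<omega>)" .
  qed
  also have "\<dots> \<le> liminf (\<lambda>j. \<integral>\<^sup>+\<omega>. \<phi> (r j) \<omega> \<partial>M)"
    by (rule nn_integral_liminf) measurable
  also have "\<dots> = (\<integral>\<^sup>+\<omega>. ennreal (G \<omega>) \<partial>M)"
    unfolding int by (simp add: Liminf_const)
  finally show ?thesis unfolding h_def .
qed

section \<open>Exponential moments of the square-root diffusion\<close>

text \<open>Right ends are sampled because the summation by parts below produces the values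
  \<open>y (Suc i)\<close>. Each term is compared with an increment of the antiderivative by the
  mean value theorem and uniform continuity.\<close>

lemma riemann_sum_tendsto_integral:
  fixes f :: "real \<Rightarrow> real"
  assumes "continuous_on {a..b} f" "a \<le> b"
  shows "(\<lambda>N. \<Sum>i<Suc N. f (a + real (Suc i) * ((b - a) / real (Suc N))) * ((b - a) / real (Suc N)))
    \<longlonglongrightarrow> integral {a..b} f"
proof (rule LIMSEQ_I)
  fix e :: real assume e: "e > 0"
  define \<Phi> where "\<Phi> u = integral {a..u} f" for u
  \<comment> \<open>The summand 1 keeps the quotient meaningful when \<open>a = b\<close> and makes
    the final inequality strict.\<close>
  define e' where "e' = e / (b - a + 1)"
  have e': "e' > 0" using e assms by (simp add: e'_def)
  have "uniformly_continuous_on {a..b} f"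
    using assms by (intro compact_uniformly_continuous) auto
  then obtain d where d: "d > 0" "\<And>u v. u \<in> {a..b} \<Longrightarrow> v \<in> {a..b} \<Longrightarrow> \<bar>u - v\<bar> < d \<Longrightarrow> \<bar>f u - f v\<bar> < e'"
    using e' unfolding uniformly_continuous_on_def dist_real_def by metis
  obtain N0 where N0: "(b - a) / d < real N0"
    using reals_Archimedean2 by blast
  have deriv: "(\<Phi> has_derivative (\<lambda>w. f u * w)) (at u within {a..b})" if "u \<in> {a..b}" for u
    using integral_has_real_derivative[OF assms(1) that] unfolding \<Phi>_def has_field_derivative_def by (simp add: mult_commute_abs)
  have step: "\<bar>f v * (v - u) - (\<Phi> v - \<Phi> u)\<bar> \<le> e' * (v - u)" if "a \<le> u" "u \<le> v" "v \<le> b" "v - u < d" for u v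
  proof (cases "u = v")
    case False
    then have "u < v" using that by simp
    moreover have "(\<Phi> has_derivative (\<lambda>w. f z * w)) (at z within {u..v})" if "z \<in> {u..v}" for z
      using that \<open>a \<le> u\<close> \<open>v \<le> b\<close> by (intro has_derivative_subset[OF deriv]) auto
    ultimately obtain z where z: "z \<in> {u<..<v}" "\<Phi> v - \<Phi> u = f z * (v - u)"
      using mvt_simple[of u v \<Phi> "\<lambda>z w. f z * w"] by (metis atLeastAtMost_iff)
    have "\<bar>f v - f z\<bar> < e'"
      using z(1) that by (intro d(2)) auto
    then have "\<bar>f v - f z\<bar> * (v - u) \<le> e' * (v - u)"
      using that by (intro mult_right_mono) auto
    moreover have "f v * (v - u) - (\<Phi> v - \<Phi> u) = (f v - f z) * (v - u)"
      unfolding z(2) by (simp add: algebra_simps)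
    ultimately show ?thesis
      using that by (simp add: abs_mult)
  qed simp
  have "norm ((\<Sum>i<Suc N. f (a + real (Suc i) * ((b - a) / real (Suc N))) * ((b - a) / real (Suc N))) - integral {a..b} f) < e"
    if "N \<ge> N0" for N
  proof -
    define D where "D = (b - a) / real (Suc N)"
    have D: "D \<ge> 0" "real (Suc N) * D = b - a" "D < d"
    proof -
      show "D \<ge> 0" "real (Suc N) * D = b - a"
        using assms by (auto simp: D_def)
      have "(b - a) / d < real (Suc N)"
        using N0 that by linarith
      then show "D < d"
        using d(1) by (simp add: D_def field_simps)
    qed
    have p: "a + real i * D \<in> {a..b}" if "i \<le> Suc N" for i
    proof -
      have "real i * D \<le> real (Suc N) * D"
        using that D(1) by (intro mult_right_mono) auto
      then show ?thesis using D by simp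
    qed
    have tel: "(\<Sum>i<Suc N. \<Phi> (a + real (Suc i) * D) - \<Phi> (a + real i * D)) = integral {a..b} f"
      unfolding sum_lessThan_telescope[of "\<lambda>i. \<Phi> (a + real i * D)"] D(2) by (simp add: \<Phi>_def)
    have "norm ((\<Sum>i<Suc N. f (a + real (Suc i) * D) * D) - integral {a..b} f) =
        norm (\<Sum>i<Suc N. f (a + real (Suc i) * D) * D - (\<Phi> (a + real (Suc i) * D) - \<Phi> (a + real i * D)))"
      unfolding tel[symmetric] sum_subtractf ..
    also have "\<dots> \<le> (\<Sum>i<Suc N. e' * D)"
    proof (rule sum_norm_le)
      fix i assume i: "i \<in> {..<Suc N}"
      have "a + real i * D \<le> a + real (Suc i) * D"
        using D(1) by (simp add: algebra_simps)
      moreover have "a + real (Suc i) * D - (a + real i * D) = D"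
        by (simp add: algebra_simps)
      ultimately show "norm (f (a + real (Suc i) * D) * D - (\<Phi> (a + real (Suc i) * D) - \<Phi> (a + real i * D))) \<le> e' * D"
        using step[of "a + real i * D" "a + real (Suc i) * D"] p[of i] p[of "Suc i"] D i by simp
    qed
    also have "\<dots> = e' * (b - a)"
      using D(2) by (simp add: mult.left_commute)
    also have "\<dots> < e"
      using e assms(2) by (simp add: e'_def field_simps)
    finally show ?thesis unfolding D_def .
  qed
  then show "\<exists>N0. \<forall>N\<ge>N0. norm ((\<Sum>i<Suc N. f (a + real (Suc i) * ((b - a) / real (Suc N))) * ((b - a) / real (Suc N))) -
      integral {a..b} f) < e"
    by blast
qed

section \<open>The square-root diffusion and the integral of its paths\<close>

locale cir_process = standard_wiener_process M F W
  for M :: "'a measure" and F :: "real \<Rightarrow> 'a measure" and W :: "real \<Rightarrow> 'a \<Rightarrow> real" +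
  fixes x \<beta> \<delta> \<gamma> :: real and X :: "real \<Rightarrow> 'a \<Rightarrow> real"
  assumes beta_pos: "0 < \<beta>" and delta_nonneg: "0 \<le> \<delta>"
    and X_nonneg: "0 \<le> t \<Longrightarrow> \<omega> \<in> space M \<Longrightarrow> 0 \<le> X t \<omega>"
    and X_adapted: "adapted_process F X"
    and X_continuous: "\<omega> \<in> space M \<Longrightarrow> continuous_on {0..} (\<lambda>t. X t \<omega>)"
    and X_solves: "solves_sde M F W (\<lambda>y. \<delta> - \<gamma> * y) (\<lambda>y. \<beta> * sqrt y) X"
    and X_initial: "AE \<omega> in M. X 0 \<omega> = x"
begin

definition J :: "real \<Rightarrow> 'a \<Rightarrow> real" where
  "J t \<omega> = integral {0..t} (\<lambda>u. X u \<omega>)"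

lemma X_measurable: "0 \<le> t \<Longrightarrow> X t \<in> borel_measurable (F t)"
  using X_adapted by (simp add: adapted_process_def)

lemma X_measurable_later: "0 \<le> s \<Longrightarrow> s \<le> t \<Longrightarrow> X s \<in> borel_measurable (F t)"
  using X_measurable filtration_measurable_mono by blast

lemma X_measurable_M: "0 \<le> t \<Longrightarrow> X t \<in> borel_measurable M"
  using X_measurable filtration_measurable by blast

lemma X_continuous_Icc: "\<omega> \<in> space M \<Longrightarrow> 0 \<le> s \<Longrightarrow> continuous_on {s..t} (\<lambda>t. X t \<omega>)"
  by (rule continuous_on_subset[OF X_continuous]) auto

lemma X_integrable: "\<omega> \<in> space M \<Longrightarrow> 0 \<le> s \<Longrightarrow> (\<lambda>u. X u \<omega>) integrable_on {s..t}"
  by (intro integrable_continuous_interval X_continuous_Icc)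

text \<open>The Riemann sums have nodes at most \<open>t\<close>, so they are measurable at time
  \<open>t\<close> by adaptedness, and path continuity passes to the limit. Adaptedness of
  \<open>J\<close> is what allows it inside the weights of
  \<open>exponential_cir_grid\<close>.\<close>

lemma J_measurable:
  assumes "0 \<le> t"
  shows "J t \<in> borel_measurable (F t)"
proof (rule borel_measurable_LIMSEQ_real)
  let ?R = "\<lambda>N \<omega>. \<Sum>i<Suc N. X (0 + real (Suc i) * ((t - 0) / real (Suc N))) \<omega> * ((t - 0) / real (Suc N))"
  show "(\<lambda>N. ?R N \<omega>) \<longlonglongrightarrow> J t \<omega>" if "\<omega> \<in> space (F t)" for \<omega>
    unfolding J_def using that assms filtration_space
    by (intro riemann_sum_tendsto_integral X_continuous_Icc) auto
  show "?R N \<in> borel_measurable (F t)" for N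
  proof (intro borel_measurable_sum borel_measurable_times borel_measurable_const X_measurable_later)
    fix i assume i: "i \<in> {..<Suc N}"
    show "0 \<le> 0 + real (Suc i) * ((t - 0) / real (Suc N))"
      using assms by simp
    have "real (Suc i) * t \<le> real (Suc N) * t"
      using i assms by (intro mult_right_mono) auto
    then show "0 + real (Suc i) * ((t - 0) / real (Suc N)) \<le> t"
      by (simp add: field_simps)
  qed
qed

lemma J_measurable_later: "0 \<le> s \<Longrightarrow> s \<le> t \<Longrightarrow> J s \<in> borel_measurable (F t)"
  using J_measurable filtration_measurable_mono by blast

lemma J_diff:
  assumes "\<omega> \<in> space M" "0 \<le> s" "s \<le> t"
  shows "J t \<omega> - J s \<omega> = integral {s..t} (\<lambda>u. X u \<omega>)"
  using Henstock_Kurzweil_Integration.integral_combine[OF assms(2,3) X_integrable[OF assms(1)]] by (simp add: J_def)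

lemma J_mono: "\<omega> \<in> space M \<Longrightarrow> 0 \<le> s \<Longrightarrow> s \<le> t \<Longrightarrow> J s \<omega> \<le> J t \<omega>"
  using J_diff[of \<omega> s t] integral_nonneg[OF X_integrable[of \<omega> s t]] X_nonneg by fastforce

lemma drift_integral:
  assumes "\<omega> \<in> space M" "0 \<le> t"
  shows "(LINT u:{0..t}|lborel. \<delta> - \<gamma> * X u \<omega>) = \<delta> * t - \<gamma> * J t \<omega>"
proof -
  have "set_integrable lborel {0..t} (\<lambda>u. \<delta> - \<gamma> * X u \<omega>)"
    using assms by (intro borel_integrable_atLeastAtMost' continuous_intros X_continuous_Icc) auto
  then have "(LINT u:{0..t}|lborel. \<delta> - \<gamma> * X u \<omega>) = integral {0..t} (\<lambda>u. \<delta> - \<gamma> * X u \<omega>)"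
    by (rule set_borel_integral_eq_integral)
  also have "\<dots> = \<delta> * t - \<gamma> * J t \<omega>"
    using assms X_integrable[of \<omega> 0 t] unfolding J_def
    by (subst integral_diff) (auto intro!: integrable_on_mult_right)
  finally show ?thesis .
qed

lemma quadratic_variation:
  assumes "\<omega> \<in> space M" "0 \<le> s" "s \<le> t"
  shows "enn2real (\<integral>\<^sup>+r\<in>{s..t}. ennreal ((\<beta> * sqrt (X r \<omega>))\<^sup>2) \<partial>lborel) = \<beta>\<^sup>2 * (J t \<omega> - J s \<omega>)"
proof -
  have int: "set_integrable lborel {s..t} (\<lambda>u. \<beta>\<^sup>2 * X u \<omega>)"
    using assms by (intro borel_integrable_atLeastAtMost' continuous_intros X_continuous_Icc) auto
  have "(\<integral>\<^sup>+r\<in>{s..t}. ennreal ((\<beta> * sqrt (X r \<omega>))\<^sup>2) \<partial>lborel) =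
      (\<integral>\<^sup>+r. ennreal (indicator {s..t} r *\<^sub>R (\<beta>\<^sup>2 * X r \<omega>)) \<partial>lborel)"
    using assms X_nonneg by (intro nn_integral_cong) (auto simp: power_mult_distrib split: split_indicator)
  also have "\<dots> = ennreal (LINT u:{s..t}|lborel. \<beta>\<^sup>2 * X u \<omega>)"
    using int assms X_nonneg unfolding set_integrable_def set_lebesgue_integral_def
    by (intro nn_integral_eq_integral) (auto split: split_indicator)
  also have "(LINT u:{s..t}|lborel. \<beta>\<^sup>2 * X u \<omega>) = \<beta>\<^sup>2 * (J t \<omega> - J s \<omega>)"
    unfolding set_borel_integral_eq_integral(2)[OF int] J_diff[OF assms] by (rule integral_mult_right)
  finally show ?thesis
    using J_mono[OF assms] by simp
qed

text \<open>The equation is solved for the Ito integral at both times. All later estimates use the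
  equation only through this inequality.\<close>

lemma exponential_cir_increment:
  assumes "0 \<le> s" "s < t" and G: "G \<in> borel_measurable (F s)" "\<And>\<omega>. \<omega> \<in> space M \<Longrightarrow> 0 \<le> G \<omega>"
  shows "(\<integral>\<^sup>+\<omega>. ennreal (G \<omega> * exp (l * (X t \<omega> - X s \<omega> - \<delta> * (t - s) + \<gamma> * (J t \<omega> - J s \<omega>)) -
      l\<^sup>2 * \<beta>\<^sup>2 * (J t \<omega> - J s \<omega>))) \<partial>M) \<le> (\<integral>\<^sup>+\<omega>. ennreal (G \<omega>) \<partial>M)"
proof -
  obtain I where I: "has_ito_integral M F W (\<lambda>s \<omega>. \<beta> * sqrt (X s \<omega>)) s I"
    "AE \<omega> in M. X s \<omega> = X 0 \<omega> + (LINT u:{0..s}|lborel. \<delta> - \<gamma> * X u \<omega>) + I \<omega>"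
    using X_solves assms(1) unfolding solves_sde_def by blast
  obtain K where K: "has_ito_integral M F W (\<lambda>s \<omega>. \<beta> * sqrt (X s \<omega>)) t K"
    "AE \<omega> in M. X t \<omega> = X 0 \<omega> + (LINT u:{0..t}|lborel. \<delta> - \<gamma> * X u \<omega>) + K \<omega>"
    using X_solves assms(1,2) unfolding solves_sde_def by (meson less_imp_le order_trans)
  have "(\<integral>\<^sup>+\<omega>. ennreal (G \<omega> * exp (l * (X t \<omega> - X s \<omega> - \<delta> * (t - s) + \<gamma> * (J t \<omega> - J s \<omega>)) -
      l\<^sup>2 * \<beta>\<^sup>2 * (J t \<omega> - J s \<omega>))) \<partial>M) =
    (\<integral>\<^sup>+\<omega>. ennreal (G \<omega> * exp (l * (K \<omega> - I \<omega>) -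
      l\<^sup>2 * enn2real (\<integral>\<^sup>+r\<in>{s..t}. ennreal ((\<beta> * sqrt (X r \<omega>))\<^sup>2) \<partial>lborel))) \<partial>M)"
  proof (rule nn_integral_cong_AE, use I(2) K(2) AE_space in eventually_elim)
    fix \<omega> assume w: "\<omega> \<in> space M"
      and "X s \<omega> = X 0 \<omega> + (LINT u:{0..s}|lborel. \<delta> - \<gamma> * X u \<omega>) + I \<omega>"
      and "X t \<omega> = X 0 \<omega> + (LINT u:{0..t}|lborel. \<delta> - \<gamma> * X u \<omega>) + K \<omega>"
    then have "K \<omega> - I \<omega> = X t \<omega> - X s \<omega> - \<delta> * (t - s) + \<gamma> * (J t \<omega> - J s \<omega>)"
      using assms(1,2) by (simp add: drift_integral algebra_simps)
    then show "ennreal (G \<omega> * exp (l * (X t \<omega> - X s \<omega> - \<delta> * (t - s) + \<gamma> * (J t \<omega> - J s \<omega>)) -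
        l\<^sup>2 * \<beta>\<^sup>2 * (J t \<omega> - J s \<omega>))) =
      ennreal (G \<omega> * exp (l * (K \<omega> - I \<omega>) -
        l\<^sup>2 * enn2real (\<integral>\<^sup>+r\<in>{s..t}. ennreal ((\<beta> * sqrt (X r \<omega>))\<^sup>2) \<partial>lborel)))"
      using w assms(1,2) by (simp add: quadratic_variation mult.assoc)
  qed
  also have "\<dots> \<le> (\<integral>\<^sup>+\<omega>. ennreal (G \<omega>) \<partial>M)"
    by (rule exponential_ito_increment[OF assms(1,2) I(1) K(1) G])
  finally show ?thesis .
qed

text \<open>A deterministic rate that changes from cell to cell is obtained by iterating the
  one-step inequality, with the exponential of the past absorbed into the weight. This imitates a
  time-dependent integrand without introducing further Ito integrals.\<close>

lemma exponential_cir_grid: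
  assumes "0 \<le> s" "0 < d" and G: "G \<in> borel_measurable (F s)" "\<And>\<omega>. \<omega> \<in> space M \<Longrightarrow> 0 \<le> G \<omega>"
  defines "p \<equiv> \<lambda>i. s + real i * d"
  shows "(\<integral>\<^sup>+\<omega>. ennreal (G \<omega> * exp (\<Sum>i<N. l i * (X (p (Suc i)) \<omega> - X (p i) \<omega> - \<delta> * d +
      \<gamma> * (J (p (Suc i)) \<omega> - J (p i) \<omega>)) - (l i)\<^sup>2 * \<beta>\<^sup>2 * (J (p (Suc i)) \<omega> - J (p i) \<omega>))) \<partial>M)
    \<le> (\<integral>\<^sup>+\<omega>. ennreal (G \<omega>) \<partial>M)"
proof (induction N)
  case 0
  then show ?case by simp
next
  case (Suc N)
  have p: "0 \<le> p i" "p i < p (Suc i)" "i \<le> j \<Longrightarrow> p i \<le> p j" "p (Suc i) - p i = d" for i j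
    using assms(1,2) by (auto simp: p_def algebra_simps intro!: mult_right_mono)
  have ps: "s \<le> p i" for i
    using assms(1,2) by (simp add: p_def)
  define H where "H \<omega> = G \<omega> * exp (\<Sum>i<N. l i * (X (p (Suc i)) \<omega> - X (p i) \<omega> - \<delta> * d +
      \<gamma> * (J (p (Suc i)) \<omega> - J (p i) \<omega>)) - (l i)\<^sup>2 * \<beta>\<^sup>2 * (J (p (Suc i)) \<omega> - J (p i) \<omega>))" for \<omega>
  have meas: "X (p i) \<in> borel_measurable (F (p N))" "J (p i) \<in> borel_measurable (F (p N))" if "i \<le> N" for i
    using that p by (auto intro: X_measurable_later J_measurable_later)
  have sum: "(\<lambda>\<omega>. \<Sum>i<N. l i * (X (p (Suc i)) \<omega> - X (p i) \<omega> - \<delta> * d +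
      \<gamma> * (J (p (Suc i)) \<omega> - J (p i) \<omega>)) - (l i)\<^sup>2 * \<beta>\<^sup>2 * (J (p (Suc i)) \<omega> - J (p i) \<omega>)) \<in> borel_measurable (F (p N))"
  proof (rule borel_measurable_sum)
    fix i assume "i \<in> {..<N}"
    then have [measurable]: "X (p i) \<in> borel_measurable (F (p N))" "J (p i) \<in> borel_measurable (F (p N))"
      "X (p (Suc i)) \<in> borel_measurable (F (p N))" "J (p (Suc i)) \<in> borel_measurable (F (p N))"
      using meas[of i] meas[of "Suc i"] by auto
    show "(\<lambda>\<omega>. l i * (X (p (Suc i)) \<omega> - X (p i) \<omega> - \<delta> * d +
      \<gamma> * (J (p (Suc i)) \<omega> - J (p i) \<omega>)) - (l i)\<^sup>2 * \<beta>\<^sup>2 * (J (p (Suc i)) \<omega> - J (p i) \<omega>)) \<in> borel_measurable (F (p N))"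
      by measurable
  qed
  have "G \<in> borel_measurable (F (p N))"
    using assms(1) ps by (intro filtration_measurable_mono[OF _ _ G(1)])
  then have "H \<in> borel_measurable (F (p N))"
    unfolding H_def[abs_def] using sum by measurable
  moreover have "0 \<le> H \<omega>" if "\<omega> \<in> space M" for \<omega>
    using G(2)[OF that] by (simp add: H_def)
  ultimately have "(\<integral>\<^sup>+\<omega>. ennreal (H \<omega> * exp (l N * (X (p (Suc N)) \<omega> - X (p N) \<omega> - \<delta> * (p (Suc N) - p N) +
      \<gamma> * (J (p (Suc N)) \<omega> - J (p N) \<omega>)) - (l N)\<^sup>2 * \<beta>\<^sup>2 * (J (p (Suc N)) \<omega> - J (p N) \<omega>))) \<partial>M)
      \<le> (\<integral>\<^sup>+\<omega>. ennreal (H \<omega>) \<partial>M)"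
    by (intro exponential_cir_increment p)
  also have "\<dots> \<le> (\<integral>\<^sup>+\<omega>. ennreal (G \<omega>) \<partial>M)"
    unfolding H_def by (rule Suc.IH)
  finally show ?case
    unfolding H_def p(4) by (simp only: mult.assoc exp_add[symmetric] sum.lessThan_Suc)
qed

text \<open>Abel summation. With \<open>D\<close> equal to \<open>L\<close> times the mesh, the last
  term becomes \<open>L\<close> times a Riemann sum of the path, which will compensate the integral
  of \<open>X\<close>.\<close>

lemma affine_weight_summation_by_parts:
  fixes y :: "nat \<Rightarrow> real"
  shows "(\<Sum>i<N. (A - D * real i) * (y (Suc i) - y i)) =
    (A - D * real N) * y N - A * y 0 + D * (\<Sum>i<N. y (Suc i))"
  by (induction N) (auto simp: algebra_simps)

text \<open>
  With \<open>t = s + h\<close>, the weight \<open>\<lambda>(u) = \<mu> + L (t - u)\<close> satisfies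
  \<open>\<lambda>' \<le> \<gamma> \<lambda> - \<beta>\<^sup>2 \<lambda>\<^sup>2\<close>, so the integral of \<open>X \<ge> 0\<close> can be dropped from the exponent.
\<close>

lemma exponential_moment_transition:
  assumes "0 \<le> s" "0 < h" and G: "G \<in> borel_measurable (F s)" "\<And>\<omega>. \<omega> \<in> space M \<Longrightarrow> 0 \<le> G \<omega>"
    and "0 \<le> L" and riccati: "\<And>\<theta>. 0 \<le> \<theta> \<Longrightarrow> \<theta> \<le> h \<Longrightarrow> \<beta>\<^sup>2 * (\<mu> + L * \<theta>)\<^sup>2 - \<gamma> * (\<mu> + L * \<theta>) \<le> L"
  shows "(\<integral>\<^sup>+\<omega>. ennreal (G \<omega> * exp (\<mu> * (X (s + h) \<omega> - X s \<omega>) - L * h * X s \<omega> - \<delta> * h * (\<bar>\<mu>\<bar> + L * h))) \<partial>M)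
    \<le> (\<integral>\<^sup>+\<omega>. ennreal (G \<omega>) \<partial>M)"
proof -
  define d where "d N = h / real (Suc N)" for N
  define p where "p N i = s + real i * d N" for N i
  \<comment> \<open>The affine weight sampled at the left ends of the cells. It starts with
    \<open>\<mu> + L * h\<close> and would reach \<open>\<mu>\<close> at index \<open>Suc N\<close>;
    that value becomes the coefficient of \<open>X (s + h)\<close> after summation by parts.\<close>
  define l where "l N i = (\<mu> + L * h) - L * d N * real i" for N i
  define e where "e N \<omega> = (\<Sum>i<Suc N. l N i * (X (p N (Suc i)) \<omega> - X (p N i) \<omega> - \<delta> * d N +
      \<gamma> * (J (p N (Suc i)) \<omega> - J (p N i) \<omega>)) - (l N i)\<^sup>2 * \<beta>\<^sup>2 * (J (p N (Suc i)) \<omega> - J (p N i) \<omega>))" for N \<omega>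
  define R where "R N \<omega> = (\<Sum>i<Suc N. X (p N (Suc i)) \<omega> * d N)" for N \<omega>
  define c where "c \<omega> = \<mu> * (X (s + h) \<omega> - X s \<omega>) - L * h * X s \<omega> - \<delta> * h * (\<bar>\<mu>\<bar> + L * h)" for \<omega>
  have d: "d N > 0" "real (Suc N) * d N = h" for N
    using assms(2) by (auto simp: d_def)
  have p0: "p N 0 = s" "p N (Suc N) = s + h" for N
    using d(2)[of N] by (auto simp: p_def)
  have p: "0 \<le> p N i" "p N i \<le> p N (Suc i)" for N i
    using assms(1) d(1)[of N] by (auto simp: p_def algebra_simps intro!: add_nonneg_nonneg)
  have theta: "0 \<le> h - d N * real i" "h - d N * real i \<le> h" if "i < Suc N" for N i
  proof -
    have "d N * real i \<le> d N * real (Suc N)"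
      using d(1)[of N] that by (intro mult_left_mono) auto
    then show "0 \<le> h - d N * real i" "h - d N * real i \<le> h"
      using d(1,2)[of N] by (auto simp: mult.commute)
  qed
  have l: "l N i = \<mu> + L * (h - d N * real i)" for N i
    by (simp add: l_def algebra_simps)
  have int: "(\<integral>\<^sup>+\<omega>. ennreal (G \<omega> * exp (e N \<omega>)) \<partial>M) \<le> (\<integral>\<^sup>+\<omega>. ennreal (G \<omega>) \<partial>M)" for N
    unfolding e_def p_def by (rule exponential_cir_grid[OF assms(1) d(1) G])
  \<comment> \<open>The Riccati inequality bounds the coefficient of each increment of
    \<open>J\<close> below by \<open>- L\<close>, and summation by parts contributes
    \<open>L * R N \<omega>\<close>. The two nearly cancel, and the discrepancy vanishes with the
    mesh.\<close>
  have lower: "c \<omega> + L * (R N \<omega> - (J (s + h) \<omega> - J s \<omega>)) \<le> e N \<omega>" if w: "\<omega> \<in> space M" for N \<omega>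
  proof -
    have "(\<Sum>i<Suc N. l N i * (X (p N (Suc i)) \<omega> - X (p N i) \<omega>) - \<delta> * (\<bar>\<mu>\<bar> + L * h) * d N -
        L * (J (p N (Suc i)) \<omega> - J (p N i) \<omega>)) \<le> e N \<omega>"
      unfolding e_def
    proof (rule sum_mono)
      fix i assume "i \<in> {..<Suc N}"
      then have th: "0 \<le> h - d N * real i" "h - d N * real i \<le> h"
        using theta by auto
      have "(\<beta>\<^sup>2 * (l N i)\<^sup>2 - \<gamma> * l N i) * (J (p N (Suc i)) \<omega> - J (p N i) \<omega>) \<le> L * (J (p N (Suc i)) \<omega> - J (p N i) \<omega>)"
        unfolding l using riccati[OF th] J_mono[OF w p] by (intro mult_right_mono) auto
      moreover have "L * (h - d N * real i) \<le> L * h"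
        using th \<open>0 \<le> L\<close> by (intro mult_left_mono) auto
      then have "l N i \<le> \<bar>\<mu>\<bar> + L * h"
        unfolding l by linarith
      then have "l N i * (\<delta> * d N) \<le> (\<bar>\<mu>\<bar> + L * h) * (\<delta> * d N)"
        using delta_nonneg d(1)[of N] by (intro mult_right_mono) (auto intro: less_imp_le)
      ultimately show "l N i * (X (p N (Suc i)) \<omega> - X (p N i) \<omega>) - \<delta> * (\<bar>\<mu>\<bar> + L * h) * d N -
          L * (J (p N (Suc i)) \<omega> - J (p N i) \<omega>) \<le>
        l N i * (X (p N (Suc i)) \<omega> - X (p N i) \<omega> - \<delta> * d N + \<gamma> * (J (p N (Suc i)) \<omega> - J (p N i) \<omega>)) -
          (l N i)\<^sup>2 * \<beta>\<^sup>2 * (J (p N (Suc i)) \<omega> - J (p N i) \<omega>)"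
        by (simp add: algebra_simps)
    qed
    moreover have "(\<Sum>i<Suc N. l N i * (X (p N (Suc i)) \<omega> - X (p N i) \<omega>)) =
        \<mu> * X (s + h) \<omega> - (\<mu> + L * h) * X s \<omega> + L * R N \<omega>"
      unfolding l_def affine_weight_summation_by_parts[of _ _ "\<lambda>i. X (p N i) \<omega>"] p0
      using d(2)[of N] by (simp only: R_def sum_distrib_right[symmetric]) (simp add: algebra_simps)
    moreover have "(\<Sum>i<Suc N. \<delta> * (\<bar>\<mu>\<bar> + L * h) * d N) = \<delta> * h * (\<bar>\<mu>\<bar> + L * h)"
      using d(2)[of N] by (simp add: algebra_simps)
    moreover have "(\<Sum>i<Suc N. L * (J (p N (Suc i)) \<omega> - J (p N i) \<omega>)) = L * (J (s + h) \<omega> - J s \<omega>)"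
      unfolding sum_distrib_left[symmetric] sum_lessThan_telescope[of "\<lambda>i. J (p N i) \<omega>"] p0 ..
    ultimately show ?thesis
      unfolding sum_subtractf c_def by (simp add: algebra_simps)
  qed
  have [measurable]: "G \<in> borel_measurable M"
    using G(1) assms(1) filtration_measurable by blast
  have [measurable]: "X (p N i) \<in> borel_measurable M" "J (p N i) \<in> borel_measurable M" for N i
    using p(1) X_measurable_M filtration_measurable[OF _ J_measurable] by auto
  have [measurable]: "e N \<in> borel_measurable M" for N
    unfolding e_def[abs_def] by measurable
  have "(\<integral>\<^sup>+\<omega>. ennreal (G \<omega> * exp (c \<omega>)) \<partial>M) \<le> (\<integral>\<^sup>+\<omega>. liminf (\<lambda>N. ennreal (G \<omega> * exp (e N \<omega>))) \<partial>M)"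
  proof (rule nn_integral_mono)
    fix \<omega> assume w: "\<omega> \<in> space M"
    have "(\<lambda>N. R N \<omega>) \<longlonglongrightarrow> integral {s..s + h} (\<lambda>u. X u \<omega>)"
      using riemann_sum_tendsto_integral[OF X_continuous_Icc[OF w assms(1), of "s + h"]] assms(2)
      by (simp add: R_def p_def d_def)
    then have "(\<lambda>N. R N \<omega>) \<longlonglongrightarrow> J (s + h) \<omega> - J s \<omega>"
      using J_diff[OF w assms(1), of "s + h"] assms(2) by simp
    then have "(\<lambda>N. ennreal (G \<omega> * exp (c \<omega> + L * (R N \<omega> - (J (s + h) \<omega> - J s \<omega>))))) \<longlonglongrightarrow>
        ennreal (G \<omega> * exp (c \<omega> + L * ((J (s + h) \<omega> - J s \<omega>) - (J (s + h) \<omega> - J s \<omega>))))"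
      by (intro tendsto_intros tendsto_ennrealI)
    then have "ennreal (G \<omega> * exp (c \<omega>)) =
        liminf (\<lambda>N. ennreal (G \<omega> * exp (c \<omega> + L * (R N \<omega> - (J (s + h) \<omega> - J s \<omega>)))))"
      by (simp add: lim_imp_Liminf)
    also have "\<dots> \<le> liminf (\<lambda>N. ennreal (G \<omega> * exp (e N \<omega>)))"
      using lower[OF w] G(2)[OF w]
      by (intro Liminf_mono always_eventually allI ennreal_leI mult_left_mono) auto
    finally show "ennreal (G \<omega> * exp (c \<omega>)) \<le> liminf (\<lambda>N. ennreal (G \<omega> * exp (e N \<omega>)))" .
  qed
  also have "\<dots> \<le> liminf (\<lambda>N. \<integral>\<^sup>+\<omega>. ennreal (G \<omega> * exp (e N \<omega>)) \<partial>M)"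
    by (rule nn_integral_liminf) measurable
  also have "\<dots> \<le> (\<integral>\<^sup>+\<omega>. ennreal (G \<omega>) \<partial>M)"
    using int by (intro Liminf_le always_eventually allI) auto
  finally show ?thesis unfolding c_def .
qed

end

section \<open>Elementary inequalities for powers, exponentials and square roots\<close>

lemma powr_le_exp:
  fixes a p y :: real
  assumes "0 < a" "0 < p" "0 \<le> y"
  shows "y powr p \<le> (p / a) powr p * exp (a * y)"
proof -
  have "a * y / p \<le> exp (a * y / p)"
    using exp_ge_add_one_self[of "a * y / p"] by linarith
  then have "(a * y / p) powr p \<le> exp (a * y / p) powr p"
    using assms by (intro powr_mono2) auto
  also have "exp (a * y / p) powr p = exp (a * y)"
    using assms by (simp add: powr_def)
  finally have "(p / a) powr p * (a * y / p) powr p \<le> (p / a) powr p * exp (a * y)"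
    by (intro mult_left_mono) auto
  also have "(p / a) powr p * (a * y / p) powr p = y powr p"
    using assms by (simp flip: powr_mult)
  finally show ?thesis .
qed

lemma exp_abs_le: "exp (a * \<bar>d\<bar>) \<le> exp (a * d) + exp (- a * d)" for a d :: real
  by (cases "0 \<le> d") (simp_all add: abs_of_neg)

text \<open>The denominator involves only \<open>b\<close>, which will be the earlier value, so the
  normalisation is known at the earlier time. If both values are below \<open>h\<close>, the roots
  differ by at most \<open>sqrt h\<close>. Otherwise \<open>h \<le> a + b\<close>, so
  \<open>sqrt (b + h)\<close> is controlled by the sum of the roots, by which \<open>a - b\<close>
  factorises.\<close>

lemma sqrt_diff_le:
  fixes a b h :: real
  assumes "0 \<le> a" "0 \<le> b" "0 < h"
  shows "\<bar>sqrt a - sqrt b\<bar> \<le> 2 * (\<bar>a - b\<bar> / sqrt (b + h)) + sqrt h"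
proof (cases "a < h \<and> b < h")
  case True
  then have "sqrt a \<le> sqrt h" "sqrt b \<le> sqrt h" "0 \<le> sqrt a" "0 \<le> sqrt b"
    using assms by auto
  then have "\<bar>sqrt a - sqrt b\<bar> \<le> sqrt h" by linarith
  moreover have "0 \<le> 2 * (\<bar>a - b\<bar> / sqrt (b + h))"
    using assms by simp
  ultimately show ?thesis by linarith
next
  case False
  have le: "sqrt (b + h) \<le> 2 * (sqrt a + sqrt b)"
  proof -
    have "b + h \<le> 2\<^sup>2 * (a + b)"
      using False assms by auto
    also have "\<dots> \<le> 2\<^sup>2 * (sqrt a + sqrt b)\<^sup>2"
      using assms by (simp add: power2_sum)
    also have "\<dots> = (2 * (sqrt a + sqrt b))\<^sup>2"
      by (rule power_mult_distrib[symmetric])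
    finally have "b + h \<le> (2 * (sqrt a + sqrt b))\<^sup>2" .
    then show ?thesis
      by (rule real_le_lsqrt[rotated]) (use assms in simp)
  qed
  have "\<bar>a - b\<bar> = \<bar>sqrt a - sqrt b\<bar> * (sqrt a + sqrt b)"
  proof -
    have "a - b = (sqrt a - sqrt b) * (sqrt a + sqrt b)"
      using assms by (simp add: algebra_simps flip: power2_eq_square)
    then show ?thesis
      using assms by (simp add: abs_mult)
  qed
  then have "\<bar>sqrt a - sqrt b\<bar> * sqrt (b + h) \<le> 2 * \<bar>a - b\<bar>"
    using mult_left_mono[OF le, of "\<bar>sqrt a - sqrt b\<bar>"] by (simp add: algebra_simps)
  then have "\<bar>sqrt a - sqrt b\<bar> \<le> 2 * (\<bar>a - b\<bar> / sqrt (b + h))"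
    using assms by (simp add: field_simps)
  moreover have "0 \<le> sqrt h" using assms by simp
  ultimately show ?thesis by linarith
qed

section \<open>Short-time transition estimates and normalised increments\<close>

context cir_process
begin

text \<open>A step length serving two conditions: the product with
  \<open>4 * \<beta>\<^sup>2 + 2 * \<bar>\<gamma>\<bar>\<close> is at most 1, as used for rates up
  to 1, and the product with \<open>4 * \<bar>\<gamma>\<bar>\<close> is at most 1, as used for rates
  that depend on the step. The summand 1 also keeps the step at most 1.\<close>

definition h\<^sub>0 :: real where
  "h\<^sub>0 = 1 / (4 * \<beta>\<^sup>2 + 4 * \<bar>\<gamma>\<bar> + 1)"

lemma h\<^sub>0_bounds: "0 < h\<^sub>0" "h\<^sub>0 \<le> 1" "h\<^sub>0 * (4 * \<beta>\<^sup>2 + 2 * \<bar>\<gamma>\<bar>) \<le> 1" "h\<^sub>0 * (4 * \<bar>\<gamma>\<bar>) \<le> 1"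
proof -
  have "4 * \<beta>\<^sup>2 + 4 * \<bar>\<gamma>\<bar> + 1 > 0" "4 * \<beta>\<^sup>2 \<ge> 0" by (auto intro: add_nonneg_pos)
  then show "0 < h\<^sub>0" "h\<^sub>0 \<le> 1" "h\<^sub>0 * (4 * \<beta>\<^sup>2 + 2 * \<bar>\<gamma>\<bar>) \<le> 1" "h\<^sub>0 * (4 * \<bar>\<gamma>\<bar>) \<le> 1"
    by (auto simp: h\<^sub>0_def divide_simps)
qed

text \<open>The slope \<open>L\<close> is chosen self-consistently: shortness of \<open>h\<close>
  gives \<open>L * h \<le> \<bar>\<mu>\<bar>\<close>, so the affine weight stays within
  \<open>2 * \<bar>\<mu>\<bar>\<close> in absolute value, and for such weights the Riccati
  expression is at most \<open>4 * \<beta>\<^sup>2 * \<mu>\<^sup>2 + 2 * \<bar>\<gamma>\<bar> *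
  \<bar>\<mu>\<bar>\<close>, which is \<open>L\<close> again.\<close>

lemma exponential_moment_short_transition:
  assumes "0 \<le> s" "0 < h" and G: "G \<in> borel_measurable (F s)" "\<And>\<omega>. \<omega> \<in> space M \<Longrightarrow> 0 \<le> G \<omega>"
    and short: "h * (4 * \<beta>\<^sup>2 * \<bar>\<mu>\<bar> + 2 * \<bar>\<gamma>\<bar>) \<le> 1"
  shows "(\<integral>\<^sup>+\<omega>. ennreal (G \<omega> * exp (\<mu> * (X (s + h) \<omega> - X s \<omega>) -
      (4 * \<beta>\<^sup>2 * \<mu>\<^sup>2 + 2 * \<bar>\<gamma>\<bar> * \<bar>\<mu>\<bar>) * h * X s \<omega> - 2 * \<delta> * h * \<bar>\<mu>\<bar>)) \<partial>M)
    \<le> (\<integral>\<^sup>+\<omega>. ennreal (G \<omega>) \<partial>M)"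
proof -
  define L where "L = 4 * \<beta>\<^sup>2 * \<mu>\<^sup>2 + 2 * \<bar>\<gamma>\<bar> * \<bar>\<mu>\<bar>"
  have L: "0 \<le> L" by (simp add: L_def)
  have "L * h = \<bar>\<mu>\<bar> * (h * (4 * \<beta>\<^sup>2 * \<bar>\<mu>\<bar> + 2 * \<bar>\<gamma>\<bar>))"
    by (simp add: L_def algebra_simps power2_eq_square flip: abs_mult)
  also have "\<dots> \<le> \<bar>\<mu>\<bar> * 1"
    using short by (intro mult_left_mono) auto
  finally have Lh: "L * h \<le> \<bar>\<mu>\<bar>" by simp
  have "(\<integral>\<^sup>+\<omega>. ennreal (G \<omega> * exp (\<mu> * (X (s + h) \<omega> - X s \<omega>) - L * h * X s \<omega> - \<delta> * h * (\<bar>\<mu>\<bar> + L * h))) \<partial>M)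
      \<le> (\<integral>\<^sup>+\<omega>. ennreal (G \<omega>) \<partial>M)"
  proof (rule exponential_moment_transition[OF assms(1,2) G L])
    fix \<theta> :: real assume "0 \<le> \<theta>" "\<theta> \<le> h"
    then have "0 \<le> L * \<theta>" "L * \<theta> \<le> L * h"
      using L by (auto intro: mult_left_mono)
    then have b: "\<bar>\<mu> + L * \<theta>\<bar> \<le> 2 * \<bar>\<mu>\<bar>"
      using Lh by linarith
    then have "\<bar>\<mu> + L * \<theta>\<bar>\<^sup>2 \<le> (2 * \<bar>\<mu>\<bar>)\<^sup>2"
      by (intro power_mono) auto
    then have "\<beta>\<^sup>2 * (\<mu> + L * \<theta>)\<^sup>2 \<le> \<beta>\<^sup>2 * (2 * \<bar>\<mu>\<bar>)\<^sup>2"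
      by (intro mult_left_mono) auto
    moreover have "- (\<gamma> * (\<mu> + L * \<theta>)) \<le> \<bar>\<gamma>\<bar> * (2 * \<bar>\<mu>\<bar>)"
    proof -
      have "- (\<gamma> * (\<mu> + L * \<theta>)) \<le> \<bar>\<gamma>\<bar> * \<bar>\<mu> + L * \<theta>\<bar>"
        unfolding abs_mult[symmetric] by linarith
      also have "\<dots> \<le> \<bar>\<gamma>\<bar> * (2 * \<bar>\<mu>\<bar>)"
        using b by (intro mult_left_mono) auto
      finally show ?thesis .
    qed
    ultimately show "\<beta>\<^sup>2 * (\<mu> + L * \<theta>)\<^sup>2 - \<gamma> * (\<mu> + L * \<theta>) \<le> L"
      by (simp add: L_def power_mult_distrib)
  qed
  moreover have "\<delta> * h * (\<bar>\<mu>\<bar> + L * h) \<le> 2 * \<delta> * h * \<bar>\<mu>\<bar>"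
  proof -
    have "\<delta> * h * (\<bar>\<mu>\<bar> + L * h) \<le> \<delta> * h * (2 * \<bar>\<mu>\<bar>)"
      using Lh delta_nonneg assms(2) by (intro mult_left_mono) auto
    then show ?thesis by simp
  qed
  then have "(\<integral>\<^sup>+\<omega>. ennreal (G \<omega> * exp (\<mu> * (X (s + h) \<omega> - X s \<omega>) - L * h * X s \<omega> - 2 * \<delta> * h * \<bar>\<mu>\<bar>)) \<partial>M)
      \<le> (\<integral>\<^sup>+\<omega>. ennreal (G \<omega> * exp (\<mu> * (X (s + h) \<omega> - X s \<omega>) - L * h * X s \<omega> - \<delta> * h * (\<bar>\<mu>\<bar> + L * h))) \<partial>M)"
    using G(2) by (intro nn_integral_mono ennreal_leI mult_left_mono) auto
  ultimately show ?thesis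
    unfolding L_def by (rule order_trans[rotated])
qed

text \<open>The weight \<open>exp ((\<mu> + L * h) * X s \<omega>)\<close> cancels
  \<open>X s\<close> on the left, and \<open>L * h \<le> \<mu>\<close> bounds the rate remaining at
  time \<open>s\<close> by \<open>2 * \<mu>\<close>. The drift costs at most
  \<open>exp (2 * \<delta>)\<close> because \<open>h\<close> and \<open>\<mu>\<close> are at most
  1.\<close>

lemma exponential_moment_doubling:
  assumes "0 \<le> s" "0 < h" "h \<le> h\<^sub>0" "0 \<le> \<mu>" "\<mu> \<le> 1"
  shows "(\<integral>\<^sup>+\<omega>. ennreal (exp (\<mu> * X (s + h) \<omega>)) \<partial>M) \<le>
    ennreal (exp (2 * \<delta>)) * (\<integral>\<^sup>+\<omega>. ennreal (exp (2 * \<mu> * X s \<omega>)) \<partial>M)"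
proof -
  define L where "L = 4 * \<beta>\<^sup>2 * \<mu>\<^sup>2 + 2 * \<bar>\<gamma>\<bar> * \<bar>\<mu>\<bar>"
  have short: "h * (4 * \<beta>\<^sup>2 * \<bar>\<mu>\<bar> + 2 * \<bar>\<gamma>\<bar>) \<le> 1"
  proof -
    have "h * (4 * \<beta>\<^sup>2 * \<bar>\<mu>\<bar> + 2 * \<bar>\<gamma>\<bar>) \<le> h\<^sub>0 * (4 * \<beta>\<^sup>2 * 1 + 2 * \<bar>\<gamma>\<bar>)"
      using assms by (intro mult_mono add_mono) auto
    then show ?thesis using h\<^sub>0_bounds(3) by simp
  qed
  have X: "X s \<in> borel_measurable (F s)"
    using assms by (intro X_measurable)
  have [measurable]: "X s \<in> borel_measurable M" "X (s + h) \<in> borel_measurable M"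
    using assms by (auto intro: X_measurable_M)
  have "L * h = \<mu> * (h * (4 * \<beta>\<^sup>2 * \<bar>\<mu>\<bar> + 2 * \<bar>\<gamma>\<bar>))"
    using assms by (simp add: L_def algebra_simps power2_eq_square)
  also have "\<dots> \<le> \<mu> * 1"
    using short assms by (intro mult_left_mono) auto
  finally have Lh: "L * h \<le> \<mu>" by simp
  have dh: "2 * \<delta> * h * \<bar>\<mu>\<bar> \<le> 2 * \<delta>"
  proof -
    have "2 * \<delta> * (h * \<bar>\<mu>\<bar>) \<le> 2 * \<delta> * (1 * 1)"
      using assms h\<^sub>0_bounds delta_nonneg by (intro mult_left_mono mult_mono) auto
    then show ?thesis by simp
  qed
  have "(\<integral>\<^sup>+\<omega>. ennreal (exp (\<mu> * X (s + h) \<omega>)) \<partial>M) \<le>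
      (\<integral>\<^sup>+\<omega>. ennreal (exp (2 * \<delta>)) * ennreal (exp ((\<mu> + L * h) * X s \<omega>) * exp (\<mu> * (X (s + h) \<omega> - X s \<omega>) -
      L * h * X s \<omega> - 2 * \<delta> * h * \<bar>\<mu>\<bar>)) \<partial>M)"
    using dh by (intro nn_integral_mono)
      (simp add: ennreal_mult[symmetric] exp_add[symmetric] algebra_simps)
  also have "\<dots> = ennreal (exp (2 * \<delta>)) * (\<integral>\<^sup>+\<omega>. ennreal (exp ((\<mu> + L * h) * X s \<omega>) * exp (\<mu> * (X (s + h) \<omega> - X s \<omega>) -
      L * h * X s \<omega> - 2 * \<delta> * h * \<bar>\<mu>\<bar>)) \<partial>M)"
    by (rule nn_integral_cmult) measurable
  also have "\<dots> \<le> ennreal (exp (2 * \<delta>)) * (\<integral>\<^sup>+\<omega>. ennreal (exp ((\<mu> + L * h) * X s \<omega>)) \<partial>M)"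
  proof (rule mult_left_mono)
    have "(\<lambda>\<omega>. exp ((\<mu> + L * h) * X s \<omega>)) \<in> borel_measurable (F s)"
      using X by measurable
    then show "(\<integral>\<^sup>+\<omega>. ennreal (exp ((\<mu> + L * h) * X s \<omega>) * exp (\<mu> * (X (s + h) \<omega> - X s \<omega>) -
        L * h * X s \<omega> - 2 * \<delta> * h * \<bar>\<mu>\<bar>)) \<partial>M) \<le> (\<integral>\<^sup>+\<omega>. ennreal (exp ((\<mu> + L * h) * X s \<omega>)) \<partial>M)"
      unfolding L_def by (intro exponential_moment_short_transition[OF assms(1,2) _ _ short]) auto
  qed auto
  also have "\<dots> \<le> ennreal (exp (2 * \<delta>)) * (\<integral>\<^sup>+\<omega>. ennreal (exp (2 * \<mu> * X s \<omega>)) \<partial>M)"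
    using Lh X_nonneg[OF assms(1)]
    by (intro mult_left_mono nn_integral_mono ennreal_leI) (auto intro!: mult_right_mono)
  finally show ?thesis .
qed

text \<open>The rate is 1 at time 0, where \<open>X\<close> is almost surely the constant
  \<open>x\<close>. Each further step of length \<open>h\<^sub>0\<close> halves the rate and
  multiplies the bound by \<open>exp (2 * \<delta>)\<close>. A bounded horizon takes finitely many
  steps, so a positive rate survives.\<close>

lemma exponential_moments:
  obtains \<epsilon> C where "0 < \<epsilon>" "0 \<le> C" "\<And>t. 0 \<le> t \<Longrightarrow> t \<le> T \<Longrightarrow> (\<integral>\<^sup>+\<omega>. ennreal (exp (\<epsilon> * X t \<omega>)) \<partial>M) \<le> ennreal C"
proof -
  have "\<exists>\<epsilon> C. 0 < \<epsilon> \<and> \<epsilon> \<le> 1 \<and> 0 \<le> C \<and>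
      (\<forall>t. 0 \<le> t \<longrightarrow> t \<le> real n * h\<^sub>0 \<longrightarrow> (\<integral>\<^sup>+\<omega>. ennreal (exp (\<epsilon> * X t \<omega>)) \<partial>M) \<le> ennreal C)" for n
  proof (induction n)
    case 0
    have "(\<integral>\<^sup>+\<omega>. ennreal (exp (1 * X 0 \<omega>)) \<partial>M) = (\<integral>\<^sup>+\<omega>. ennreal (exp x) \<partial>M)"
      using X_initial by (intro nn_integral_cong_AE) auto
    then have "(\<integral>\<^sup>+\<omega>. ennreal (exp (1 * X 0 \<omega>)) \<partial>M) \<le> ennreal (exp x)"
      by (simp add: emeasure_space_1)
    then show ?case
      by (intro exI[of _ 1] exI[of _ "exp x"]) auto
  next
    case (Suc n)
    then obtain \<epsilon> C where IH: "0 < \<epsilon>" "\<epsilon> \<le> 1" "0 \<le> C"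
      "\<And>t. 0 \<le> t \<Longrightarrow> t \<le> real n * h\<^sub>0 \<Longrightarrow> (\<integral>\<^sup>+\<omega>. ennreal (exp (\<epsilon> * X t \<omega>)) \<partial>M) \<le> ennreal C"
      by blast
    have "(\<integral>\<^sup>+\<omega>. ennreal (exp (\<epsilon> / 2 * X t \<omega>)) \<partial>M) \<le> ennreal (exp (2 * \<delta>) * C)"
      if t: "0 \<le> t" "t \<le> real (Suc n) * h\<^sub>0" for t
    proof (cases "t \<le> real n * h\<^sub>0")
      case True
      have "(\<integral>\<^sup>+\<omega>. ennreal (exp (\<epsilon> / 2 * X t \<omega>)) \<partial>M) \<le> (\<integral>\<^sup>+\<omega>. ennreal (exp (\<epsilon> * X t \<omega>)) \<partial>M)"
        using IH(1) X_nonneg[OF t(1)] by (intro nn_integral_mono ennreal_leI) (auto intro!: mult_right_mono)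
      also have "\<dots> \<le> ennreal C" by (intro IH t True)
      also have "\<dots> \<le> ennreal (exp (2 * \<delta>) * C)"
        using IH(3) delta_nonneg by (intro ennreal_leI) (simp add: mult_le_cancel_right1)
      finally show ?thesis .
    next
      case False
      define h where "h = t - real n * h\<^sub>0"
      have h: "0 < h" "h \<le> h\<^sub>0" "real n * h\<^sub>0 + h = t"
        using False t by (auto simp: h_def algebra_simps)
      have "(\<integral>\<^sup>+\<omega>. ennreal (exp (\<epsilon> / 2 * X (real n * h\<^sub>0 + h) \<omega>)) \<partial>M) \<le>
          ennreal (exp (2 * \<delta>)) * (\<integral>\<^sup>+\<omega>. ennreal (exp (2 * (\<epsilon> / 2) * X (real n * h\<^sub>0) \<omega>)) \<partial>M)"
        using IH h h\<^sub>0_bounds by (intro exponential_moment_doubling) auto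
      also have "\<dots> \<le> ennreal (exp (2 * \<delta>)) * ennreal C"
        using IH(4)[of "real n * h\<^sub>0"] h\<^sub>0_bounds by (intro mult_left_mono) auto
      finally show ?thesis
        unfolding h by (simp add: ennreal_mult')
    qed
    then show ?case
      using IH by (intro exI[of _ "\<epsilon> / 2"] exI[of _ "exp (2 * \<delta>) * C"]) auto
  qed
  moreover obtain n where "T / h\<^sub>0 < real n"
    using reals_Archimedean2 by blast
  then have "T \<le> real n * h\<^sub>0"
    using h\<^sub>0_bounds(1) by (simp add: field_simps)
  ultimately show ?thesis
    using that by (meson order_trans)
qed

text \<open>
  On the event \<open>j h \<le> X\<^sub>s < (j + 1) h\<close> the transition estimate is applied with
  \<open>\<mu> = \<plusminus>c / sqrt (h ((j + 1) h))\<close>, the inverse of the order of magnitude of the increment.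
\<close>

lemma normalized_increment_exponential_moment:
  obtains c where "0 < c" "\<And>T. \<exists>C\<ge>0. \<forall>s h. 0 \<le> s \<longrightarrow> s \<le> T \<longrightarrow> 0 < h \<longrightarrow> h \<le> h\<^sub>0 \<longrightarrow>
    (\<integral>\<^sup>+\<omega>. ennreal (exp (c * (\<bar>X (s + h) \<omega> - X s \<omega>\<bar> / sqrt (h * (X s \<omega> + h))))) \<partial>M) \<le> ennreal C"
proof -
  \<comment> \<open>With this value the diffusion uses half of the shortness condition,
    \<open>4 * \<beta>\<^sup>2 * c = 1 / 2\<close>; the choice of \<open>h\<^sub>0\<close> leaves
    the other half for the linear drift. As \<open>c\<close> depends only on \<open>\<beta>\<close>,
    it can be fixed before \<open>T\<close>.\<close>
  define c where "c = 1 / (8 * \<beta>\<^sup>2)"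
  have c: "0 < c" "4 * \<beta>\<^sup>2 * c = 1 / 2"
    using beta_pos by (auto simp: c_def)
  define K where "K = 4 * \<beta>\<^sup>2 * c\<^sup>2 + 2 * \<delta> * c"
  \<comment> \<open>\<open>E\<close> pays for the loss in the transition estimate: \<open>K\<close>
    covers the diffusion term and the constant part of the drift, the root covers the linear
    part.\<close>
  define E where "E s \<omega> = exp (K + 2 * \<bar>\<gamma>\<bar> * c * sqrt (X s \<omega> + 1))" for s \<omega>
  have step: "(\<integral>\<^sup>+\<omega>. ennreal (exp (c * (\<bar>X (s + h) \<omega> - X s \<omega>\<bar> / sqrt (h * (X s \<omega> + h))))) \<partial>M) \<le>
      2 * (\<integral>\<^sup>+\<omega>. ennreal (E s \<omega>) \<partial>M)" if s: "0 \<le> s" and h: "0 < h" "h \<le> h\<^sub>0" for s h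
  proof -
    \<comment> \<open>The transition estimate needs a deterministic rate, while the natural rate
      depends on \<open>X s\<close>. Slices of width \<open>h\<close> are known at time
      \<open>s\<close>, and on each of them one rate is good enough.\<close>
    define A where "A j = {\<omega> \<in> space M. real j * h \<le> X s \<omega> \<and> X s \<omega> < (real j + 1) * h}" for j :: nat
    define m where "m j = c / sqrt (h * ((real j + 1) * h))" for j :: nat
    have X[measurable]: "X s \<in> borel_measurable (F s)" "X s \<in> borel_measurable M" "X (s + h) \<in> borel_measurable M"
      using s h by (auto intro: X_measurable X_measurable_M)
    have AF: "A j \<in> sets (F s)" for j
      unfolding A_def filtration_space[OF s, symmetric] by measurable
    then have [measurable]: "A j \<in> sets M" for j
      using filtration_subset[OF s] by auto
    have disj: "disjoint_family A"
      unfolding disjoint_family_on_def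
    proof (intro ballI impI)
      fix i j :: nat assume "i \<noteq> j"
      have "i \<le> j" if "real i * h \<le> y" "y < (real j + 1) * h" for y and i j :: nat
      proof -
        have "real i * h < (real j + 1) * h" using that by linarith
        then have "real i < real j + 1"
          by (rule mult_right_less_imp_less) (use h in simp)
        then show ?thesis by linarith
      qed
      then have "i = j" if "\<omega> \<in> A i" "\<omega> \<in> A j" for \<omega>
        using that unfolding A_def by (intro antisym) blast+
      then show "A i \<inter> A j = {}"
        using \<open>i \<noteq> j\<close> by blast
    qed
    have union: "(\<Union>j. A j) = space M"
    proof (intro equalityI subsetI)
      fix \<omega> assume w: "\<omega> \<in> space M"
      define j where "j = nat \<lfloor>X s \<omega> / h\<rfloor>"
      have "0 \<le> X s \<omega> / h" using X_nonneg[OF s w] h by simp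
      then have "real j = of_int \<lfloor>X s \<omega> / h\<rfloor>"
        by (simp add: j_def)
      then have "real j \<le> X s \<omega> / h" "X s \<omega> / h < real j + 1"
        by linarith+
      then have "\<omega> \<in> A j"
        using w h by (simp add: A_def field_simps)
      then show "\<omega> \<in> (\<Union>j. A j)" by blast
    qed (auto simp: A_def)
    have m: "0 < m j" "4 * \<beta>\<^sup>2 * (m j)\<^sup>2 * h * ((real j + 1) * h) = 4 * \<beta>\<^sup>2 * c\<^sup>2"
      "m j * h * ((real j + 1) * h) = c * sqrt (h * ((real j + 1) * h))" "h * m j \<le> c" for j
    proof -
      let ?y = "h * ((real j + 1) * h)"
      have y: "0 < ?y" using h by simp
      show "0 < m j" unfolding m_def using y c by simp
      have "(m j)\<^sup>2 * ?y = c\<^sup>2"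
        using y h by (simp add: m_def power_divide)
      then show "4 * \<beta>\<^sup>2 * (m j)\<^sup>2 * h * ((real j + 1) * h) = 4 * \<beta>\<^sup>2 * c\<^sup>2"
        by (simp add: mult_ac)
      have "m j * ?y = c * sqrt ?y"
        using y by (simp add: m_def field_simps)
      then show "m j * h * ((real j + 1) * h) = c * sqrt ?y"
        by (simp add: mult_ac)
      have "h * 1 \<le> sqrt ?y"
        using h by (intro real_le_rsqrt) (auto simp: power2_eq_square mult_ac)
      then show "h * m j \<le> c"
        unfolding m_def using c y by (simp add: field_simps)
    qed
    have one: "(\<integral>\<^sup>+\<omega>\<in>A j. ennreal (exp (\<mu> * (X (s + h) \<omega> - X s \<omega>))) \<partial>M) \<le> (\<integral>\<^sup>+\<omega>\<in>A j. ennreal (E s \<omega>) \<partial>M)"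
      if mu: "\<bar>\<mu>\<bar> = m j" for j \<mu>
    proof -
      \<comment> \<open>The factor \<open>E s\<close> in the weight cancels the loss, so the
        exponential of the increment alone remains on the left; on the right stands the integral of
        \<open>E s\<close> over the slice, which can be summed over \<open>j\<close>.\<close>
      define G where "G \<omega> = indicator (A j) \<omega> * E s \<omega>" for \<omega>
      have mu2: "\<mu>\<^sup>2 = (m j)\<^sup>2" using mu by (metis power2_abs)
      have "h * (4 * \<beta>\<^sup>2 * \<bar>\<mu>\<bar> + 2 * \<bar>\<gamma>\<bar>) \<le> 1"
      proof -
        have "4 * \<beta>\<^sup>2 * (h * \<bar>\<mu>\<bar>) \<le> 4 * \<beta>\<^sup>2 * c"
          unfolding mu using m(4)[of j] by (intro mult_left_mono) auto
        moreover have "h * (4 * \<bar>\<gamma>\<bar>) \<le> h\<^sub>0 * (4 * \<bar>\<gamma>\<bar>)"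
          using h by (intro mult_right_mono) auto
        ultimately show ?thesis
          using c(2) h\<^sub>0_bounds(4) by (simp add: algebra_simps)
      qed
      moreover have "G \<in> borel_measurable (F s)"
        unfolding G_def[abs_def] E_def[abs_def] using AF X(1) by measurable
      moreover have "0 \<le> G \<omega>" for \<omega>
        by (simp add: G_def E_def)
      ultimately have "(\<integral>\<^sup>+\<omega>. ennreal (G \<omega> * exp (\<mu> * (X (s + h) \<omega> - X s \<omega>) -
          (4 * \<beta>\<^sup>2 * \<mu>\<^sup>2 + 2 * \<bar>\<gamma>\<bar> * \<bar>\<mu>\<bar>) * h * X s \<omega> - 2 * \<delta> * h * \<bar>\<mu>\<bar>)) \<partial>M) \<le> (\<integral>\<^sup>+\<omega>. ennreal (G \<omega>) \<partial>M)"
        by (intro exponential_moment_short_transition[OF s h(1)])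
      note est = this
      have pointwise: "ennreal (exp (\<mu> * (X (s + h) \<omega> - X s \<omega>))) * indicator (A j) \<omega> \<le>
        ennreal (G \<omega> * exp (\<mu> * (X (s + h) \<omega> - X s \<omega>) -
          (4 * \<beta>\<^sup>2 * \<mu>\<^sup>2 + 2 * \<bar>\<gamma>\<bar> * \<bar>\<mu>\<bar>) * h * X s \<omega> - 2 * \<delta> * h * \<bar>\<mu>\<bar>))" for \<omega>
      proof (cases "\<omega> \<in> A j")
        case True
        let ?y = "(real j + 1) * h"
        have w: "\<omega> \<in> space M" and Xs: "X s \<omega> \<le> ?y" "?y \<le> X s \<omega> + h" "0 \<le> X s \<omega>"
          using True X_nonneg[OF s] by (auto simp: A_def algebra_simps)
        have "(4 * \<beta>\<^sup>2 * \<mu>\<^sup>2 + 2 * \<bar>\<gamma>\<bar> * \<bar>\<mu>\<bar>) * h * X s \<omega> \<le> (4 * \<beta>\<^sup>2 * \<mu>\<^sup>2 + 2 * \<bar>\<gamma>\<bar> * \<bar>\<mu>\<bar>) * h * ?y"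
          using Xs h by (intro mult_left_mono) auto
        also have "\<dots> = 4 * \<beta>\<^sup>2 * (m j)\<^sup>2 * h * ?y + 2 * \<bar>\<gamma>\<bar> * (m j * h * ?y)"
          unfolding mu mu2 by (simp add: algebra_simps)
        also have "\<dots> = 4 * \<beta>\<^sup>2 * c\<^sup>2 + 2 * \<bar>\<gamma>\<bar> * (c * sqrt (h * ?y))"
          unfolding m(2,3) ..
        also have "\<dots> \<le> 4 * \<beta>\<^sup>2 * c\<^sup>2 + 2 * \<bar>\<gamma>\<bar> * (c * sqrt (X s \<omega> + 1))"
        proof -
          have "h * ?y \<le> 1 * (X s \<omega> + 1)"
            using Xs h h\<^sub>0_bounds by (intro mult_mono) auto
          then show ?thesis
            using c by (intro add_left_mono mult_left_mono) auto
        qed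
        finally have "(4 * \<beta>\<^sup>2 * \<mu>\<^sup>2 + 2 * \<bar>\<gamma>\<bar> * \<bar>\<mu>\<bar>) * h * X s \<omega> \<le> 4 * \<beta>\<^sup>2 * c\<^sup>2 + 2 * \<bar>\<gamma>\<bar> * (c * sqrt (X s \<omega> + 1))" .
        moreover have "2 * \<delta> * h * \<bar>\<mu>\<bar> \<le> 2 * \<delta> * c"
          unfolding mu mult.assoc using m(4)[of j] delta_nonneg by (intro mult_left_mono) auto
        ultimately have "(4 * \<beta>\<^sup>2 * \<mu>\<^sup>2 + 2 * \<bar>\<gamma>\<bar> * \<bar>\<mu>\<bar>) * h * X s \<omega> + 2 * \<delta> * h * \<bar>\<mu>\<bar> \<le>
            K + 2 * \<bar>\<gamma>\<bar> * c * sqrt (X s \<omega> + 1)"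
          by (simp add: K_def)
        then show ?thesis
          using True by (simp add: G_def E_def exp_add[symmetric])
      qed simp
      have "(\<integral>\<^sup>+\<omega>\<in>A j. ennreal (exp (\<mu> * (X (s + h) \<omega> - X s \<omega>))) \<partial>M) \<le> (\<integral>\<^sup>+\<omega>. ennreal (G \<omega>) \<partial>M)"
        by (rule order_trans[OF nn_integral_mono est]) (rule pointwise)
      also have "\<dots> = (\<integral>\<^sup>+\<omega>\<in>A j. ennreal (E s \<omega>) \<partial>M)"
        by (intro nn_integral_cong) (auto simp: G_def split: split_indicator)
      finally show ?thesis .
    qed
    have E[measurable]: "E s \<in> borel_measurable M"
      unfolding E_def[abs_def] by measurable
    have "(\<integral>\<^sup>+\<omega>. ennreal (exp (c * (\<bar>X (s + h) \<omega> - X s \<omega>\<bar> / sqrt (h * (X s \<omega> + h))))) \<partial>M) =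
        (\<integral>\<^sup>+\<omega>\<in>(\<Union>j. A j). ennreal (exp (c * (\<bar>X (s + h) \<omega> - X s \<omega>\<bar> / sqrt (h * (X s \<omega> + h))))) \<partial>M)"
      unfolding union by (intro nn_integral_cong) simp
    also have "\<dots> = (\<Sum>j. \<integral>\<^sup>+\<omega>\<in>A j. ennreal (exp (c * (\<bar>X (s + h) \<omega> - X s \<omega>\<bar> / sqrt (h * (X s \<omega> + h))))) \<partial>M)"
      by (rule nn_integral_disjoint_family[OF _ _ disj]) auto
    also have "\<dots> \<le> (\<Sum>j. 2 * (\<integral>\<^sup>+\<omega>\<in>A j. ennreal (E s \<omega>) \<partial>M))"
    proof (rule suminf_le)
      fix j
      have "(\<integral>\<^sup>+\<omega>\<in>A j. ennreal (exp (c * (\<bar>X (s + h) \<omega> - X s \<omega>\<bar> / sqrt (h * (X s \<omega> + h))))) \<partial>M) \<le>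
        (\<integral>\<^sup>+\<omega>. ennreal (exp (m j * (X (s + h) \<omega> - X s \<omega>))) * indicator (A j) \<omega> +
          ennreal (exp (- m j * (X (s + h) \<omega> - X s \<omega>))) * indicator (A j) \<omega> \<partial>M)"
      proof (rule nn_integral_mono)
        fix \<omega>
        show "ennreal (exp (c * (\<bar>X (s + h) \<omega> - X s \<omega>\<bar> / sqrt (h * (X s \<omega> + h))))) * indicator (A j) \<omega> \<le>
          ennreal (exp (m j * (X (s + h) \<omega> - X s \<omega>))) * indicator (A j) \<omega> +
          ennreal (exp (- m j * (X (s + h) \<omega> - X s \<omega>))) * indicator (A j) \<omega>"
        proof (cases "\<omega> \<in> A j")
          case True
          \<comment> \<open>The upper end of the slice is at most \<open>X s \<omega> + h\<close>,
            so replacing the random normalisation by that of the slice only enlarges the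
            quotient.\<close>
          have "h * ((real j + 1) * h) \<le> h * (X s \<omega> + h)"
            using True h by (intro mult_left_mono) (auto simp: A_def algebra_simps)
          then have "c * (\<bar>X (s + h) \<omega> - X s \<omega>\<bar> / sqrt (h * (X s \<omega> + h))) \<le> c * (\<bar>X (s + h) \<omega> - X s \<omega>\<bar> / sqrt (h * ((real j + 1) * h)))"
            using c h by (intro mult_left_mono divide_left_mono) (auto intro!: mult_pos_pos add_nonneg_pos X_nonneg s simp: True[unfolded A_def, simplified])
          also have "\<dots> = m j * \<bar>X (s + h) \<omega> - X s \<omega>\<bar>"
            by (simp add: m_def)
          finally have "exp (c * (\<bar>X (s + h) \<omega> - X s \<omega>\<bar> / sqrt (h * (X s \<omega> + h)))) \<le> exp (m j * \<bar>X (s + h) \<omega> - X s \<omega>\<bar>)"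
            by simp
          also have "\<dots> \<le> exp (m j * (X (s + h) \<omega> - X s \<omega>)) + exp (- m j * (X (s + h) \<omega> - X s \<omega>))"
            by (rule exp_abs_le)
          finally show ?thesis
            using True by (simp add: ennreal_plus[symmetric] ennreal_leI del: ennreal_plus)
        qed simp
      qed
      also have "\<dots> = (\<integral>\<^sup>+\<omega>\<in>A j. ennreal (exp (m j * (X (s + h) \<omega> - X s \<omega>))) \<partial>M) +
          (\<integral>\<^sup>+\<omega>\<in>A j. ennreal (exp (- m j * (X (s + h) \<omega> - X s \<omega>))) \<partial>M)"
        by (rule nn_integral_add) auto
      also have "\<dots> \<le> (\<integral>\<^sup>+\<omega>\<in>A j. ennreal (E s \<omega>) \<partial>M) + (\<integral>\<^sup>+\<omega>\<in>A j. ennreal (E s \<omega>) \<partial>M)"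
        using m(1)[of j] by (intro add_mono one) auto
      finally show "(\<integral>\<^sup>+\<omega>\<in>A j. ennreal (exp (c * (\<bar>X (s + h) \<omega> - X s \<omega>\<bar> / sqrt (h * (X s \<omega> + h))))) \<partial>M) \<le>
          2 * (\<integral>\<^sup>+\<omega>\<in>A j. ennreal (E s \<omega>) \<partial>M)"
        by (simp add: mult_2)
    qed auto
    also have "\<dots> = 2 * (\<Sum>j. \<integral>\<^sup>+\<omega>\<in>A j. ennreal (E s \<omega>) \<partial>M)"
      by (rule ennreal_suminf_cmult)
    also have "(\<Sum>j. \<integral>\<^sup>+\<omega>\<in>A j. ennreal (E s \<omega>) \<partial>M) = (\<integral>\<^sup>+\<omega>\<in>(\<Union>j. A j). ennreal (E s \<omega>) \<partial>M)"
      by (rule nn_integral_disjoint_family[OF _ _ disj, symmetric]) auto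
    also have "\<dots> = (\<integral>\<^sup>+\<omega>. ennreal (E s \<omega>) \<partial>M)"
      unfolding union by (intro nn_integral_cong) simp
    finally show ?thesis .
  qed
  show ?thesis
  proof (rule that[OF c(1)])
    fix T
    obtain \<epsilon> C where eC: "0 < \<epsilon>" "0 \<le> C"
      "\<And>t. 0 \<le> t \<Longrightarrow> t \<le> T \<Longrightarrow> (\<integral>\<^sup>+\<omega>. ennreal (exp (\<epsilon> * X t \<omega>)) \<partial>M) \<le> ennreal C"
      using exponential_moments by blast
    define D where "D = exp (K + (\<bar>\<gamma>\<bar> * c)\<^sup>2 / \<epsilon> + \<epsilon>)"
    have "2 * (\<integral>\<^sup>+\<omega>. ennreal (E s \<omega>) \<partial>M) \<le> ennreal (2 * (D * C))" if s: "0 \<le> s" "s \<le> T" for s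
    proof -
      have "(\<integral>\<^sup>+\<omega>. ennreal (E s \<omega>) \<partial>M) \<le> (\<integral>\<^sup>+\<omega>. ennreal D * ennreal (exp (\<epsilon> * X s \<omega>)) \<partial>M)"
      proof (rule nn_integral_mono)
        fix \<omega> assume w: "\<omega> \<in> space M"
        \<comment> \<open>Young's inequality: the root in \<open>E\<close> is dominated by
          \<open>\<epsilon> * X s \<omega>\<close> up to a constant, so an exponential moment of any
          positive rate suffices to integrate \<open>E\<close>.\<close>
        have "0 \<le> (\<bar>\<gamma>\<bar> * c / sqrt \<epsilon> - sqrt \<epsilon> * sqrt (X s \<omega> + 1))\<^sup>2" by simp
        also have "\<dots> = (\<bar>\<gamma>\<bar> * c)\<^sup>2 / \<epsilon> + \<epsilon> * (X s \<omega> + 1) - 2 * \<bar>\<gamma>\<bar> * c * sqrt (X s \<omega> + 1)"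
          using eC(1) X_nonneg[OF s(1) w]
          by (simp add: power2_diff power_mult_distrib power_divide)
        finally show "ennreal (E s \<omega>) \<le> ennreal D * ennreal (exp (\<epsilon> * X s \<omega>))"
          by (simp add: E_def D_def ennreal_mult[symmetric] exp_add[symmetric] ennreal_leI algebra_simps)
      qed
      also have "\<dots> = ennreal D * (\<integral>\<^sup>+\<omega>. ennreal (exp (\<epsilon> * X s \<omega>)) \<partial>M)"
        using X_measurable_M[OF s(1)] by (intro nn_integral_cmult) measurable
      also have "\<dots> \<le> ennreal D * ennreal C"
        by (intro mult_left_mono eC s) auto
      finally have "2 * (\<integral>\<^sup>+\<omega>. ennreal (E s \<omega>) \<partial>M) \<le> 2 * (ennreal D * ennreal C)"
        by (intro mult_left_mono) auto
      then show ?thesis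
        using eC(2) by (simp add: ennreal_mult D_def)
    qed
    then show "\<exists>C\<ge>0. \<forall>s h. 0 \<le> s \<longrightarrow> s \<le> T \<longrightarrow> 0 < h \<longrightarrow> h \<le> h\<^sub>0 \<longrightarrow>
      (\<integral>\<^sup>+\<omega>. ennreal (exp (c * (\<bar>X (s + h) \<omega> - X s \<omega>\<bar> / sqrt (h * (X s \<omega> + h))))) \<partial>M) \<le> ennreal C"
      using step eC(2) by (intro exI[of _ "2 * (D * C)"]) (auto simp: D_def intro: order_trans)
  qed
qed

end

section \<open>Hoelder estimates for the square root\<close>

text \<open>For steps up to \<open>h\<^sub>0\<close> the exponential moment of the normalised
  increment dominates every power. For longer steps nothing has to be small: moments of
  \<open>X\<close> suffice, and dividing by \<open>h\<^sub>0 powr (p / 2)\<close> brings their bound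
  into the required form.\<close>

lemma (in cir_process) sqrt_increment_moment:
  assumes "0 < p"
  obtains C where "0 \<le> C" "\<And>s t. 0 \<le> s \<Longrightarrow> s < t \<Longrightarrow> t \<le> T \<Longrightarrow>
    (\<integral>\<^sup>+\<omega>. ennreal (\<bar>sqrt (X t \<omega>) - sqrt (X s \<omega>)\<bar> powr p) \<partial>M) \<le> ennreal (C * (t - s) powr (p / 2))"
proof -
  obtain c where c: "0 < c" and ex: "\<And>T. \<exists>C\<ge>0. \<forall>s h. 0 \<le> s \<longrightarrow> s \<le> T \<longrightarrow> 0 < h \<longrightarrow> h \<le> h\<^sub>0 \<longrightarrow>
    (\<integral>\<^sup>+\<omega>. ennreal (exp (c * (\<bar>X (s + h) \<omega> - X s \<omega>\<bar> / sqrt (h * (X s \<omega> + h))))) \<partial>M) \<le> ennreal C"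
    using normalized_increment_exponential_moment by blast
  obtain C\<^sub>1 where C1: "0 \<le> C\<^sub>1" "\<And>s h. 0 \<le> s \<Longrightarrow> s \<le> T \<Longrightarrow> 0 < h \<Longrightarrow> h \<le> h\<^sub>0 \<Longrightarrow>
    (\<integral>\<^sup>+\<omega>. ennreal (exp (c * (\<bar>X (s + h) \<omega> - X s \<omega>\<bar> / sqrt (h * (X s \<omega> + h))))) \<partial>M) \<le> ennreal C\<^sub>1"
    using ex[of T] by blast
  obtain \<epsilon> C\<^sub>2 where C2: "0 < \<epsilon>" "0 \<le> C\<^sub>2"
    "\<And>t. 0 \<le> t \<Longrightarrow> t \<le> T \<Longrightarrow> (\<integral>\<^sup>+\<omega>. ennreal (exp (\<epsilon> * X t \<omega>)) \<partial>M) \<le> ennreal C\<^sub>2"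
    using exponential_moments by blast
  \<comment> \<open>The rate \<open>c / 2\<close> compensates the factor 2 in
    \<open>sqrt_diff_le\<close>; the summand \<open>sqrt h\<close> there, normalised to 1, produces
    the factor \<open>exp (c / 2)\<close>.\<close>
  define K\<^sub>1 where "K\<^sub>1 = (p / (c / 2)) powr p * exp (c / 2)"
  define K\<^sub>2 where "K\<^sub>2 = (p / 2 / \<epsilon>) powr (p / 2)"
  have K: "0 \<le> K\<^sub>1" "0 \<le> K\<^sub>2" by (auto simp: K\<^sub>1_def K\<^sub>2_def)
  define D where "D = K\<^sub>1 * C\<^sub>1 + K\<^sub>2 * (2 * C\<^sub>2) / h\<^sub>0 powr (p / 2)"
  have h0: "0 < h\<^sub>0 powr (p / 2)" using h\<^sub>0_bounds(1) by simp
  have D: "0 \<le> K\<^sub>1 * C\<^sub>1" "0 \<le> K\<^sub>2 * (2 * C\<^sub>2) / h\<^sub>0 powr (p / 2)"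
    using K C1 C2 by auto
  show ?thesis
  proof (rule that[of D])
    show "0 \<le> D" using D by (simp add: D_def)
    fix s t assume st: "0 \<le> s" "s < t" "t \<le> T"
    define h where "h = t - s"
    have h: "0 < h" "t = s + h" using st by (auto simp: h_def)
    have [measurable]: "X s \<in> borel_measurable M" "X t \<in> borel_measurable M"
      using st by (auto intro: X_measurable_M)
    show "(\<integral>\<^sup>+\<omega>. ennreal (\<bar>sqrt (X t \<omega>) - sqrt (X s \<omega>)\<bar> powr p) \<partial>M) \<le> ennreal (D * (t - s) powr (p / 2))"
    proof (cases "h \<le> h\<^sub>0")
      case True
      have "(\<integral>\<^sup>+\<omega>. ennreal (\<bar>sqrt (X t \<omega>) - sqrt (X s \<omega>)\<bar> powr p) \<partial>M) \<le>
          (\<integral>\<^sup>+\<omega>. ennreal (h powr (p / 2) * K\<^sub>1) * ennreal (exp (c * (\<bar>X t \<omega> - X s \<omega>\<bar> / sqrt (h * (X s \<omega> + h))))) \<partial>M)"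
      proof (rule nn_integral_mono)
        fix \<omega> assume w: "\<omega> \<in> space M"
        define U where "U = \<bar>sqrt (X t \<omega>) - sqrt (X s \<omega>)\<bar> / sqrt h"
        define R where "R = \<bar>X t \<omega> - X s \<omega>\<bar> / sqrt (h * (X s \<omega> + h))"
        have "\<bar>sqrt (X t \<omega>) - sqrt (X s \<omega>)\<bar> \<le> 2 * (\<bar>X t \<omega> - X s \<omega>\<bar> / sqrt (X s \<omega> + h)) + sqrt h"
          using X_nonneg[OF _ w] st h by (intro sqrt_diff_le) auto
        then have "U \<le> (2 * (\<bar>X t \<omega> - X s \<omega>\<bar> / sqrt (X s \<omega> + h)) + sqrt h) / sqrt h"
          unfolding U_def using h by (intro divide_right_mono) auto
        also have "\<dots> = 2 * R + 1"
          using h by (simp add: R_def real_sqrt_mult add_divide_distrib mult.commute)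
        finally have UR: "c / 2 * U \<le> c / 2 * (2 * R + 1)"
          using c by (intro mult_left_mono) auto
        have "U powr p \<le> (p / (c / 2)) powr p * exp (c / 2 * U)"
          using c assms h by (intro powr_le_exp) (auto simp: U_def)
        also have "\<dots> \<le> (p / (c / 2)) powr p * exp (c / 2 * (2 * R + 1))"
          using UR by (intro mult_left_mono) auto
        also have "\<dots> = K\<^sub>1 * exp (c * R)"
          by (simp add: K\<^sub>1_def exp_add[symmetric] algebra_simps)
        finally have "h powr (p / 2) * U powr p \<le> h powr (p / 2) * (K\<^sub>1 * exp (c * R))"
          by (intro mult_left_mono) auto
        moreover have "\<bar>sqrt (X t \<omega>) - sqrt (X s \<omega>)\<bar> powr p = h powr (p / 2) * U powr p"
        proof -
          have "h powr (p / 2) = sqrt h powr p"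
            using h by (simp add: powr_half_sqrt[symmetric] powr_powr)
          then show ?thesis
            using h by (simp add: U_def flip: powr_mult)
        qed
        ultimately show "ennreal (\<bar>sqrt (X t \<omega>) - sqrt (X s \<omega>)\<bar> powr p) \<le>
            ennreal (h powr (p / 2) * K\<^sub>1) * ennreal (exp (c * (\<bar>X t \<omega> - X s \<omega>\<bar> / sqrt (h * (X s \<omega> + h)))))"
          using K by (simp add: R_def ennreal_mult[symmetric] ennreal_leI mult.assoc)
      qed
      also have "\<dots> = ennreal (h powr (p / 2) * K\<^sub>1) * (\<integral>\<^sup>+\<omega>. ennreal (exp (c * (\<bar>X t \<omega> - X s \<omega>\<bar> / sqrt (h * (X s \<omega> + h))))) \<partial>M)"
        by (rule nn_integral_cmult) measurable
      also have "\<dots> \<le> ennreal (h powr (p / 2) * K\<^sub>1) * ennreal C\<^sub>1"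
        unfolding h(2) using C1(2)[of s h] st True h by (intro mult_left_mono) auto
      also have "\<dots> = ennreal (K\<^sub>1 * C\<^sub>1 * h powr (p / 2))"
        using K C1 by (simp add: ennreal_mult[symmetric] mult_ac)
      also have "\<dots> \<le> ennreal (D * h powr (p / 2))"
        using D by (intro ennreal_leI mult_right_mono) (auto simp: D_def)
      finally show ?thesis by (simp add: h_def)
    next
      case False
      have "(\<integral>\<^sup>+\<omega>. ennreal (\<bar>sqrt (X t \<omega>) - sqrt (X s \<omega>)\<bar> powr p) \<partial>M) \<le>
          (\<integral>\<^sup>+\<omega>. ennreal K\<^sub>2 * (ennreal (exp (\<epsilon> * X t \<omega>)) + ennreal (exp (\<epsilon> * X s \<omega>))) \<partial>M)"
      proof (rule nn_integral_mono)
        fix \<omega> assume w: "\<omega> \<in> space M"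
        have nn: "0 \<le> X t \<omega>" "0 \<le> X s \<omega>" using X_nonneg[OF _ w] st by auto
        have root: "sqrt y powr p = y powr (p / 2)" if "0 \<le> y" for y
          using that by (simp add: powr_half_sqrt[symmetric] powr_powr)
        have "\<bar>sqrt (X t \<omega>) - sqrt (X s \<omega>)\<bar> \<le> sqrt (X t \<omega>) \<or> \<bar>sqrt (X t \<omega>) - sqrt (X s \<omega>)\<bar> \<le> sqrt (X s \<omega>)"
          using nn by (auto simp: abs_if)
        then have "\<bar>sqrt (X t \<omega>) - sqrt (X s \<omega>)\<bar> powr p \<le> sqrt (X t \<omega>) powr p \<or>
            \<bar>sqrt (X t \<omega>) - sqrt (X s \<omega>)\<bar> powr p \<le> sqrt (X s \<omega>) powr p"
          using assms by (auto intro!: powr_mono2)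
        moreover have "0 \<le> sqrt (X t \<omega>) powr p" "0 \<le> sqrt (X s \<omega>) powr p" by auto
        ultimately have "\<bar>sqrt (X t \<omega>) - sqrt (X s \<omega>)\<bar> powr p \<le> X t \<omega> powr (p / 2) + X s \<omega> powr (p / 2)"
          unfolding root[OF nn(1)] root[OF nn(2)] by linarith
        also have "\<dots> \<le> K\<^sub>2 * exp (\<epsilon> * X t \<omega>) + K\<^sub>2 * exp (\<epsilon> * X s \<omega>)"
          unfolding K\<^sub>2_def using nn C2 assms by (intro add_mono powr_le_exp) auto
        finally show "ennreal (\<bar>sqrt (X t \<omega>) - sqrt (X s \<omega>)\<bar> powr p) \<le>
            ennreal K\<^sub>2 * (ennreal (exp (\<epsilon> * X t \<omega>)) + ennreal (exp (\<epsilon> * X s \<omega>)))"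
          using K by (simp add: ennreal_plus[symmetric] ennreal_mult[symmetric] ennreal_leI distrib_left del: ennreal_plus)
      qed
      also have "\<dots> = ennreal K\<^sub>2 * ((\<integral>\<^sup>+\<omega>. ennreal (exp (\<epsilon> * X t \<omega>)) \<partial>M) + (\<integral>\<^sup>+\<omega>. ennreal (exp (\<epsilon> * X s \<omega>)) \<partial>M))"
        by (subst nn_integral_cmult, measurable, subst nn_integral_add) auto
      also have "\<dots> \<le> ennreal K\<^sub>2 * (ennreal C\<^sub>2 + ennreal C\<^sub>2)"
        using st by (intro mult_left_mono add_mono C2) auto
      also have "\<dots> = ennreal (K\<^sub>2 * (2 * C\<^sub>2) / h\<^sub>0 powr (p / 2) * h\<^sub>0 powr (p / 2))"
        using K C2 h0 by (simp add: ennreal_plus[symmetric] ennreal_mult[symmetric] del: ennreal_plus)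
      also have "\<dots> \<le> ennreal (D * h powr (p / 2))"
        using D False h\<^sub>0_bounds(1) assms
        by (intro ennreal_leI mult_mono powr_mono2) (auto simp: D_def)
      finally show ?thesis by (simp add: h_def)
    qed
  qed
qed

text \<open>Chaining: a point is reached from its dyadic approximations by at most one increment per
  level, and these add up to a geometric series. For two points the chains start at the level
  comparable to their distance, where the approximations coincide or are neighbours; hence two tails
  and one increment in the constant.\<close>

lemma dyadic_increments_imp_hoelder:
  fixes f :: "real \<Rightarrow> real"
  assumes "0 < T" "0 < \<alpha>" "0 \<le> B" and cont: "continuous_on {0..T} f"
    and inc: "\<And>n i. i < 2 ^ n \<Longrightarrow> \<bar>f (T * real (Suc i) / 2 ^ n) - f (T * real i / 2 ^ n)\<bar> \<le> B * (2 powr - \<alpha>) ^ n"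
    and "s \<in> {0..T}" "t \<in> {0..T}"
  shows "\<bar>f t - f s\<bar> \<le> (2 / (1 - 2 powr - \<alpha>) + 1) * 2 powr \<alpha> / T powr \<alpha> * B * \<bar>t - s\<bar> powr \<alpha>"
proof -
  define r where "r = 2 powr - \<alpha>"
  have r: "0 < r" "r < 1"
    using assms(2) powr_less_mono[of "- \<alpha>" 0 "2 :: real"] by (auto simp: r_def)
  define C where "C = 1 / (1 - r)"
  have C: "0 < C" "C * (1 - r) = 1" using r by (auto simp: C_def)
  define k where "k n u = nat \<lfloor>2 ^ n * u / T\<rfloor>" for n u
  define g where "g n u = f (T * real (k n u) / 2 ^ n)" for n u
  have k: "real (k n u) \<le> 2 ^ n * u / T" "2 ^ n * u / T < real (k n u) + 1" "k n u \<le> 2 ^ n"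
    if "u \<in> {0..T}" for n u
  proof -
    have "0 \<le> 2 ^ n * u / T" using that assms(1) by simp
    then have "real (k n u) = of_int \<lfloor>2 ^ n * u / T\<rfloor>"
      by (simp add: k_def)
    then show 1: "real (k n u) \<le> 2 ^ n * u / T" "2 ^ n * u / T < real (k n u) + 1"
      by linarith+
    have "2 ^ n * u / T \<le> 2 ^ n"
      using that assms(1) by (simp add: field_simps)
    then have "real (k n u) \<le> real (2 ^ n)"
      using 1 unfolding of_nat_power of_nat_numeral by linarith
    then show "k n u \<le> 2 ^ n" by (simp only: of_nat_le_iff)
  qed
  \<comment> \<open>Passing to the next level turns the index \<open>k n u\<close> into twice itself
    or one more. The approximation moves only in the second case, by a single increment of level
    \<open>Suc n\<close>.\<close>
  have step: "\<bar>g (Suc n) u - g n u\<bar> \<le> B * r ^ Suc n" if u: "u \<in> {0..T}" for n u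
  proof -
    have "real (k (Suc n) u) \<le> 2 * (2 ^ n * u / T)" "2 * (2 ^ n * u / T) < real (k (Suc n) u) + 1"
      using k(1,2)[OF u, of "Suc n"] by auto
    then have "2 * real (k n u) < real (k (Suc n) u) + 1" "real (k (Suc n) u) < 2 * real (k n u) + 2"
      using k(1,2)[OF u, of n] by linarith+
    then have "k (Suc n) u = 2 * k n u \<or> k (Suc n) u = Suc (2 * k n u)"
      by linarith
    moreover have eq: "T * real (2 * k n u) / 2 ^ Suc n = T * real (k n u) / 2 ^ n" by simp
    ultimately show ?thesis
    proof (elim disjE)
      assume "k (Suc n) u = 2 * k n u"
      then have "g (Suc n) u = g n u" unfolding g_def using eq by simp
      then show ?thesis using assms(3) r by simp
    next
      assume s: "k (Suc n) u = Suc (2 * k n u)"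
      then have "2 * k n u < 2 ^ Suc n" using k(3)[OF u, of "Suc n"] by simp
      from inc[OF this] show ?thesis
        unfolding g_def s eq r_def .
    qed
  qed
  \<comment> \<open>The bound is put in telescoping form: since \<open>C * (1 - r) = 1\<close>, the
    step from level \<open>m\<close> to \<open>Suc m\<close> contributes at most
    \<open>B * C * (r ^ m - r ^ Suc m)\<close>.\<close>
  have chain: "\<bar>g (n + j) u - g n u\<bar> \<le> B * C * (r ^ n - r ^ (n + j))" if u: "u \<in> {0..T}" for n j u
  proof (induction j)
    case (Suc j)
    have "B * r ^ Suc (n + j) \<le> B * (r ^ (n + j) * (C * (1 - r)))"
      unfolding C(2) using assms(3) r by (intro mult_left_mono) (auto simp: mult_left_le_one_le)
    then have "\<bar>g (Suc (n + j)) u - g (n + j) u\<bar> \<le> B * (r ^ (n + j) * (C * (1 - r)))"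
      using step[OF u, of "n + j"] by linarith
    then have "\<bar>g (n + Suc j) u - g n u\<bar> \<le> B * C * (r ^ n - r ^ (n + j)) + B * (r ^ (n + j) * (C * (1 - r)))"
      using Suc by simp
    then show ?case by (simp add: algebra_simps)
  qed simp
  have lim: "(\<lambda>n. g n u) \<longlonglongrightarrow> f u" if u: "u \<in> {0..T}" for u
  proof -
    have "(\<lambda>n. T * real (k n u) / 2 ^ n) \<longlonglongrightarrow> u"
    proof (rule LIMSEQ_I)
      fix e :: real assume "e > 0"
      have "(\<lambda>n. T * (1 / 2) ^ n) \<longlonglongrightarrow> T * 0"
        by (intro tendsto_mult_left LIMSEQ_power_zero) simp
      then have "\<exists>N. \<forall>n\<ge>N. T * (1 / 2) ^ n < e"
        using \<open>e > 0\<close> order_tendstoD(2)[of _ "T * 0" sequentially e] by (auto simp: eventually_sequentially)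
      moreover have "norm (T * real (k n u) / 2 ^ n - u) \<le> T * (1 / 2) ^ n" for n
      proof -
        have "\<bar>real (k n u) - 2 ^ n * u / T\<bar> \<le> 1"
          using k(1,2)[OF u, of n] by linarith
        then have "T / 2 ^ n * \<bar>real (k n u) - 2 ^ n * u / T\<bar> \<le> T / 2 ^ n * 1"
          using assms(1) by (intro mult_left_mono) auto
        moreover have "T * real (k n u) / 2 ^ n - u = T / 2 ^ n * (real (k n u) - 2 ^ n * u / T)"
          using assms(1) by (simp add: field_simps)
        ultimately show ?thesis
          using assms(1) by (simp add: abs_mult power_one_over)
      qed
      ultimately show "\<exists>N. \<forall>n\<ge>N. norm (T * real (k n u) / 2 ^ n - u) < e"
        by (meson le_less_trans)
    qed
    moreover have "T * real (k n u) / 2 ^ n \<in> {0..T}" for n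
    proof -
      have "real (k n u) \<le> 2 ^ n"
        using k(3)[OF u, of n] by (metis of_nat_le_iff of_nat_numeral of_nat_power)
      then show ?thesis using assms(1) by (simp add: field_simps)
    qed
    ultimately show ?thesis
      unfolding g_def using u by (intro continuous_on_tendsto_compose[OF cont] always_eventually allI)
  qed
  have tail: "\<bar>f u - g n u\<bar> \<le> B * C * r ^ n" if u: "u \<in> {0..T}" for n u
  proof (rule LIMSEQ_le_const2)
    show "(\<lambda>j. \<bar>g (j + n) u - g n u\<bar>) \<longlonglongrightarrow> \<bar>f u - g n u\<bar>"
      by (intro tendsto_intros LIMSEQ_ignore_initial_segment lim u)
    have "B * C * (r ^ n - r ^ (n + j)) \<le> B * C * r ^ n" for j
      using assms(3) C r by (intro mult_left_mono) auto
    then show "\<exists>N. \<forall>j\<ge>N. \<bar>g (j + n) u - g n u\<bar> \<le> B * C * r ^ n"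
      using chain[OF u, of n] by (metis add.commute order_trans)
  qed
  have main: "\<bar>f v - f u\<bar> \<le> (2 * C + 1) * 2 powr \<alpha> / T powr \<alpha> * B * (v - u) powr \<alpha>"
    if uv: "u \<in> {0..T}" "v \<in> {0..T}" "u < v" for u v
  proof -
    have ex: "\<exists>n. T / 2 ^ Suc n < v - u"
    proof -
      obtain n where "(1 / 2) ^ n < (v - u) / T"
        using real_arch_pow_inv[of "(v - u) / T" "1 / 2"] uv assms(1) by auto
      then have "T / 2 ^ n < v - u"
        using assms(1) by (simp add: field_simps power_divide)
      moreover have "T / 2 ^ Suc n \<le> T / 2 ^ n"
        using assms(1) by (simp add: field_simps)
      ultimately show ?thesis by (meson le_less_trans)
    qed
    \<comment> \<open>Minimality gives \<open>v - u \<le> T / 2 ^ n\<close> as well; at level 0 this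
      holds because both points lie in \<open>{0..T}\<close>.\<close>
    define n where "n = (LEAST n. T / 2 ^ Suc n < v - u)"
    have n: "T / 2 ^ Suc n < v - u"
      unfolding n_def using ex by (rule LeastI_ex)
    have n': "v - u \<le> T / 2 ^ n"
    proof (cases n)
      case (Suc m)
      then have "\<not> T / 2 ^ Suc m < v - u"
        unfolding n_def by (metis lessI not_less_Least)
      then show ?thesis unfolding Suc by linarith
    qed (use uv in auto)
    have "2 ^ n * v / T \<le> 2 ^ n * u / T + 1"
      using n' assms(1) by (simp add: field_simps)
    moreover have "2 ^ n * u / T \<le> 2 ^ n * v / T"
      using uv assms(1) by (intro divide_right_mono mult_left_mono) auto
    ultimately have "real (k n v) < real (k n u) + 2" "real (k n u) < real (k n v) + 1"
      using k(1,2)[OF uv(1), of n] k(1,2)[OF uv(2), of n] by linarith+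
    then have "k n v = k n u \<or> k n v = Suc (k n u)" by linarith
    then have "\<bar>g n v - g n u\<bar> \<le> B * r ^ n"
    proof (elim disjE)
      assume "k n v = k n u"
      then show ?thesis using assms(3) r by (simp add: g_def)
    next
      assume s: "k n v = Suc (k n u)"
      then have "k n u < 2 ^ n" using k(3)[OF uv(2), of n] by simp
      from inc[OF this] show ?thesis unfolding g_def s r_def .
    qed
    then have "\<bar>f v - f u\<bar> \<le> (2 * C + 1) * B * r ^ n"
      using tail[OF uv(1), of n] tail[OF uv(2), of n] by (simp add: algebra_simps)
    also have "r ^ n = 2 powr \<alpha> / T powr \<alpha> * (T / 2 ^ Suc n) powr \<alpha>"
    proof -
      have "r ^ n = 2 powr (- \<alpha> * real n)"
        by (simp add: r_def powr_powr flip: powr_realpow)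
      also have "\<dots> = 2 powr \<alpha> * 2 powr (- (real (Suc n) * \<alpha>))"
        by (simp add: algebra_simps flip: powr_add)
      also have "2 powr (- (real (Suc n) * \<alpha>)) = (T / 2 ^ Suc n) powr \<alpha> / T powr \<alpha>"
        using assms(1) by (simp add: powr_divide powr_powr powr_minus_divide del: power_Suc flip: powr_realpow)
      finally show ?thesis by simp
    qed
    also have "(2 * C + 1) * B * (2 powr \<alpha> / T powr \<alpha> * (T / 2 ^ Suc n) powr \<alpha>) \<le>
        (2 * C + 1) * B * (2 powr \<alpha> / T powr \<alpha> * (v - u) powr \<alpha>)"
      using n C assms by (intro mult_left_mono powr_mono2) auto
    finally show ?thesis by (simp add: mult_ac)
  qed
  have "s < t \<or> t < s \<or> s = t" by linarith
  then show ?thesis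
    using main[OF assms(6,7)] main[OF assms(7,6)] assms(2) unfolding C_def r_def
    by (elim disjE) (auto simp: abs_minus_commute)
qed

text \<open>A dominating function is produced, instead of an estimate of the supremum over
  uncountably many pairs, so that monotonicity of the nonnegative integral settles the matter later.
  It is built from the sum \<open>S\<close> of all normalised dyadic increments to the power
  \<open>q\<close>; finiteness of \<open>S\<close> bounds each of them at once.\<close>

lemma (in prob_space) kolmogorov_hoelder_moment:
  fixes Z :: "real \<Rightarrow> 'a \<Rightarrow> real"
  assumes "0 < T" "\<alpha> < 1 / 2" "0 < p"
    and cont: "\<And>\<omega>. \<omega> \<in> space M \<Longrightarrow> continuous_on {0..T} (\<lambda>t. Z t \<omega>)"
    and meas: "\<And>t. t \<in> {0..T} \<Longrightarrow> Z t \<in> borel_measurable M"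
    and moment: "\<And>q. 0 < q \<Longrightarrow> \<exists>C\<ge>0. \<forall>s t. 0 \<le> s \<longrightarrow> s < t \<longrightarrow> t \<le> T \<longrightarrow>
      (\<integral>\<^sup>+\<omega>. ennreal (\<bar>Z t \<omega> - Z s \<omega>\<bar> powr q) \<partial>M) \<le> ennreal (C * (t - s) powr (q / 2))"
  obtains B :: "'a \<Rightarrow> ennreal" where "(\<integral>\<^sup>+\<omega>. B \<omega> \<partial>M) < \<infinity>"
    "\<And>\<omega> s t. \<omega> \<in> space M \<Longrightarrow> s \<in> {0..T} \<Longrightarrow> t \<in> {0..T} \<Longrightarrow> s \<noteq> t \<Longrightarrow>
      ennreal ((\<bar>Z t \<omega> - Z s \<omega>\<bar> / \<bar>t - s\<bar> powr \<alpha>) powr p) \<le> B \<omega>"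
proof -
  \<comment> \<open>\<open>\<alpha>\<close> may be zero or negative, so chaining uses a positive
    exponent not below it; on \<open>{0..T}\<close> the change of exponent costs the factor
    \<open>T powr (a - \<alpha>)\<close>.\<close>
  define a where "a = max \<alpha> (1 / 4)"
  have a: "0 < a" "a < 1 / 2" "\<alpha> \<le> a" using assms(2) by (auto simp: a_def)
  \<comment> \<open>Level n has 2^n increments, and the normalised moment of each is of order 2^(-n
    q (1/2 - a)). This choice makes that at most 2^(-2n), leaving a geometric series;
    \<open>p \<le> q\<close> later allows \<open>b powr (p / q) \<le> 1 + b\<close>.\<close>
  define q where "q = max p (2 / (1 / 2 - a))"
  have q: "0 < q" "p \<le> q" "2 \<le> q * (1 / 2 - a)"
  proof -
    show "0 < q" "p \<le> q" using assms(3) by (auto simp: q_def)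
    have "2 / (1 / 2 - a) \<le> q" by (simp add: q_def)
    then show "2 \<le> q * (1 / 2 - a)" using a(2) by (simp add: pos_divide_le_eq)
  qed
  obtain C where C: "0 \<le> C" "\<And>s t. 0 \<le> s \<Longrightarrow> s < t \<Longrightarrow> t \<le> T \<Longrightarrow>
      (\<integral>\<^sup>+\<omega>. ennreal (\<bar>Z t \<omega> - Z s \<omega>\<bar> powr q) \<partial>M) \<le> ennreal (C * (t - s) powr (q / 2))"
    using moment[OF q(1)] by blast
  define r where "r = (2 :: real) powr - a"
  have r: "0 < r" by (simp add: r_def)
  define D where "D n i \<omega> = \<bar>Z (T * real (Suc i) / 2 ^ n) \<omega> - Z (T * real i / 2 ^ n) \<omega>\<bar>" for n i \<omega>
  define S where "S \<omega> = (\<Sum>n. \<Sum>i<2 ^ n. ennreal ((D n i \<omega> / r ^ n) powr q))" for \<omega>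
  have pt: "T * real i / 2 ^ n \<in> {0..T}" if "i \<le> 2 ^ n" for i n
  proof -
    have "real i \<le> 2 ^ n"
      using that by (metis of_nat_le_iff of_nat_numeral of_nat_power)
    then show ?thesis using assms(1) by (simp add: field_simps)
  qed
  have [measurable]: "D n i \<in> borel_measurable M" if "i < 2 ^ n" for n i
    unfolding D_def[abs_def] using pt[of i n] pt[of "Suc i" n] that
    by (intro borel_measurable_abs borel_measurable_diff meas) auto
  define K where "K = C * T powr (q / 2)"
  have K: "0 \<le> K" using C by (simp add: K_def)
  have Dint: "(\<integral>\<^sup>+\<omega>. ennreal ((D n i \<omega> / r ^ n) powr q) \<partial>M) \<le> ennreal (K * 2 powr (- 2 * real n))"
    if i: "i < 2 ^ n" for n i
  proof -
    have [measurable]: "D n i \<in> borel_measurable M" using i by measurable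
    have "(\<integral>\<^sup>+\<omega>. ennreal ((D n i \<omega> / r ^ n) powr q) \<partial>M) = (\<integral>\<^sup>+\<omega>. ennreal (1 / (r ^ n) powr q) * ennreal (D n i \<omega> powr q) \<partial>M)"
      using r by (intro nn_integral_cong) (simp add: D_def powr_divide flip: ennreal_mult)
    also have "\<dots> = ennreal (1 / (r ^ n) powr q) * (\<integral>\<^sup>+\<omega>. ennreal (D n i \<omega> powr q) \<partial>M)"
      by (rule nn_integral_cmult) measurable
    also have "\<dots> \<le> ennreal (1 / (r ^ n) powr q) * ennreal (C * (T * real (Suc i) / 2 ^ n - T * real i / 2 ^ n) powr (q / 2))"
      unfolding D_def using pt[of i n] pt[of "Suc i" n] i assms(1)
      by (intro mult_left_mono C) (auto simp: divide_strict_right_mono)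
    also have "T * real (Suc i) / 2 ^ n - T * real i / 2 ^ n = T / 2 ^ n"
      by (simp add: field_simps)
    also have "ennreal (1 / (r ^ n) powr q) * ennreal (C * (T / 2 ^ n) powr (q / 2)) =
        ennreal (1 / (r ^ n) powr q * (C * (T / 2 ^ n) powr (q / 2)))"
      by (rule ennreal_mult[symmetric]) (use C in auto)
    also have "1 / (r ^ n) powr q * (C * (T / 2 ^ n) powr (q / 2)) = K * 2 powr (- (real n * (q * (1 / 2 - a))))"
    proof -
      have "r ^ n = 2 powr (- (a * real n))"
        by (simp add: r_def powr_powr flip: powr_realpow)
      then have "1 / (r ^ n) powr q = 2 powr (a * real n * q)"
        by (simp add: powr_powr powr_divide powr_minus_divide)
      moreover have "(T / 2 ^ n) powr (q / 2) = T powr (q / 2) * 2 powr (- (real n * q / 2))"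
        using assms(1) by (simp add: powr_divide powr_powr powr_minus_divide flip: powr_realpow)
      ultimately show ?thesis
        by (simp add: K_def algebra_simps flip: powr_add)
    qed
    also have "ennreal (K * 2 powr (- (real n * (q * (1 / 2 - a))))) \<le> ennreal (K * 2 powr (- 2 * real n))"
    proof -
      have "real n * 2 \<le> real n * (q * (1 / 2 - a))"
        using q(3) by (intro mult_left_mono) auto
      then show ?thesis
        using K by (intro ennreal_leI mult_left_mono powr_mono) auto
    qed
    finally show ?thesis .
  qed
  have [measurable]: "(\<lambda>\<omega>. \<Sum>i<2 ^ n. ennreal ((D n i \<omega> / r ^ n) powr q)) \<in> borel_measurable M" for n
    by (intro borel_measurable_sum) auto
  have [measurable]: "S \<in> borel_measurable M"
    unfolding S_def[abs_def] by measurable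
  have "(\<integral>\<^sup>+\<omega>. S \<omega> \<partial>M) = (\<Sum>n. \<Sum>i<2 ^ n. \<integral>\<^sup>+\<omega>. ennreal ((D n i \<omega> / r ^ n) powr q) \<partial>M)"
    unfolding S_def
  proof (subst nn_integral_suminf)
    show "(\<Sum>n. \<integral>\<^sup>+\<omega>. (\<Sum>i<2 ^ n. ennreal ((D n i \<omega> / r ^ n) powr q)) \<partial>M) =
        (\<Sum>n. \<Sum>i<2 ^ n. \<integral>\<^sup>+\<omega>. ennreal ((D n i \<omega> / r ^ n) powr q) \<partial>M)"
      by (intro suminf_cong nn_integral_sum) auto
  qed measurable
  also have "\<dots> \<le> (\<Sum>n. ennreal (K * (1 / 2) ^ n))"
  proof (rule suminf_le)
    fix n
    have "(\<Sum>i<2 ^ n. \<integral>\<^sup>+\<omega>. ennreal ((D n i \<omega> / r ^ n) powr q) \<partial>M) \<le> (\<Sum>i<2 ^ n :: nat. ennreal (K * 2 powr (- 2 * real n)))"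
      by (intro sum_mono Dint) auto
    also have "\<dots> = ennreal (2 ^ n * (K * 2 powr (- 2 * real n)))"
      using K by (simp add: ennreal_mult ennreal_of_nat_eq_real_of_nat)
    also have "2 ^ n * (K * 2 powr (- 2 * real n)) = K * (1 / 2) ^ n"
    proof -
      have "(2::real) ^ n * 2 powr (- 2 * real n) = 2 powr (real n + - 2 * real n)"
        unfolding powr_add by (simp add: powr_realpow)
      also have "\<dots> = (1 / 2) ^ n"
        by (simp add: powr_minus_divide powr_realpow power_one_over)
      finally show ?thesis by (simp add: mult_ac)
    qed
    finally show "(\<Sum>i<2 ^ n. \<integral>\<^sup>+\<omega>. ennreal ((D n i \<omega> / r ^ n) powr q) \<partial>M) \<le> ennreal (K * (1 / 2) ^ n)" .
  qed auto
  also have "\<dots> < \<infinity>"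
    using K by (subst suminf_ennreal2) (auto intro!: summable_mult summable_geometric)
  finally have Sfin: "(\<integral>\<^sup>+\<omega>. S \<omega> \<partial>M) < \<infinity>" .
  define C\<^sub>0 where "C\<^sub>0 = (2 / (1 - 2 powr - a) + 1) * 2 powr a / T powr a"
  have "2 powr - a < (1 :: real)"
    using a(1) powr_less_mono[of "- a" 0 "2 :: real"] by simp
  then have C0: "0 \<le> C\<^sub>0"
    using assms(1) by (simp add: C\<^sub>0_def)
  \<comment> \<open>The summand 1 makes \<open>L\<close> positive, so that the dominating function
    is infinite wherever \<open>S\<close> is.\<close>
  define L where "L = (C\<^sub>0 * T powr (a - \<alpha>)) powr p + 1"
  have L: "0 < L" by (simp add: L_def add_nonneg_pos)
  show ?thesis
  proof (rule that[of "\<lambda>\<omega>. ennreal L * (1 + S \<omega>)"])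
    have "(\<integral>\<^sup>+\<omega>. ennreal L * (1 + S \<omega>) \<partial>M) = ennreal L * (1 + (\<integral>\<^sup>+\<omega>. S \<omega> \<partial>M))"
      by (subst nn_integral_cmult, measurable, subst nn_integral_add) (auto simp: emeasure_space_1)
    also have "\<dots> < \<infinity>"
      using Sfin by (simp add: ennreal_mult_less_top)
    finally show "(\<integral>\<^sup>+\<omega>. ennreal L * (1 + S \<omega>) \<partial>M) < \<infinity>" .
  next
    fix \<omega> s t
    assume w: "\<omega> \<in> space M" and st: "s \<in> {0..T}" "t \<in> {0..T}" "s \<noteq> t"
    show "ennreal ((\<bar>Z t \<omega> - Z s \<omega>\<bar> / \<bar>t - s\<bar> powr \<alpha>) powr p) \<le> ennreal L * (1 + S \<omega>)"
    proof (cases "S \<omega> = \<infinity>")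
      case True
      then show ?thesis using L by (simp add: ennreal_mult_top)
    next
      case False
      define b where "b = enn2real (S \<omega>)"
      have Sb: "S \<omega> = ennreal b" and b: "0 \<le> b"
        using False by (auto simp: b_def less_top)
      have inc: "\<bar>Z (T * real (Suc i) / 2 ^ n) \<omega> - Z (T * real i / 2 ^ n) \<omega>\<bar> \<le> b powr (1 / q) * (2 powr - a) ^ n"
        if i: "i < 2 ^ n" for n i
      proof -
        have "ennreal ((D n i \<omega> / r ^ n) powr q) \<le> (\<Sum>i<2 ^ n. ennreal ((D n i \<omega> / r ^ n) powr q))"
          using i by (intro member_le_sum) auto
        also have "\<dots> \<le> S \<omega>"
          unfolding S_def
          using sum_le_suminf[of "\<lambda>n. \<Sum>i<2 ^ n. ennreal ((D n i \<omega> / r ^ n) powr q)" "{n}"] by simp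
        finally have "(D n i \<omega> / r ^ n) powr q \<le> b"
          using b by (simp add: Sb)
        then have "((D n i \<omega> / r ^ n) powr q) powr (1 / q) \<le> b powr (1 / q)"
          using q(1) by (intro powr_mono2) auto
        then have "D n i \<omega> / r ^ n \<le> b powr (1 / q)"
          using q(1) r by (simp add: powr_powr D_def)
        then show ?thesis
          using r by (simp add: D_def r_def[symmetric] field_simps)
      qed
      have d: "0 < \<bar>t - s\<bar>" "\<bar>t - s\<bar> \<le> T" using st by auto
      have "\<bar>Z t \<omega> - Z s \<omega>\<bar> \<le> C\<^sub>0 * b powr (1 / q) * \<bar>t - s\<bar> powr a"
        unfolding C\<^sub>0_def
        by (rule dyadic_increments_imp_hoelder[OF assms(1) a(1) _ cont[OF w] inc st(1,2)]) auto
      also have "\<bar>t - s\<bar> powr a = \<bar>t - s\<bar> powr (a - \<alpha>) * \<bar>t - s\<bar> powr \<alpha>"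
        by (simp flip: powr_add)
      also have "C\<^sub>0 * b powr (1 / q) * (\<bar>t - s\<bar> powr (a - \<alpha>) * \<bar>t - s\<bar> powr \<alpha>) \<le>
          C\<^sub>0 * b powr (1 / q) * (T powr (a - \<alpha>) * \<bar>t - s\<bar> powr \<alpha>)"
        using C0 d a(3) by (intro mult_left_mono mult_right_mono powr_mono2) auto
      finally have "\<bar>Z t \<omega> - Z s \<omega>\<bar> / \<bar>t - s\<bar> powr \<alpha> \<le> (C\<^sub>0 * T powr (a - \<alpha>)) * b powr (1 / q)"
        using d by (simp add: field_simps)
      then have "(\<bar>Z t \<omega> - Z s \<omega>\<bar> / \<bar>t - s\<bar> powr \<alpha>) powr p \<le> ((C\<^sub>0 * T powr (a - \<alpha>)) * b powr (1 / q)) powr p"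
        using assms(3) by (intro powr_mono2) auto
      also have "\<dots> = (C\<^sub>0 * T powr (a - \<alpha>)) powr p * b powr (p / q)"
        using C0 by (simp add: powr_mult powr_powr)
      also have "\<dots> \<le> L * (1 + b)"
      proof (intro mult_mono)
        have pq: "0 \<le> p / q" "p / q \<le> 1" using q assms(3) by auto
        show "b powr (p / q) \<le> 1 + b"
        proof (cases "b \<le> 1")
          case True
          then have "b powr (p / q) \<le> 1" using b pq by (intro powr_le1) auto
          then show ?thesis using b by linarith
        next
          case False
          then have "b powr (p / q) \<le> b powr 1" using pq by (intro powr_mono) auto
          then show ?thesis using False by simp
        qed
      qed (use L in \<open>auto simp: L_def\<close>)
      finally show ?thesis
        unfolding Sb using L b
        by (simp add: ennreal_leI flip: ennreal_mult ennreal_plus ennreal_1)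
    qed
  qed
qed

section \<open>Powers on [0,infinity] and finiteness of the two norms\<close>

lemma ennpowr_less_top: "y < \<infinity> \<Longrightarrow> ennpowr y p < \<infinity>"
  by (simp add: ennpowr_def)

lemma ennpowr_ennreal: "0 \<le> y \<Longrightarrow> ennpowr (ennreal y) p = ennreal (y powr p)"
  by (simp add: ennpowr_def)

lemma ennpowr_le:
  assumes "y \<le> ennreal C" "0 \<le> C" "0 < p"
  shows "ennpowr y p \<le> ennreal (C powr p)"
proof -
  have "y < \<infinity>" using assms(1) by (rule le_less_trans) simp
  moreover have "enn2real y \<le> C" using assms(1,2) by (rule enn2real_leI[rotated])
  ultimately show ?thesis
    using assms(3) by (auto simp: ennpowr_def intro!: ennreal_leI powr_mono2)
qed

text \<open>Taking roots turns the bounds on the individual powers into one bound on the supremum,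
  to which the power is applied again; an infinite \<open>b\<close> is trivial.\<close>

lemma ennpowr_SUP_le:
  assumes "0 < p" and v: "\<And>i. i \<in> I \<Longrightarrow> 0 \<le> v i" "\<And>i. i \<in> I \<Longrightarrow> ennreal (v i powr p) \<le> b"
  shows "ennpowr (SUP i\<in>I. ennreal (v i)) p \<le> b"
proof (cases b)
  case (real c)
  have "(SUP i\<in>I. ennreal (v i)) \<le> ennreal (c powr (1 / p))"
  proof (rule SUP_least)
    fix i assume i: "i \<in> I"
    then have "v i powr p \<le> c" using v(2)[OF i] real by simp
    then have "(v i powr p) powr (1 / p) \<le> c powr (1 / p)"
      using assms(1) by (intro powr_mono2) auto
    then show "ennreal (v i) \<le> ennreal (c powr (1 / p))"
      using assms(1) v(1)[OF i] by (intro ennreal_leI) (simp add: powr_powr)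
  qed
  then have "ennpowr (SUP i\<in>I. ennreal (v i)) p \<le> ennreal ((c powr (1 / p)) powr p)"
    using assms(1) by (intro ennpowr_le) auto
  then show ?thesis
    using real assms(1) by (simp add: powr_powr)
qed simp

theorem theorem1p2:
  fixes x \<beta> \<delta> \<gamma> :: real
    and M :: "'a measure" and F :: "real \<Rightarrow> 'a measure"
    and W X Z :: "real \<Rightarrow> 'a \<Rightarrow> real"
  assumes "0 < x" and "0 < \<beta>" and "0 \<le> \<delta>"
    and "stochastic_basis M F"
    and "standard_wiener_process M F W"
    and "\<And>t \<omega>. 0 \<le> t \<Longrightarrow> \<omega> \<in> space M \<Longrightarrow> 0 \<le> X t \<omega>"
    and "adapted_process F X"
    and "\<And>\<omega>. \<omega> \<in> space M \<Longrightarrow> continuous_on {0..} (\<lambda>t. X t \<omega>)"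
    and "solves_sde M F W (\<lambda>y. \<delta> - \<gamma> * y) (\<lambda>y. \<beta> * sqrt y) X"
    and "AE \<omega> in M. X 0 \<omega> = x"
    and "\<And>t \<omega>. 0 \<le> t \<Longrightarrow> \<omega> \<in> space M \<Longrightarrow> Z t \<omega> = sqrt (X t \<omega>)"
  shows "\<forall>T>0. \<forall>\<epsilon>>0. \<forall>p>0.
    (SUP (s, t) \<in> {(s, t). s \<in> {0..T} \<and> t \<in> {0..T} \<and> s \<noteq> t}.
       Lp_norm M p (\<lambda>\<omega>. ennreal \<bar>(Z t \<omega> - Z s \<omega>) / \<bar>t - s\<bar> powr (1 / 2)\<bar>))
    + Lp_norm M p (\<lambda>\<omega>.
        SUP (s, t) \<in> {(s, t). s \<in> {0..T} \<and> t \<in> {0..T} \<and> s \<noteq> t}.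
          ennreal (\<bar>Z t \<omega> - Z s \<omega>\<bar> / \<bar>t - s\<bar> powr (1 / 2 - \<epsilon>)))
    < \<infinity>"
proof (intro allI impI)
  fix T \<epsilon> p :: real
  assume T: "0 < T" and eps: "0 < \<epsilon>" and p: "0 < p"
  interpret standard_wiener_process M F W by fact
  interpret cir_process M F W x \<beta> \<delta> \<gamma> X
    by unfold_locales (use assms in auto)
  have Z: "Z t \<omega> = sqrt (X t \<omega>)" if "t \<in> {0..T}" "\<omega> \<in> space M" for t \<omega>
    using assms(11) that by simp
  have Z_measurable: "Z t \<in> borel_measurable M" if "t \<in> {0..T}" for t
    using X_measurable_M[of t] that by (subst measurable_cong[OF Z[OF that]]) auto
  have Z_continuous: "continuous_on {0..T} (\<lambda>t. Z t \<omega>)" if "\<omega> \<in> space M" for \<omega>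
    by (rule continuous_on_eq[OF continuous_on_real_sqrt[OF X_continuous_Icc[OF that order_refl]]])
      (simp add: Z that)
  have moment: "\<exists>C\<ge>0. \<forall>s t. 0 \<le> s \<longrightarrow> s < t \<longrightarrow> t \<le> T \<longrightarrow>
      (\<integral>\<^sup>+\<omega>. ennreal (\<bar>Z t \<omega> - Z s \<omega>\<bar> powr q) \<partial>M) \<le> ennreal (C * (t - s) powr (q / 2))" if q: "0 < q" for q
  proof -
    obtain C where C: "0 \<le> C" "\<And>s t. 0 \<le> s \<Longrightarrow> s < t \<Longrightarrow> t \<le> T \<Longrightarrow>
        (\<integral>\<^sup>+\<omega>. ennreal (\<bar>sqrt (X t \<omega>) - sqrt (X s \<omega>)\<bar> powr q) \<partial>M) \<le> ennreal (C * (t - s) powr (q / 2))"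
      using sqrt_increment_moment[OF q] by blast
    have "(\<integral>\<^sup>+\<omega>. ennreal (\<bar>Z t \<omega> - Z s \<omega>\<bar> powr q) \<partial>M) \<le> ennreal (C * (t - s) powr (q / 2))"
      if st: "0 \<le> s" "s < t" "t \<le> T" for s t
      using C(2)[OF st] st by (subst nn_integral_cong[where v="\<lambda>\<omega>. ennreal (\<bar>sqrt (X t \<omega>) - sqrt (X s \<omega>)\<bar> powr q)"]) (auto simp: Z)
    then show ?thesis using C(1) by blast
  qed
  let ?I = "{(s, t). s \<in> {0..T} \<and> t \<in> {0..T} \<and> s \<noteq> t}"
  have "(SUP (s, t) \<in> ?I. Lp_norm M p (\<lambda>\<omega>. ennreal \<bar>(Z t \<omega> - Z s \<omega>) / \<bar>t - s\<bar> powr (1 / 2)\<bar>)) < \<infinity>"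
  proof -
    obtain C where C: "0 \<le> C" "\<And>s t. 0 \<le> s \<Longrightarrow> s < t \<Longrightarrow> t \<le> T \<Longrightarrow>
        (\<integral>\<^sup>+\<omega>. ennreal (\<bar>Z t \<omega> - Z s \<omega>\<bar> powr p) \<partial>M) \<le> ennreal (C * (t - s) powr (p / 2))"
      using moment[OF p] by blast
    have "Lp_norm M p (\<lambda>\<omega>. ennreal \<bar>(Z t \<omega> - Z s \<omega>) / \<bar>t - s\<bar> powr (1 / 2)\<bar>) \<le> ennreal (C powr (1 / p))"
      if st: "s \<in> {0..T}" "t \<in> {0..T}" "s \<noteq> t" for s t
    proof -
      note [measurable] = Z_measurable[OF st(1)] Z_measurable[OF st(2)]
      have d: "0 < \<bar>t - s\<bar>" using st by simp
      have "(\<integral>\<^sup>+\<omega>. ennpowr (ennreal \<bar>(Z t \<omega> - Z s \<omega>) / \<bar>t - s\<bar> powr (1 / 2)\<bar>) p \<partial>M) =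
          (\<integral>\<^sup>+\<omega>. ennreal (1 / \<bar>t - s\<bar> powr (p / 2)) * ennreal (\<bar>Z t \<omega> - Z s \<omega>\<bar> powr p) \<partial>M)"
        by (intro nn_integral_cong)
          (simp add: ennpowr_ennreal powr_divide powr_powr flip: ennreal_mult)
      also have "\<dots> = ennreal (1 / \<bar>t - s\<bar> powr (p / 2)) * (\<integral>\<^sup>+\<omega>. ennreal (\<bar>Z t \<omega> - Z s \<omega>\<bar> powr p) \<partial>M)"
        by (rule nn_integral_cmult) measurable
      also have "\<dots> \<le> ennreal (1 / \<bar>t - s\<bar> powr (p / 2)) * ennreal (C * \<bar>t - s\<bar> powr (p / 2))"
      proof (rule mult_left_mono)
        show "(\<integral>\<^sup>+\<omega>. ennreal (\<bar>Z t \<omega> - Z s \<omega>\<bar> powr p) \<partial>M) \<le> ennreal (C * \<bar>t - s\<bar> powr (p / 2))"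
        proof (cases "s < t")
          case True
          then show ?thesis using C(2)[of s t] st by simp
        next
          \<comment> \<open>The moment bound is stated for ordered times; the other order follows
            from the symmetry of the absolute value.\<close>
          case False
          then show ?thesis using C(2)[of t s] st by (simp add: abs_minus_commute)
        qed
      qed simp
      also have "\<dots> = ennreal C"
        using C(1) d by (simp flip: ennreal_mult)
      finally show ?thesis
        unfolding Lp_norm_def using C(1) p by (intro ennpowr_le) auto
    qed
    then have "(SUP (s, t) \<in> ?I. Lp_norm M p (\<lambda>\<omega>. ennreal \<bar>(Z t \<omega> - Z s \<omega>) / \<bar>t - s\<bar> powr (1 / 2)\<bar>)) \<le> ennreal (C powr (1 / p))"
      by (intro SUP_least) auto
    then show ?thesis by (rule le_less_trans) simp
  qed
  moreover have "Lp_norm M p (\<lambda>\<omega>. SUP (s, t) \<in> ?I. ennreal (\<bar>Z t \<omega> - Z s \<omega>\<bar> / \<bar>t - s\<bar> powr (1 / 2 - \<epsilon>))) < \<infinity>"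
  proof -
    obtain B :: "'a \<Rightarrow> ennreal" where B: "(\<integral>\<^sup>+\<omega>. B \<omega> \<partial>M) < \<infinity>"
      "\<And>\<omega> s t. \<omega> \<in> space M \<Longrightarrow> s \<in> {0..T} \<Longrightarrow> t \<in> {0..T} \<Longrightarrow> s \<noteq> t \<Longrightarrow>
        ennreal ((\<bar>Z t \<omega> - Z s \<omega>\<bar> / \<bar>t - s\<bar> powr (1 / 2 - \<epsilon>)) powr p) \<le> B \<omega>"
      using kolmogorov_hoelder_moment[OF T _ p Z_continuous Z_measurable moment, of "1 / 2 - \<epsilon>"] eps
      by (metis diff_less_eq less_add_same_cancel1)
    have "(\<integral>\<^sup>+\<omega>. ennpowr (SUP (s, t) \<in> ?I. ennreal (\<bar>Z t \<omega> - Z s \<omega>\<bar> / \<bar>t - s\<bar> powr (1 / 2 - \<epsilon>))) p \<partial>M) \<le>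
        (\<integral>\<^sup>+\<omega>. B \<omega> \<partial>M)"
    proof (rule nn_integral_mono)
      fix \<omega> assume w: "\<omega> \<in> space M"
      show "ennpowr (SUP (s, t) \<in> ?I. ennreal (\<bar>Z t \<omega> - Z s \<omega>\<bar> / \<bar>t - s\<bar> powr (1 / 2 - \<epsilon>))) p \<le> B \<omega>"
        using B(2)[OF w] ennpowr_SUP_le[OF p, of ?I "\<lambda>(s, t). \<bar>Z t \<omega> - Z s \<omega>\<bar> / \<bar>t - s\<bar> powr (1 / 2 - \<epsilon>)" "B \<omega>"]
        by (auto simp: case_prod_unfold)
    qed
    then show ?thesis
      unfolding Lp_norm_def by (intro ennpowr_less_top) (rule le_less_trans[OF _ B(1)])
  qed
  ultimately show "(SUP (s, t) \<in> ?I.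
       Lp_norm M p (\<lambda>\<omega>. ennreal \<bar>(Z t \<omega> - Z s \<omega>) / \<bar>t - s\<bar> powr (1 / 2)\<bar>))
    + Lp_norm M p (\<lambda>\<omega>. SUP (s, t) \<in> ?I. ennreal (\<bar>Z t \<omega> - Z s \<omega>\<bar> / \<bar>t - s\<bar> powr (1 / 2 - \<epsilon>))) < \<infinity>"
    by simp
qed

end
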